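(* Fix one of the ground state sequences (A) or (B) and $m\in\mathbb Z$. The normally ordered semi-infinite wedges in $\mathcal F_m$ form a basis of the $\mathbb Q(q)$-vector space $\mathcal F_m$. Here a normally ordered semi-infinite wedge is (the image in $\mathcal F_m$ of) $G(c_m)\wedge G(c_{m+1})\wedge\cdots\wedge G(c_{m+r-1})\wedge\overline{|m+r\rangle}$ where $(c_m,c_{m+1},\dots)$ is a sequence in $B_{\mathrm{aff}}$ with $c_s=b^\circ_s$ for all $s\ge m+r$, and $H(c_s\otimes c_{s+1})>0$ for all $s\ge m$.
   Context: Let $\mathfrak g=\widehat{\mathfrak{sl}}_2$, $I=\{0,1\}$, weight lattice $P=\mathbb Z\Lambda_0\oplus\mathbb Z\Lambda_1\oplus\mathbb Z\delta$, coroots $h_0,h_1$ with $\langle h_i,\Lambda_j\rangle=\delta_{ij}$, $\langle h_i,\delta\rangle=0$, central element $c=h_0+h_1$. $U_q(\mathfrak g)$ is the quantum affine algebra over $\mathbb Q(q)$ with generators $e_i,f_i$ ($i\in I$), $q^h$ ($h\in P^*$), $t_i=q^{h_i}$, and coproduct $\Delta(q^h)=q^h\otimes q^h$, $\Delta(e_i)=e_i\otimes1+t_i^{-1}\otimes e_i$, $\Delta(f_i)=f_i\otimes t_i+1\otimes f_i$. $[n]=(q^n-q^{-n})/(q-q^{-1})$; $A\subset\mathbb Q(q)$ is the ring of rational functions regular at $q=0$. Let $J=\{0,1,2\}$. $V_{\mathrm{aff}}$ is the $\mathbb Q(q)$-space with basis $z^av_j$ ($a\in\mathbb Z$, $j\in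 J$), a $U_q(\mathfrak g)$-module via: $\mathrm{wt}(z^av_j)=2(1-j)(\Lambda_1-\Lambda_0)+a\delta$, $q^hz^av_j=q^{\langle h,\mathrm{wt}(z^av_j)\rangle}z^av_j$, $e_1z^av_j=[3-j]z^av_{j-1}$, $f_1z^av_j=[j+1]z^av_{j+1}$, $e_0z^av_j=[j+1]z^{a+1}v_{j+1}$, $f_0z^av_j=[3-j]z^{a-1}v_{j-1}$ (with $v_{-1}=v_3=0$). The operator $z^b$ sends $z^av_j\mapsto z^{a+b}v_j$. The crystal of $V_{\mathrm{aff}}$ is $B_{\mathrm{aff}}=\{z^ab_j\}$ with lower global base $G(z^ab_j)=z^av_j$; the energy function is $H(z^ab_i\otimes z^{a'}b_j)=\min\{i,2-j\}-a+a'$. $N\subset V_{\mathrm{aff}}\otimes V_{\mathrm{aff}}$ is the smallest subspace containing $v_0\otimes v_0$ that is stable under the action of $U_q(\mathfrak g)$ (via $\Delta$) and under the operators $z\otimes z$, $z^{-1}\otimes z^{-1}$, $z\otimes1+1\otimes z$. For $n\ge2$, $N_n=\sum_{r=0}^{n-2}V_{\mathrm{aff}}^{\otimes r}\otimes N\otimes V_{\mathrm{aff}}^{\otimes(n-r-2)}$, $\bigwedge^nV_{\mathrm{aff}}:=V_{\mathrm{aff}}^{\otimes n}/N_n$, and $L(\bigwedge^nV_{\mathrm{aff}})$ is the image of the $A$-lattice spanned by all $G(c_1)\otimes\cdots\otimes G(c_n)$, $c_r\in B_{\mathrm{aff}}$. Ground state sequences: (A) $b^\circ_m=zb_2$ for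 $m$ even, $b^\circ_m=b_0$ for $m$ odd; (B) $b^\circ_m=b_1$ for all $m$. Put $v^\circ_m=G(b^\circ_m)$. The pre-Fock space $\bar{\mathcal F}_m$ is the inductive limit of the spaces $\bigwedge^rV_{\mathrm{aff}}$ ($r\ge0$) along the maps $u\mapsto u\wedge v^\circ_{m+r}$; the image of $u\in\bigwedge^rV_{\mathrm{aff}}$ is written $u\wedge\overline{|m+r\rangle}$ (the formal semi-infinite wedge $u\wedge v^\circ_{m+r}\wedge v^\circ_{m+r+1}\wedge\cdots$), and $\overline{|m\rangle}$ is the image of $1\in\bigwedge^0V_{\mathrm{aff}}=\mathbb Q(q)$. $L(\bar{\mathcal F}_m)$ is the $A$-span of the images of the $L(\bigwedge^rV_{\mathrm{aff}})$. The Fock space is $\mathcal F_m=\bar{\mathcal F}_m/\bigcap_{n>0}q^nL(\bar{\mathcal F}_m)$, $|m\rangle$ is the image of $\overline{|m\rangle}$, $L(\mathcal F_m)$ is the image of $L(\bar{\mathcal F}_m)$, and $\mathcal F_m$ carries the $q$-adic topology with neighborhood basis of $0$ given by $\{q^nL(\mathcal F_m)\}_{n\ge0}$. *)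

theory Defs
  imports "HOL-Computational_Algebra.Polynomial" "HOL-Computational_Algebra.Fraction_Field"
begin

type_synonym K = "rat poly fract"

definition qq :: K where "qq = Fract [:0, 1:] 1"

definition Areg :: "K set" where
  "Areg = {x. \<exists>p r. poly r 0 \<noteq> 0 \<and> x = Fract p r}"

definition qint :: "int \<Rightarrow> K" where
  "qint n = (qq powi n - qq powi (-n)) / (qq - qq powi (-1))"

text \<open>The basis element z^a v_j (equivalently the crystal element z^a b_j) is encoded
  as the pair (a, j), with j in {0,1,2}.\<close>
type_synonym bas = "int \<times> nat"

definition validB :: "bas \<Rightarrow> bool" where "validB x \<longleftrightarrow> snd x \<le> 2"

text \<open>Vectors of V_aff: finitely supported coefficient functions on the basis.
  Elements of the n-fold tensor power: coefficient functions on words of basis elements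
  (the word [x1,...,xn] stands for G(x1) \<otimes> ... \<otimes> G(xn)).\<close>
type_synonym vec = "bas \<Rightarrow> K"
type_synonym tens = "bas list \<Rightarrow> K"

definition supp :: "('b \<Rightarrow> K) \<Rightarrow> 'b set" where "supp u = {w. u w \<noteq> 0}"

definition istens :: "nat \<Rightarrow> tens \<Rightarrow> bool" where
  "istens n u \<longleftrightarrow> finite (supp u) \<and>
     (\<forall>w. u w \<noteq> 0 \<longrightarrow> length w = n \<and> (\<forall>x\<in>set w. validB x))"

definition delta :: "'b \<Rightarrow> 'b \<Rightarrow> K" where "delta x = (\<lambda>y. if y = x then 1 else 0)"

definition lin :: "('b \<Rightarrow> 'c \<Rightarrow> K) \<Rightarrow> ('b \<Rightarrow> K) \<Rightarrow> 'c \<Rightarrow> K" where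
  "lin \<phi> u = (\<lambda>w. \<Sum>v\<in>supp u. u v * \<phi> v w)"

definition tensor2 :: "vec \<Rightarrow> vec \<Rightarrow> tens" where
  "tensor2 v w = (\<lambda>l. case l of [x, y] \<Rightarrow> v x * w y | _ \<Rightarrow> 0)"

text \<open>weights a \<Lambda>0 + b \<Lambda>1 + c \<delta> encoded as (a,b,c);
  elements h of P^* = Z h0 + Z h1 + Z d (dual basis) encoded as (x,y,w).\<close>
definition wt :: "bas \<Rightarrow> int \<times> int \<times> int" where
  "wt x = (let j = int (snd x) in (-2 * (1 - j), 2 * (1 - j), fst x))"

definition pair :: "int \<times> int \<times> int \<Rightarrow> int \<times> int \<times> int \<Rightarrow> int" where
  "pair h l = (case h of (x, y, w) \<Rightarrow> case l of (a, b, c) \<Rightarrow> x * a + y * b + w * c)"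

definition hcor :: "nat \<Rightarrow> int \<times> int \<times> int" where
  "hcor i = (if i = 0 then (1, 0, 0) else (0, 1, 0))"

definition ev :: "nat \<Rightarrow> bas \<Rightarrow> vec" where
  "ev i x = (case x of (a, j) \<Rightarrow>
     if i = 1 then (if 1 \<le> j \<and> j \<le> 2 then (\<lambda>y. qint (3 - int j) * delta (a, j - 1) y) else (\<lambda>_. 0))
     else (if j \<le> 1 then (\<lambda>y. qint (int j + 1) * delta (a + 1, j + 1) y) else (\<lambda>_. 0)))"

definition fv :: "nat \<Rightarrow> bas \<Rightarrow> vec" where
  "fv i x = (case x of (a, j) \<Rightarrow>
     if i = 1 then (if j \<le> 1 then (\<lambda>y. qint (int j + 1) * delta (a, j + 1) y) else (\<lambda>_. 0))
     else (if 1 \<le> j \<and> j \<le> 2 then (\<lambda>y. qint (3 - int j) * delta (a - 1, j - 1) y) else (\<lambda>_. 0)))"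

text \<open>Operators acting on V_aff \<otimes> V_aff: the generators q^h, e_i, f_i (i in {0,1}) acting
  via the coproduct, and z\<otimes>z, z^{-1}\<otimes>z^{-1}, z\<otimes>1 + 1\<otimes>z.\<close>
datatype gen = Qh "int \<times> int \<times> int" | E nat | F nat | ZZ | ZZinv | ZS

definition op2b :: "gen \<Rightarrow> bas list \<Rightarrow> tens" where
  "op2b g l = (case l of [x, y] \<Rightarrow>
     (case g of
        Qh h \<Rightarrow> (\<lambda>w. qq powi (pair h (wt x) + pair h (wt y)) * delta [x, y] w)
      | E i \<Rightarrow> (\<lambda>w. tensor2 (ev i x) (delta y) w
                 + qq powi (- pair (hcor i) (wt x)) * tensor2 (delta x) (ev i y) w)
      | F i \<Rightarrow> (\<lambda>w. qq powi (pair (hcor i) (wt y)) * tensor2 (fv i x) (delta y) w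
                 + tensor2 (delta x) (fv i y) w)
      | ZZ \<Rightarrow> delta [(fst x + 1, snd x), (fst y + 1, snd y)]
      | ZZinv \<Rightarrow> delta [(fst x - 1, snd x), (fst y - 1, snd y)]
      | ZS \<Rightarrow> (\<lambda>w. delta [(fst x + 1, snd x), y] w + delta [x, (fst y + 1, snd y)] w))
   | _ \<Rightarrow> (\<lambda>_. 0))"

definition op2 :: "gen \<Rightarrow> tens \<Rightarrow> tens" where "op2 g = lin (op2b g)"

definition validgen :: "gen \<Rightarrow> bool" where
  "validgen g = (case g of E i \<Rightarrow> i \<le> 1 | F i \<Rightarrow> i \<le> 1 | _ \<Rightarrow> True)"

inductive_set Nsp :: "tens set" where
  gen0: "delta [(0, 0), (0, 0)] \<in> Nsp"
| zero: "(\<lambda>_. 0) \<in> Nsp"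
| add: "u \<in> Nsp \<Longrightarrow> v \<in> Nsp \<Longrightarrow> (\<lambda>w. u w + v w) \<in> Nsp"
| smult: "u \<in> Nsp \<Longrightarrow> (\<lambda>w. c * u w) \<in> Nsp"
| oper: "u \<in> Nsp \<Longrightarrow> validgen g \<Longrightarrow> op2 g u \<in> Nsp"

text \<open>N_n = sum over r of V^{\<otimes> r} \<otimes> N \<otimes> V^{\<otimes>(n-r-2)}: the span of all
  G(p) \<otimes> u \<otimes> G(s) with p, s basis words of lengths r, n-r-2 and u in N.\<close>
definition embedN :: "bas list \<Rightarrow> tens \<Rightarrow> bas list \<Rightarrow> tens" where
  "embedN p u s = (\<lambda>w. if length w = length p + 2 + length s \<and> take (length p) w = p
        \<and> drop (length p + 2) w = s then u (take 2 (drop (length p) w)) else 0)"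

inductive_set Nn :: "nat \<Rightarrow> tens set" for n :: nat where
  emb: "u \<in> Nsp \<Longrightarrow> length p + 2 + length s = n \<Longrightarrow> \<forall>x\<in>set p. validB x \<Longrightarrow>
        \<forall>x\<in>set s. validB x \<Longrightarrow> embedN p u s \<in> Nn n"
| zero: "(\<lambda>_. 0) \<in> Nn n"
| add: "u \<in> Nn n \<Longrightarrow> v \<in> Nn n \<Longrightarrow> (\<lambda>w. u w + v w) \<in> Nn n"
| smult: "u \<in> Nn n \<Longrightarrow> (\<lambda>w. c * u w) \<in> Nn n"

datatype GS = GSA | GSB

definition bgs :: "GS \<Rightarrow> int \<Rightarrow> bas" where
  "bgs gs k = (case gs of GSA \<Rightarrow> (if even k then (1, 2) else (0, 0)) | GSB \<Rightarrow> (0, 1))"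

definition Hen :: "bas \<Rightarrow> bas \<Rightarrow> int" where
  "Hen x y = min (int (snd x)) (2 - int (snd y)) - fst x + fst y"

text \<open>The transition map of the inductive system, from stage r to stage R \<ge> r:
  u \<mapsto> u \<wedge> vcirc_{m+r} \<wedge> ... \<wedge> vcirc_{m+R-1} (on representatives in the tensor power).\<close>
definition ext :: "GS \<Rightarrow> int \<Rightarrow> nat \<Rightarrow> nat \<Rightarrow> tens \<Rightarrow> tens" where
  "ext gs m r R u = (\<lambda>w. if length w = R \<and> drop r w = map (\<lambda>k. bgs gs (m + int k)) [r..<R]
        then u (take r w) else 0)"

text \<open>The element of the pre-Fock space represented by u in (V_aff)^{\<otimes> r} (i.e. the image of
  the class of u in the r-th wedge power) is zero.\<close>
definition zeroBar :: "GS \<Rightarrow> int \<Rightarrow> nat \<Rightarrow> tens \<Rightarrow> bool" where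
  "zeroBar gs m r u \<longleftrightarrow> (\<exists>R\<ge>r. ext gs m r R u \<in> Nn R)"

definition Ltens :: "nat \<Rightarrow> tens set" where
  "Ltens r = {u. istens r u \<and> (\<forall>w. u w \<in> Areg)}"

text \<open>The element represented by (r,u) lies in q^n L(pre-Fock space): it equals q^n times a
  finite sum of images of lattice elements of various stages.\<close>
definition inqL :: "GS \<Rightarrow> int \<Rightarrow> nat \<Rightarrow> nat \<Rightarrow> tens \<Rightarrow> bool" where
  "inqL gs m n r u \<longleftrightarrow> (\<exists>R\<ge>r. \<exists>ws :: (nat \<times> tens) list.
      (\<forall>(s, w)\<in>set ws. s \<le> R \<and> w \<in> Ltens s) \<and>
      zeroBar gs m R (\<lambda>x. ext gs m r R u x - qq ^ n * (\<Sum>(s, w)\<leftarrow>ws. ext gs m s R w x)))"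

text \<open>The element represented by (r,u) is zero in the Fock space F_m.\<close>
definition zeroF :: "GS \<Rightarrow> int \<Rightarrow> nat \<Rightarrow> tens \<Rightarrow> bool" where
  "zeroF gs m r u \<longleftrightarrow> (\<forall>n>0. inqL gs m n r u)"

text \<open>Sequences (c_m, c_{m+1}, ...) are encoded as c :: nat \<Rightarrow> bas with c k = c_{m+k}.\<close>
definition normord :: "GS \<Rightarrow> int \<Rightarrow> (nat \<Rightarrow> bas) \<Rightarrow> bool" where
  "normord gs m c \<longleftrightarrow> (\<forall>k. validB (c k)) \<and> (\<exists>r. \<forall>k\<ge>r. c k = bgs gs (m + int k))
      \<and> (\<forall>k. Hen (c k) (c (Suc k)) > 0)"

definition gtens :: "nat \<Rightarrow> (nat \<Rightarrow> bas) \<Rightarrow> tens" where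
  "gtens R c = delta (map c [0..<R])"

end

(*
The relations between adjacent letters are generated from v_0 \<otimes> v_0 by e_0, f_1 and the symmetric
functions of the two copies of z.  In each weight they have a leading term z_1^h v_i \<otimes> v_j, with h
the energy, plus terms divisible by q; this gives a terminating straightening with coefficients
regular at q = 0.

Independence: the R-matrix of V is the identity on N and satisfies the Yang-Baxter equation, so the
alternating sum over the symmetric group annihilates N_n.  At q = 0 it permutes the powers of z
(shifted by energies), and the normally ordered words become those with strictly increasing powers,
which have linearly independent antisymmetrizations.  Hence a combination of normally ordered
wedges lying in q^n L has all its coefficients in q^n A.

Spanning: if a letter c violates the normal ordering with the vacuum that follows it, straightening
c with the first vacuum letter produces, for weight reasons, only letters that again violate it; the
term without a factor q violates it less.  So c followed by the vacuum lies in every q^n L.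
*)
theory Submission
  imports Defs "HOL-Library.Function_Algebras"
begin

section \<open>Rational functions regular at q = 0\<close>

text \<open>Membership in \<open>Nn\<close> is easy to establish but hard to refute, since
  \<open>Nsp\<close> is only given as a closure under operators. Independence therefore needs a
  linear map that annihilates all relations and survives reduction at q = 0. Tensors are read as
  Laurent polynomials in z_1, ..., z_n, one for each choice of components, and evaluated at points.
  The R-matrix being the identity on N then means that such a function f satisfies s_i f = f, so 2 f
  = f + s_i f is killed by the alternating sum. Rational functions of the z_i never occur as formal
  objects, and reduction at q = 0 concerns only elements of Q(q).

  For spanning, the quotient by the intersection of the q^n L is what removes a bad last letter.
  Consecutive vacuum letters have energy 1, so a violation of size -H shrinks by one with each
  absorbed vacuum letter until only terms with a factor q are left. Each further power of q consumes
  more vacuum letters, so the stage at which membership in q^n L is established depends on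
  n.\<close>

lemma qq_power: "qq ^ k = Fract (monom 1 k) 1"
proof (induction k)
  case 0
  then show ?case by (simp add: One_fract_def monom_0 one_pCons)
next
  case (Suc k)
  then show ?case by (simp add: qq_def monom_Suc)
qed

lemma qq_nonzero [simp]: "qq \<noteq> 0"
  by (simp add: qq_def eq_fract Zero_fract_def)

lemma of_nat_fract: "(of_nat n :: K) = Fract [:of_nat n:] 1"
  by (simp add: of_nat_fract of_nat_poly)

lemma of_int_fract: "(of_int n :: K) = Fract [:of_int n:] 1"
proof (cases n rule: int_cases2)
  case (nonneg m)
  then show ?thesis by (simp add: of_nat_fract)
next
  case (nonpos m)
  then show ?thesis by (simp add: of_nat_fract)
qed

lemma of_rat_fract: "(of_rat r :: K) = Fract [:r:] 1"
proof -
  obtain a b where ab: "r = of_int a / of_int b" "b \<noteq> 0"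
    using quotient_of_div[of r "fst (quotient_of r)" "snd (quotient_of r)"]
      quotient_of_denom_pos'[of r] by (metis less_irrefl prod.collapse)
  have "(of_rat r :: K) = of_int a / of_int b"
    using ab by (simp add: of_rat_divide)
  also have "\<dots> = Fract [:of_int a:] 1 / Fract [:of_int b:] 1"
    by (simp only: of_int_fract)
  also have "\<dots> = Fract [:r:] 1"
    using ab by (simp add: eq_fract)
  finally show ?thesis .
qed

text \<open>The value at q = 0, as a relation between an element of A and a rational: regularity and
  value are then proved together by introduction rules.\<close>

definition residue :: "K \<Rightarrow> rat \<Rightarrow> bool" where
  "residue x c \<longleftrightarrow> (\<exists>p r. poly r 0 \<noteq> 0 \<and> x = Fract p r \<and> poly p 0 = c * poly r 0)"

lemma Areg_iff_residue: "x \<in> Areg \<longleftrightarrow> (\<exists>c. residue x c)"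
proof
  assume "x \<in> Areg"
  then obtain p r where "poly r 0 \<noteq> 0" "x = Fract p r" by (auto simp: Areg_def)
  then have "residue x (poly p 0 / poly r 0)"
    unfolding residue_def by (intro exI[of _ p] exI[of _ r]) simp
  then show "\<exists>c. residue x c" ..
qed (auto simp: residue_def Areg_def)

lemma residue_Areg: "residue x c \<Longrightarrow> x \<in> Areg"
  by (auto simp: Areg_iff_residue)

lemma poly_zero_nonzero: "poly r 0 \<noteq> 0 \<Longrightarrow> r \<noteq> 0"
  by auto

lemma residue_unique:
  assumes "residue x c" "residue x d" shows "c = d"
proof -
  obtain p r where 1: "poly r 0 \<noteq> 0" "x = Fract p r" "poly p 0 = c * poly r 0"
    using assms(1) by (auto simp: residue_def)
  obtain p' r' where 2: "poly r' 0 \<noteq> 0" "x = Fract p' r'" "poly p' 0 = d * poly r' 0"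
    using assms(2) by (auto simp: residue_def)
  have "p * r' = p' * r"
    using 1 2 by (metis eq_fract(1) poly_zero_nonzero)
  then have "poly p 0 * poly r' 0 = poly p' 0 * poly r 0"
    by (metis poly_mult)
  then show ?thesis using 1 2 by simp
qed

lemma residue_of_rat [simp, intro]: "residue (of_rat c) c"
  unfolding residue_def of_rat_fract by (rule exI[of _ "[:c:]"], rule exI[of _ 1]) simp

lemma residue_0 [simp, intro]: "residue 0 0"
  using residue_of_rat[of 0] by simp

lemma residue_1 [simp, intro]: "residue 1 1"
  using residue_of_rat[of 1] by simp

lemma residue_qq [simp, intro]: "residue qq 0"
  unfolding residue_def qq_def by (rule exI[of _ "[:0,1:]"], rule exI[of _ 1]) simp

lemma residue_add:
  assumes "residue x c" "residue y d" shows "residue (x + y) (c + d)"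
proof -
  obtain p r where 1: "poly r 0 \<noteq> 0" "x = Fract p r" "poly p 0 = c * poly r 0"
    using assms(1) by (auto simp: residue_def)
  obtain p' r' where 2: "poly r' 0 \<noteq> 0" "y = Fract p' r'" "poly p' 0 = d * poly r' 0"
    using assms(2) by (auto simp: residue_def)
  have "x + y = Fract (p * r' + p' * r) (r * r')"
    using 1 2 by (simp add: add_fract[OF poly_zero_nonzero poly_zero_nonzero])
  then show ?thesis
    unfolding residue_def using 1 2
    by (intro exI[of _ "p * r' + p' * r"] exI[of _ "r * r'"]) (simp add: algebra_simps)
qed

lemma residue_mult:
  assumes "residue x c" "residue y d" shows "residue (x * y) (c * d)"
proof -
  obtain p r where 1: "poly r 0 \<noteq> 0" "x = Fract p r" "poly p 0 = c * poly r 0"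
    using assms(1) by (auto simp: residue_def)
  obtain p' r' where 2: "poly r' 0 \<noteq> 0" "y = Fract p' r'" "poly p' 0 = d * poly r' 0"
    using assms(2) by (auto simp: residue_def)
  have "x * y = Fract (p * p') (r * r')"
    using 1 2 poly_zero_nonzero by simp
  then show ?thesis
    unfolding residue_def using 1 2
    by (intro exI[of _ "p * p'"] exI[of _ "r * r'"]) (simp add: algebra_simps)
qed

lemma residue_inverse:
  assumes "residue x c" "c \<noteq> 0" shows "residue (inverse x) (inverse c)"
proof -
  obtain p r where 1: "poly r 0 \<noteq> 0" "x = Fract p r" "poly p 0 = c * poly r 0"
    using assms(1) by (auto simp: residue_def)
  then have "poly p 0 \<noteq> 0" using assms by simp
  then show ?thesis
    unfolding residue_def using 1 assms
    by (intro exI[of _ r] exI[of _ p]) simp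
qed

lemma residue_uminus: "residue x c \<Longrightarrow> residue (- x) (- c)"
  using residue_mult[OF residue_of_rat[of "-1"], of x c] by simp

lemma residue_diff: "residue x c \<Longrightarrow> residue y d \<Longrightarrow> residue (x - y) (c - d)"
  using residue_add[OF _ residue_uminus, of x c y d] by simp

lemma residue_divide: "residue x c \<Longrightarrow> residue y d \<Longrightarrow> d \<noteq> 0 \<Longrightarrow> residue (x / y) (c / d)"
  using residue_mult[OF _ residue_inverse, of x c y d] by (simp add: divide_inverse)

lemma residue_power: "residue x c \<Longrightarrow> residue (x ^ n) (c ^ n)"
  by (induction n) (auto intro: residue_mult)

lemma residue_powi: "residue x c \<Longrightarrow> c \<noteq> 0 \<Longrightarrow> residue (x powi n) (c powi n)"
  by (auto simp: power_int_def intro!: residue_power residue_inverse)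

lemma residue_sum: "(\<And>i. i \<in> S \<Longrightarrow> residue (f i) (g i)) \<Longrightarrow> residue (sum f S) (sum g S)"
  by (induction S rule: infinite_finite_induct) (auto intro: residue_add)

lemma residue_numeral [simp, intro]: "residue (numeral n) (numeral n)"
  using residue_of_rat[of "numeral n"] by simp

lemma Areg_closed [intro]:
  shows Areg_0: "0 \<in> Areg" and Areg_1: "1 \<in> Areg" and Areg_qq: "qq \<in> Areg"
    and Areg_add: "x \<in> Areg \<Longrightarrow> y \<in> Areg \<Longrightarrow> x + y \<in> Areg"
    and Areg_mult: "x \<in> Areg \<Longrightarrow> y \<in> Areg \<Longrightarrow> x * y \<in> Areg"
    and Areg_uminus: "x \<in> Areg \<Longrightarrow> - x \<in> Areg"
    and Areg_diff: "x \<in> Areg \<Longrightarrow> y \<in> Areg \<Longrightarrow> x - y \<in> Areg"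
    and Areg_power: "x \<in> Areg \<Longrightarrow> x ^ n \<in> Areg"
  unfolding Areg_iff_residue
  by (blast intro: residue_0 residue_1 residue_qq residue_add residue_mult residue_uminus
      residue_diff residue_power)+

lemma Areg_sum [intro]: "(\<And>i. i \<in> S \<Longrightarrow> f i \<in> Areg) \<Longrightarrow> sum f S \<in> Areg"
  by (induction S rule: infinite_finite_induct) auto

lemma residue_0_mult: "residue x 0 \<Longrightarrow> y \<in> Areg \<Longrightarrow> residue (x * y) 0"
  using residue_mult[of x 0 y] by (auto simp: Areg_iff_residue)

lemma residue_qq_power_mult: "0 < n \<Longrightarrow> y \<in> Areg \<Longrightarrow> residue (qq ^ n * y) 0"
  by (rule residue_0_mult) (use residue_power[OF residue_qq, of n] in \<open>auto simp: power_0_left\<close>)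

lemma poly_factor_order_0:
  fixes p :: "rat poly"
  assumes "p \<noteq> 0"
  obtains k p' where "p = monom 1 k * p'" "poly p' 0 \<noteq> 0"
proof -
  obtain p' where p': "p = [:- 0, 1:] ^ order 0 p * p'" "\<not> [:- 0, 1:] dvd p'"
    using order_decomp[OF assms, of 0] by blast
  have "monom 1 k = [:0, 1:] ^ k" for k :: nat
    by (simp add: monom_altdef)
  then show ?thesis
    using p' that[of "order 0 p" p'] by (metis minus_zero poly_eq_0_iff_dvd)
qed

text \<open>The q-adic valuation: N is the difference of the multiplicities of the root 0 in
  numerator and denominator.\<close>

lemma ex_leading_term:
  assumes "x \<noteq> 0"
  shows "\<exists>N y c. x = qq powi N * y \<and> residue y c \<and> c \<noteq> 0"
proof -
  obtain p r where pr: "x = Fract p r" "r \<noteq> 0" by (cases x)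
  then have "p \<noteq> 0" using assms by (auto simp: fract_collapse)
  obtain k p' where p': "p = monom 1 k * p'" "poly p' 0 \<noteq> 0"
    using poly_factor_order_0[OF \<open>p \<noteq> 0\<close>] .
  obtain l r' where r': "r = monom 1 l * r'" "poly r' 0 \<noteq> 0"
    using poly_factor_order_0[OF \<open>r \<noteq> 0\<close>] .
  have "x = qq ^ k / qq ^ l * Fract p' r'"
    using pr p' r' by (simp add: qq_power)
  also have "qq ^ k / qq ^ l = qq powi (int k - int l)"
    by (simp add: power_int_diff)
  finally have "x = qq powi (int k - int l) * Fract p' r'" .
  moreover have "residue (Fract p' r') (poly p' 0 / poly r' 0)"
    unfolding residue_def using r' by (intro exI[of _ p'] exI[of _ r']) simp
  ultimately show ?thesis using p' r' by (metis divide_eq_0_iff)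
qed

text \<open>Dividing by q to the minimal valuation makes the whole family regular and some member
  nonzero at q = 0. This turns independence over Q(q) into a question at q = 0.\<close>

lemma ex_common_leading_power:
  fixes a :: "'b \<Rightarrow> K"
  assumes "finite S" "c0 \<in> S" "a c0 \<noteq> 0"
  obtains N b where "\<And>c. c \<in> S \<Longrightarrow> a c = qq powi N * b c"
    "\<And>c. c \<in> S \<Longrightarrow> b c \<in> Areg" "\<exists>c\<in>S. \<not> residue (b c) 0"
proof -
  define S' where "S' = {c \<in> S. a c \<noteq> 0}"
  have "\<forall>c\<in>S'. \<exists>N y r. a c = qq powi N * y \<and> residue y r \<and> r \<noteq> 0"
    using ex_leading_term by (auto simp: S'_def)
  then obtain v y r where v: "\<And>c. c \<in> S' \<Longrightarrow> a c = qq powi (v c) * y c \<and> residue (y c) (r c) \<and> r c \<noteq> 0"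
    by metis
  have fin: "finite S'" "S' \<noteq> {}" using assms by (auto simp: S'_def)
  define N where "N = Min (v ` S')"
  have N: "N \<le> v c" if "c \<in> S'" for c using that fin by (simp add: N_def)
  have "N \<in> v ` S'"
    unfolding N_def by (rule Min_in) (use fin in auto)
  then obtain c1 where c1: "c1 \<in> S'" "v c1 = N" by auto
  define b where "b c = (if c \<in> S' then qq ^ nat (v c - N) * y c else 0)" for c
  have "a c = qq powi N * b c" if "c \<in> S" for c
  proof (cases "c \<in> S'")
    case True
    have "qq ^ nat (v c - N) = qq powi (v c - N)"
      using N[OF True] by (simp add: power_int_def)
    then show ?thesis using v[OF True] True by (simp add: b_def power_int_diff)
  qed (use that in \<open>auto simp: b_def S'_def\<close>)
  moreover have "b c \<in> Areg" if "c \<in> S" for c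
    using v by (auto simp: b_def intro: residue_Areg)
  moreover have "\<not> residue (b c1) 0"
    using v[OF c1(1)] c1 residue_unique by (auto simp: b_def)
  moreover have "c1 \<in> S" using c1 by (simp add: S'_def)
  ultimately show ?thesis using that by blast
qed

text \<open>Needed to see that the intersection of all q^n L is stable under scalars from Q(q), not
  only from A.\<close>

lemma ex_qq_power_clear:
  shows "\<exists>n. qq ^ n * x \<in> Areg"
proof (cases "x = 0")
  case False
  then obtain N y c where 1: "x = qq powi N * y" "residue y c"
    using ex_leading_term by blast
  have "qq ^ nat (- N) * x = qq ^ nat N * y"
    using 1 by (auto simp: power_int_def field_simps)
  then show ?thesis using 1 residue_Areg by (metis Areg_closed(5,8,3))
qed (use Areg_0 in auto)

section \<open>The R-matrix\<close>

text \<open>A component index of finite type: sums over \<open>UNIV\<close> expand by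
  \<open>sum_tri\<close>, and matrix identities become finitely many polynomial identities for
  \<open>algebra\<close>.\<close>

datatype tri = T0 | T1 | T2
lemma UNIV_tri: "UNIV = {T0, T1, T2}" using tri.exhaust by blast
instance tri :: finite
  by standard (simp add: UNIV_tri)
lemma sum_tri: "(\<Sum>i\<in>UNIV. f i) = f T0 + f T1 + f T2" for f :: "tri \<Rightarrow> 'a::comm_monoid_add"
  by (simp add: UNIV_tri add.assoc)

text \<open>The R-matrix of V with row index \<open>(i, j)\<close>, column index \<open>(k, l)\<close> and spectral parameters x, y,
  cleared of its denominator \<open>(y - q^4 x) (y - q^2 x)\<close>.  It is \<open>G(x, y) G(y, x)\<^sup>-\<^sup>1\<close>, where the columns
  of G are the generators of N over the symmetric Laurent polynomials.\<close>

definition rnum :: "'a::field_char_0 \<Rightarrow> 'a \<Rightarrow> 'a \<Rightarrow> tri \<Rightarrow> tri \<Rightarrow> tri \<Rightarrow> tri \<Rightarrow> 'a" where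
 "rnum q x y i j k l = (case (i, j) of
     (T0, T0) \<Rightarrow> if k = T0 \<and> l = T0 then (y - q^4*x) * (y - q^2*x) else 0
   | (T0, T1) \<Rightarrow> if k = T0 \<and> l = T1 then (y - q^2*x) * (1 - q^4) * y else if k = T1 \<and> l = T0 then (y - q^2*x) * q^2 * (y - x) else 0
   | (T0, T2) \<Rightarrow> if k = T0 \<and> l = T2 then (1 - q^2) * (1 - q^4) * y^2 else if k = T1 \<and> l = T1 then q * (1 + q^2) * (1 - q^4) * y * (y - x) else if k = T2 \<and> l = T0 then q^2 * (y - x) * (q^2*y - x) else 0
   | (T1, T0) \<Rightarrow> if k = T0 \<and> l = T1 then (y - q^2*x) * q^2 * (y - x) else if k = T1 \<and> l = T0 then (y - q^2*x) * (1 - q^4) * x else 0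
   | (T1, T1) \<Rightarrow> if k = T0 \<and> l = T2 then q * (1 - q^2) * y * (y - x) else if k = T1 \<and> l = T1 then x*y + q^2*y^2 - 2*q^2*x*y - 2*q^4*x*y + q^4*x^2 + q^6*x*y else if k = T2 \<and> l = T0 then q * (1 - q^2) * x * (y - x) else 0
   | (T1, T2) \<Rightarrow> if k = T1 \<and> l = T2 then (y - q^2*x) * (1 - q^4) * y else if k = T2 \<and> l = T1 then (y - q^2*x) * q^2 * (y - x) else 0
   | (T2, T0) \<Rightarrow> if k = T0 \<and> l = T2 then q^2 * (y - x) * (q^2*y - x) else if k = T1 \<and> l = T1 then q * (1 + q^2) * (1 - q^4) * x * (y - x) else if k = T2 \<and> l = T0 then (1 - q^2) * (1 - q^4) * x^2 else 0
   | (T2, T1) \<Rightarrow> if k = T1 \<and> l = T2 then (y - q^2*x) * q^2 * (y - x) else if k = T2 \<and> l = T1 then (y - q^2*x) * (1 - q^4) * x else 0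
   | (T2, T2) \<Rightarrow> if k = T2 \<and> l = T2 then (y - q^4*x) * (y - q^2*x) else 0)"



text \<open>One polynomial identity for each of the 729 choices of outer indices. Clearing
  denominators is harmless, since both sides carry the same three.\<close>

lemma rnum_yang_baxter:
 "(\<Sum>a'\<in>UNIV. \<Sum>b'\<in>UNIV. \<Sum>b2\<in>UNIV. rnum q x y a b a' b' * rnum q x z b' c b2 c1 * rnum q y z a' b2 a2 b3)
  = (\<Sum>b'\<in>UNIV. \<Sum>c'\<in>UNIV. \<Sum>b2\<in>UNIV. rnum q y z b c b' c' * rnum q x z a b' a2 b2 * rnum q x y b2 c' b3 c1)"
  by (induct a; induct b; induct c; induct a2; induct b3; induct c1;
      simp add: sum_tri rnum_def; algebra)

text \<open>Expected from the form G(x, y) G(y, x)^-1; the right side is the product of the two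
  cleared denominators.\<close>

lemma rnum_unitary:
  "(\<Sum>k\<in>UNIV. \<Sum>l\<in>UNIV. rnum q x y i j k l * rnum q y x k l i' j')
   = (if i = i' \<and> j = j' then (y - q^4*x) * (y - q^2*x) * ((x - q^4*y) * (x - q^2*y)) else 0)"
  by (induct i; induct j; induct i'; induct j'; simp add: sum_tri rnum_def; algebra)

text \<open>The shift by one keeps every parameter nonzero, so negative powers of z can be evaluated
  at each natural number.\<close>

definition pt :: "nat \<Rightarrow> K" where "pt n = of_nat (Suc n)"

definition rden :: "nat \<Rightarrow> nat \<Rightarrow> K" where
  "rden m n = (pt n - qq^4 * pt m) * (pt n - qq^2 * pt m)"

definition rm :: "nat \<Rightarrow> nat \<Rightarrow> tri \<Rightarrow> tri \<Rightarrow> tri \<Rightarrow> tri \<Rightarrow> K" where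
  "rm m n i j k l = rnum qq (pt m) (pt n) i j k l / rden m n"

lemma pt_of_rat: "pt n = of_rat (of_nat (Suc n))"
  by (simp add: pt_def del: of_nat_Suc)

lemma pt_nonzero [simp]: "pt n \<noteq> 0"
  by (simp add: pt_def del: of_nat_Suc)

lemma residue_pt [simp, intro]: "residue (pt n) (of_nat (Suc n))"
  unfolding pt_of_rat by (rule residue_of_rat)

text \<open>At q = 0 both factors reduce to the second parameter, a positive integer. Hence the
  denominator never vanishes and \<open>rm\<close> is regular.\<close>

lemma residue_rden: "residue (rden m n) (of_nat (Suc n) ^ 2)"
proof -
  have "residue (rden m n) ((of_nat (Suc n) - 0^4 * of_nat (Suc m)) * (of_nat (Suc n) - 0^2 * of_nat (Suc m)))"
    unfolding rden_def by (intro residue_mult residue_diff residue_power residue_pt residue_qq)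
  then show ?thesis by (simp add: power2_eq_square)
qed

lemma rden_nonzero [simp]: "rden m n \<noteq> 0"
proof
  assume "rden m n = 0"
  then have "(of_nat (Suc n) ^ 2 :: rat) = 0"
    using residue_unique[OF residue_rden[of m n]] residue_0 by metis
  then show False by (simp del: of_nat_Suc)
qed

lemma rm_unitary:
  "(\<Sum>k\<in>UNIV. \<Sum>l\<in>UNIV. rm m n i j k l * rm n m k l i' j') = (if i = i' \<and> j = j' then 1 else 0)"
proof -
  have "(\<Sum>k\<in>UNIV. \<Sum>l\<in>UNIV. rm m n i j k l * rm n m k l i' j')
     = (\<Sum>k\<in>UNIV. \<Sum>l\<in>UNIV. rnum qq (pt m) (pt n) i j k l * rnum qq (pt n) (pt m) k l i' j')
       / (rden m n * rden n m)"
    by (simp add: rm_def sum_divide_distrib)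
  also have "\<dots> = (if i = i' \<and> j = j' then rden m n * rden n m else 0) / (rden m n * rden n m)"
    by (simp only: rnum_unitary rden_def)
  finally show ?thesis by simp
qed

lemma rm_yang_baxter:
 "(\<Sum>a'\<in>UNIV. \<Sum>b'\<in>UNIV. \<Sum>b2\<in>UNIV. rm x y a b a' b' * rm x z b' c b2 c1 * rm y z a' b2 a2 b3)
  = (\<Sum>b'\<in>UNIV. \<Sum>c'\<in>UNIV. \<Sum>b2\<in>UNIV. rm y z b c b' c' * rm x z a b' a2 b2 * rm x y b2 c' b3 c1)"
  (is "?l = ?r")
proof -
  have "?l = (\<Sum>a'\<in>UNIV. \<Sum>b'\<in>UNIV. \<Sum>b2\<in>UNIV. rnum qq (pt x) (pt y) a b a' b' * rnum qq (pt x) (pt z) b' c b2 c1 * rnum qq (pt y) (pt z) a' b2 a2 b3)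
     / (rden x y * rden x z * rden y z)"
    by (simp add: rm_def sum_divide_distrib)
  also have "\<dots> = ?r"
    unfolding rnum_yang_baxter by (simp add: rm_def sum_divide_distrib mult_ac)
  finally show ?thesis .
qed

definition num :: "tri \<Rightarrow> nat" where "num i = (case i of T0 \<Rightarrow> 0 | T1 \<Rightarrow> 1 | T2 \<Rightarrow> 2)"

lemma num_simps [simp]: "num T0 = 0" "num T1 = 1" "num T2 = 2"
  by (simp_all add: num_def)

text \<open>The energy without the powers of z: \<open>Hen x y\<close> is this value at the
  components, minus \<open>fst x\<close>, plus \<open>fst y\<close>.\<close>

definition henergy :: "nat \<Rightarrow> nat \<Rightarrow> int" where
  "henergy i j = min (int i) (2 - int j)"

text \<open>At q = 0 the R-matrix is diagonal in the components and contributes only a power of r /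
  s with the energy as exponent. This is why the antisymmetrizer degenerates to permutations of
  powers of z.\<close>

lemma residue_rnum:
  assumes "residue q 0" "residue x r" "residue y s" "r \<noteq> 0" "s \<noteq> 0"
  shows "residue (rnum q x y i j k l)
    (if i = k \<and> j = l then s^2 * (r / s) powi henergy (num i) (num j) else 0)"
proof -
  have eqI: "residue u c \<Longrightarrow> c = d \<Longrightarrow> residue u d" for u c d by simp
  note intros = residue_mult residue_diff residue_add residue_power residue_0 residue_1
    residue_numeral assms(1-3)
  show ?thesis
    by (cases i; cases j; cases k; cases l; simp add: rnum_def henergy_def assms(4,5);
        (rule eqI, (rule intros)+, simp add: power2_eq_square field_simps assms(4,5))?)
qed

lemma residue_rm:
  "residue (rm m n i j k l)
    (if i = k \<and> j = l then (of_nat (Suc m) / of_nat (Suc n)) powi henergy (num i) (num j) else 0)"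
proof -
  have "residue (rm m n i j k l)
     ((if i = k \<and> j = l then of_nat (Suc n) ^ 2 * (of_nat (Suc m) / of_nat (Suc n)) powi henergy (num i) (num j) else 0)
      / of_nat (Suc n) ^ 2)"
    unfolding rm_def
    by (intro residue_divide residue_rden residue_rnum residue_qq residue_pt) (simp_all del: of_nat_Suc)
  then show ?thesis
    by (cases "i = k \<and> j = l") (auto simp del: of_nat_Suc)
qed

section \<open>The antisymmetrizer\<close>

text \<open>Spectral parameters are restricted to positive integers, so that R-matrix entries have no poles
  and are regular at q = 0.\<close>

type_synonym fn = "(nat \<Rightarrow> nat) \<Rightarrow> (nat \<Rightarrow> tri) \<Rightarrow> K"

text \<open>The simple transposition s_i: the parameters \<open>z i\<close> and
  \<open>z (Suc i)\<close> are exchanged and the R-matrix acts on the two components. Unitarity and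
  the Yang-Baxter equation make these operators a representation of the symmetric group.\<close>

definition sop :: "nat \<Rightarrow> fn \<Rightarrow> fn" where
  "sop i f = (\<lambda>z J. \<Sum>k\<in>UNIV. \<Sum>l\<in>UNIV. rm (z i) (z (Suc i)) (J i) (J (Suc i)) k l *
      f (z(i := z (Suc i), Suc i := z i)) (J(i := k, Suc i := l)))"

lemma sop_add: "sop i (f + g) = sop i f + sop i g"
  by (simp add: sop_def fun_eq_iff distrib_left sum.distrib)

lemma sop_uminus: "sop i (- f) = - sop i f"
  by (simp add: sop_def fun_eq_iff sum_negf)

lemma sop_diff: "sop i (f - g) = sop i f - sop i g"
  by (simp add: sop_def fun_eq_iff right_diff_distrib sum_subtractf)

lemma sop_zero [simp]: "sop i 0 = 0"
  by (simp add: sop_def fun_eq_iff)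

lemma sop_scale: "sop i (\<lambda>z J. c * f z J) = (\<lambda>z J. c * sop i f z J)"
  by (simp add: sop_def fun_eq_iff sum_distrib_left mult_ac)

lemma sop_sop_same [simp]: "sop i (sop i f) = f"
proof (intro ext)
  fix z :: "nat \<Rightarrow> nat" and J :: "nat \<Rightarrow> tri"
  define F where "F k' l' = f z (J(i := k', Suc i := l'))" for k' l'
  define R where "R k l = rm (z i) (z (Suc i)) (J i) (J (Suc i)) k l" for k l
  define R' where "R' k l k' l' = rm (z (Suc i)) (z i) k l k' l'" for k l k' l'
  have "sop i (sop i f) z J = (\<Sum>k\<in>UNIV. \<Sum>l\<in>UNIV. R k l * (\<Sum>k'\<in>UNIV. \<Sum>l'\<in>UNIV. R' k l k' l' * F k' l'))"
    unfolding sop_def F_def R_def R'_def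
    by (intro sum.cong refl arg_cong2[where f = "(*)"] arg_cong2[where f = f]) (auto simp: fun_eq_iff)
  also have "\<dots> = (\<Sum>k\<in>UNIV. \<Sum>l\<in>UNIV. \<Sum>k'\<in>UNIV. \<Sum>l'\<in>UNIV. R k l * R' k l k' l' * F k' l')"
    by (simp add: sum_distrib_left mult.assoc)
  also have "\<dots> = (\<Sum>k'\<in>UNIV. \<Sum>l'\<in>UNIV. \<Sum>k\<in>UNIV. \<Sum>l\<in>UNIV. R k l * R' k l k' l' * F k' l')"
    by (simp add: sum.cartesian_product)
      (rule sum.reindex_bij_witness[of _ "\<lambda>(k', l', k, l). (k, l, k', l')" "\<lambda>(k, l, k', l'). (k', l', k, l)"]; auto)
  also have "\<dots> = (\<Sum>k'\<in>UNIV. \<Sum>l'\<in>UNIV. (\<Sum>k\<in>UNIV. \<Sum>l\<in>UNIV. R k l * R' k l k' l') * F k' l')"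
    by (simp add: sum_distrib_right)
  also have "\<dots> = (\<Sum>k'\<in>UNIV. \<Sum>l'\<in>UNIV. (if J i = k' \<and> J (Suc i) = l' then 1 else 0) * F k' l')"
    by (simp only: R_def R'_def rm_unitary)
  also have "\<dots> = F (J i) (J (Suc i))"
    by (cases "J i"; cases "J (Suc i)") (simp_all add: sum_tri)
  also have "\<dots> = f z J" by (simp add: F_def)
  finally show "sop i (sop i f) z J = f z J" .
qed

lemma sop_commute:
  assumes "Suc i < j" shows "sop i (sop j f) = sop j (sop i f)"
proof (intro ext)
  fix z :: "nat \<Rightarrow> nat" and J :: "nat \<Rightarrow> tri"
  define F where "F k l k' l' = f (z(i := z (Suc i), Suc i := z i, j := z (Suc j), Suc j := z j))
     (J(i := k, Suc i := l, j := k', Suc j := l'))" for k l k' l'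
  define R where "R k l = rm (z i) (z (Suc i)) (J i) (J (Suc i)) k l" for k l
  define R' where "R' k l = rm (z j) (z (Suc j)) (J j) (J (Suc j)) k l" for k l
  have "sop i (sop j f) z J = (\<Sum>k\<in>UNIV. \<Sum>l\<in>UNIV. R k l * (\<Sum>k'\<in>UNIV. \<Sum>l'\<in>UNIV. R' k' l' * F k l k' l'))"
    unfolding sop_def F_def R_def R'_def using assms
    by (intro sum.cong refl arg_cong2[where f = "(*)"] arg_cong2[where f = f]) (auto simp: fun_eq_iff)
  also have "\<dots> = (\<Sum>k\<in>UNIV. \<Sum>l\<in>UNIV. \<Sum>k'\<in>UNIV. \<Sum>l'\<in>UNIV. R k l * R' k' l' * F k l k' l')"
    by (simp add: sum_distrib_left mult.assoc)
  also have "\<dots> = (\<Sum>k'\<in>UNIV. \<Sum>l'\<in>UNIV. \<Sum>k\<in>UNIV. \<Sum>l\<in>UNIV. R k l * R' k' l' * F k l k' l')"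
    by (simp add: sum.cartesian_product)
      (rule sum.reindex_bij_witness[of _ "\<lambda>(k', l', k, l). (k, l, k', l')" "\<lambda>(k, l, k', l'). (k', l', k, l)"]; auto)
  also have "\<dots> = (\<Sum>k'\<in>UNIV. \<Sum>l'\<in>UNIV. R' k' l' * (\<Sum>k\<in>UNIV. \<Sum>l\<in>UNIV. R k l * F k l k' l'))"
    by (simp add: sum_distrib_left mult_ac)
  also have "\<dots> = sop j (sop i f) z J"
    unfolding sop_def F_def R_def R'_def using assms
    by (intro sum.cong refl arg_cong2[where f = "(*)"] arg_cong2[where f = f]) (auto simp: fun_eq_iff)
  finally show "sop i (sop j f) z J = sop j (sop i f) z J" .
qed

text \<open>On the left the exchanges meet the parameter pairs (1,2), (1,3), (2,3) in this order, on
  the right (2,3), (1,3), (1,2): the two sides of the Yang-Baxter equation.\<close>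

lemma sop_braid: "sop i (sop (Suc i) (sop i f)) = sop (Suc i) (sop i (sop (Suc i) f))"
proof (intro ext)
  fix z :: "nat \<Rightarrow> nat" and J :: "nat \<Rightarrow> tri"
  define F where "F a b c = f (z(i := z (Suc (Suc i)), Suc (Suc i) := z i))
     (J(i := a, Suc i := b, Suc (Suc i) := c))" for a b c
  define R where "R = rm (z i) (z (Suc i))"
  define S where "S = rm (z i) (z (Suc (Suc i)))"
  define T where "T = rm (z (Suc i)) (z (Suc (Suc i)))"
  let ?a = "J i" and ?b = "J (Suc i)" and ?c = "J (Suc (Suc i))"
  have "sop i (sop (Suc i) (sop i f)) z J
    = (\<Sum>a'\<in>UNIV. \<Sum>b'\<in>UNIV. R ?a ?b a' b' * (\<Sum>b2\<in>UNIV. \<Sum>c1\<in>UNIV. S b' ?c b2 c1 *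
        (\<Sum>a2\<in>UNIV. \<Sum>b3\<in>UNIV. T a' b2 a2 b3 * F a2 b3 c1)))"
    unfolding sop_def F_def R_def S_def T_def
    by (intro sum.cong refl arg_cong2[where f = "(*)"] arg_cong2[where f = f]) (auto simp: fun_eq_iff)
  also have "\<dots> = (\<Sum>a'\<in>UNIV. \<Sum>b'\<in>UNIV. \<Sum>b2\<in>UNIV. \<Sum>c1\<in>UNIV. \<Sum>a2\<in>UNIV. \<Sum>b3\<in>UNIV.
       R ?a ?b a' b' * S b' ?c b2 c1 * T a' b2 a2 b3 * F a2 b3 c1)"
    by (simp add: sum_distrib_left mult.assoc)
  also have "\<dots> = (\<Sum>a2\<in>UNIV. \<Sum>b3\<in>UNIV. \<Sum>c1\<in>UNIV. \<Sum>a'\<in>UNIV. \<Sum>b'\<in>UNIV. \<Sum>b2\<in>UNIV.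
       R ?a ?b a' b' * S b' ?c b2 c1 * T a' b2 a2 b3 * F a2 b3 c1)"
    by (simp add: sum.cartesian_product)
      (rule sum.reindex_bij_witness[of _ "\<lambda>(a2, b3, c1, a', b', b2). (a', b', b2, c1, a2, b3)"
          "\<lambda>(a', b', b2, c1, a2, b3). (a2, b3, c1, a', b', b2)"]; auto)
  also have "\<dots> = (\<Sum>a2\<in>UNIV. \<Sum>b3\<in>UNIV. \<Sum>c1\<in>UNIV. (\<Sum>a'\<in>UNIV. \<Sum>b'\<in>UNIV. \<Sum>b2\<in>UNIV.
       R ?a ?b a' b' * S b' ?c b2 c1 * T a' b2 a2 b3) * F a2 b3 c1)"
    by (simp add: sum_distrib_right)
  also have "\<dots> = (\<Sum>a2\<in>UNIV. \<Sum>b3\<in>UNIV. \<Sum>c1\<in>UNIV. (\<Sum>b'\<in>UNIV. \<Sum>c'\<in>UNIV. \<Sum>b2\<in>UNIV.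
       T ?b ?c b' c' * S ?a b' a2 b2 * R b2 c' b3 c1) * F a2 b3 c1)"
    by (simp only: R_def S_def T_def rm_yang_baxter)
  also have "\<dots> = (\<Sum>a2\<in>UNIV. \<Sum>b3\<in>UNIV. \<Sum>c1\<in>UNIV. \<Sum>b'\<in>UNIV. \<Sum>c'\<in>UNIV. \<Sum>b2\<in>UNIV.
       T ?b ?c b' c' * S ?a b' a2 b2 * R b2 c' b3 c1 * F a2 b3 c1)"
    by (simp add: sum_distrib_right)
  also have "\<dots> = (\<Sum>b'\<in>UNIV. \<Sum>c'\<in>UNIV. \<Sum>a2\<in>UNIV. \<Sum>b2\<in>UNIV. \<Sum>b3\<in>UNIV. \<Sum>c1\<in>UNIV.
       T ?b ?c b' c' * S ?a b' a2 b2 * R b2 c' b3 c1 * F a2 b3 c1)"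
    by (simp add: sum.cartesian_product)
      (rule sum.reindex_bij_witness[of _ "\<lambda>(b', c', a2, b2, b3, c1). (a2, b3, c1, b', c', b2)"
          "\<lambda>(a2, b3, c1, b', c', b2). (b', c', a2, b2, b3, c1)"]; auto)
  also have "\<dots> = (\<Sum>b'\<in>UNIV. \<Sum>c'\<in>UNIV. T ?b ?c b' c' * (\<Sum>a2\<in>UNIV. \<Sum>b2\<in>UNIV. S ?a b' a2 b2 *
        (\<Sum>b3\<in>UNIV. \<Sum>c1\<in>UNIV. R b2 c' b3 c1 * F a2 b3 c1)))"
    by (simp add: sum_distrib_left mult.assoc)
  also have "\<dots> = sop (Suc i) (sop i (sop (Suc i) f)) z J"
    unfolding sop_def F_def R_def S_def T_def
    by (intro sum.cong refl arg_cong2[where f = "(*)"] arg_cong2[where f = f]) (auto simp: fun_eq_iff)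
  finally show "sop i (sop (Suc i) (sop i f)) z J = sop (Suc i) (sop i (sop (Suc i) f)) z J" .
qed

declare plus_fun_apply [simp del] minus_apply [simp del] uminus_apply [simp del] zero_fun_apply [simp del]

text \<open>\<open>Dop k\<close> is the alternating sum over the minimal right coset representatives
  \<open>s_{k-1} \<cdots> s_j\<close> of \<open>S_k\<close> in \<open>S_{k+1}\<close>, so that \<open>Asym n\<close> is the antisymmetrizer on n strands.\<close>

fun Dop :: "nat \<Rightarrow> fn \<Rightarrow> fn" where
  "Dop 0 f = f"
| "Dop (Suc k) f = f - sop k (Dop k f)"

fun Asym :: "nat \<Rightarrow> fn \<Rightarrow> fn" where
  "Asym 0 f = f"
| "Asym (Suc n) f = Asym n (Dop n f)"

lemma Dop_add: "Dop k (f + g) = Dop k f + Dop k g"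
  by (induction k) (simp_all add: sop_add algebra_simps)

lemma Dop_scale: "Dop k (\<lambda>z J. c * f z J) = (\<lambda>z J. c * Dop k f z J)"
proof (induction k)
  case (Suc k)
  have "Dop (Suc k) (\<lambda>z J. c * f z J) = (\<lambda>z J. c * f z J) - (\<lambda>z J. c * sop k (Dop k f) z J)"
    by (simp add: Suc sop_scale)
  then show ?case by (simp add: fun_eq_iff minus_apply right_diff_distrib)
qed simp

lemma Asym_add: "Asym n (f + g) = Asym n f + Asym n g"
  by (induction n arbitrary: f g) (simp_all add: Dop_add)

lemma Asym_scale: "Asym n (\<lambda>z J. c * f z J) = (\<lambda>z J. c * Asym n f z J)"
  by (induction n arbitrary: f) (simp_all add: Dop_scale)

lemma Asym_uminus: "Asym n (- f) = - Asym n f"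
  using Asym_scale[of n "-1" f] by (simp add: fun_Compl_def)

lemma Dop_sop_commute: "k < i \<Longrightarrow> Dop k (sop i f) = sop i (Dop k f)"
  by (induction k) (simp_all add: sop_diff sop_commute[symmetric])

text \<open>The sum of the images of all 1 + s_i, on which an alternating sum has to vanish.\<close>

inductive_set symspan :: "nat \<Rightarrow> fn set" for n where
  zero: "0 \<in> symspan n"
| gen: "Suc i < n \<Longrightarrow> f + sop i f \<in> symspan n"
| add: "f \<in> symspan n \<Longrightarrow> g \<in> symspan n \<Longrightarrow> f + g \<in> symspan n"
| neg: "f \<in> symspan n \<Longrightarrow> - f \<in> symspan n"

lemma symspan_mono: "f \<in> symspan n \<Longrightarrow> n \<le> m \<Longrightarrow> f \<in> symspan m"
  by (induction rule: symspan.induct) (auto intro: symspan.intros)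

lemma symspan_sop: "f \<in> symspan n \<Longrightarrow> n \<le> i \<Longrightarrow> sop i f \<in> symspan n"
proof (induction rule: symspan.induct)
  case (gen j f)
  then have "sop i (f + sop j f) = sop i f + sop j (sop i f)"
    by (simp add: sop_add sop_commute)
  then show ?case using gen symspan.gen by simp
qed (simp_all add: sop_add sop_uminus symspan.zero symspan.add symspan.neg)

text \<open>The inductive step for the vanishing of the antisymmetrizer on f + s_i f. As
  \<open>Asym (Suc k)\<close> is \<open>Asym k\<close> after \<open>Dop k\<close>, it suffices that
  \<open>Dop k\<close> sends this element into the span belonging to one strand less.\<close>

lemma Dop_sop_symspan: "i < k \<Longrightarrow> Dop k (f + sop i f) \<in> symspan k"
proof (induction k)
  case (Suc k)
  show ?case
  proof (cases "i < k")
    case True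
    have "sop k (Dop k (f + sop i f)) \<in> symspan k"
      using Suc.IH[OF True] by (rule symspan_sop) simp
    then have "- sop k (Dop k (f + sop i f)) \<in> symspan (Suc k)"
      by (intro symspan.neg symspan_mono[of _ k "Suc k"]) auto
    moreover have "f + sop i f \<in> symspan (Suc k)"
      using True by (intro symspan.gen) simp
    ultimately show ?thesis
      using symspan.add by fastforce
  next
    case False
    then have i: "i = k" using Suc.prems by simp
    show ?thesis
    proof (cases k)
      case 0
      have "Dop (Suc k) (f + sop i f) = 0"
        using 0 i by (simp add: sop_add algebra_simps)
      then show ?thesis by (simp only: symspan.zero)
    next
      case (Suc l)
      \<comment> \<open>For i = k the terms f and s_k f cancel, and the braid relation turns the
        rest into ?g and its image under s_l.\<close>
      let ?g = "sop k (sop l (Dop l f))"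
      have 1: "Dop k (sop k f) = sop k f - sop l (sop k (Dop l f))"
        using Suc by (simp add: Dop_sop_commute)
      have "sop k (Dop k (sop k f)) = f - sop k (sop l (sop k (Dop l f)))"
        unfolding 1 by (simp add: sop_diff)
      also have "\<dots> = f - sop l ?g"
        using Suc sop_braid[of l "Dop l f"] by simp
      finally have 2: "Dop (Suc k) (sop k f) = sop k f - f + sop l ?g" by simp
      have "Dop (Suc k) f = f - sop k f + ?g"
        using Suc by (simp add: sop_diff)
      then have "Dop (Suc k) (f + sop i f) = ?g + sop l ?g"
        unfolding i Dop_add 2 by simp
      then show ?thesis using Suc by (simp only:) (rule symspan.gen, simp)
    qed
  qed
qed simp

lemma Asym_symspan: "f \<in> symspan n \<Longrightarrow> Asym n f = 0"
proof (induction n arbitrary: f)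
  case 0
  from 0 show ?case by (induction rule: symspan.induct) (simp_all add: zero_fun_def)
next
  case (Suc n)
  have zero: "Asym m 0 = 0" for m
    using Asym_scale[of m 0 0] by (simp add: zero_fun_def)
  from Suc.prems show ?case
  proof (induction rule: symspan.induct)
    case (gen i f)
    then show ?case using Suc.IH[OF Dop_sop_symspan[of i n f]] by simp
  next
    case (add f g)
    then show ?case by (simp only: Asym_add add_0_right)
  next
    case (neg f)
    then show ?case by (simp only: Asym_uminus minus_zero)
  qed (simp only: zero)
qed

declare plus_fun_apply [simp] minus_apply [simp] uminus_apply [simp] zero_fun_apply [simp]

section \<open>Functionals annihilating the relations\<close>

definition contr :: "('b \<Rightarrow> K) \<Rightarrow> ('b \<Rightarrow> K) \<Rightarrow> K" where
  "contr u \<theta> = (\<Sum>w\<in>supp u. u w * \<theta> w)"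

lemma contr_superset: "finite T \<Longrightarrow> supp u \<subseteq> T \<Longrightarrow> contr u \<theta> = (\<Sum>w\<in>T. u w * \<theta> w)"
  unfolding contr_def by (rule sum.mono_neutral_left) (auto simp: supp_def)

lemma supp_add: "supp (\<lambda>w. u w + v w) \<subseteq> supp u \<union> supp v"
  and supp_scale: "supp (\<lambda>w. c * u w) \<subseteq> supp u"
  and supp_zero: "supp (\<lambda>w. 0) = {}"
  and supp_delta: "supp (delta x) = {x}"
  by (auto simp: supp_def delta_def)

lemma finite_supp_add: "finite (supp u) \<Longrightarrow> finite (supp v) \<Longrightarrow> finite (supp (\<lambda>w. u w + v w))"
  by (rule finite_subset[OF supp_add]) simp

lemma finite_supp_scale: "finite (supp u) \<Longrightarrow> finite (supp (\<lambda>w. c * u w))"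
  by (rule finite_subset[OF supp_scale])

lemma finite_supp_delta [simp]: "finite (supp (delta x))"
  by (simp add: supp_delta)

lemma contr_add: "finite (supp u) \<Longrightarrow> finite (supp v) \<Longrightarrow> contr (\<lambda>w. u w + v w) \<theta> = contr u \<theta> + contr v \<theta>"
  using supp_add[of u v]
  by (simp add: contr_superset[of "supp u \<union> supp v"] distrib_right sum.distrib)

lemma contr_scale: "finite (supp u) \<Longrightarrow> contr (\<lambda>w. c * u w) \<theta> = c * contr u \<theta>"
  using supp_scale[of c u]
  by (simp add: contr_superset[of "supp u"] sum_distrib_left mult.assoc)

lemma contr_zero: "contr (\<lambda>w. 0) \<theta> = 0"
  by (simp add: contr_def supp_zero)

lemma contr_delta [simp]: "contr (delta x) \<theta> = \<theta> x"
  by (simp add: contr_def supp_delta) (simp add: delta_def)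

lemma contr_cong: "(\<And>w. w \<in> supp u \<Longrightarrow> \<theta> w = G w) \<Longrightarrow> contr u \<theta> = contr u G"
  by (simp add: contr_def)

lemma contr_sum_right: "contr u (\<lambda>w. \<Sum>i\<in>S. c i * \<theta> i w) = (\<Sum>i\<in>S. c i * contr u (\<theta> i))"
proof -
  have "contr u (\<lambda>w. \<Sum>i\<in>S. c i * \<theta> i w) = (\<Sum>w\<in>supp u. \<Sum>i\<in>S. c i * (u w * \<theta> i w))"
    by (simp add: contr_def sum_distrib_left mult_ac)
  also have "\<dots> = (\<Sum>i\<in>S. \<Sum>w\<in>supp u. c i * (u w * \<theta> i w))"
    by (rule sum.swap)
  finally show ?thesis by (simp add: contr_def sum_distrib_left)
qed

lemma contr_mult_right: "contr u (\<lambda>w. c * \<theta> w) = c * contr u \<theta>"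
  by (simp add: contr_def sum_distrib_left mult_ac)

lemma supp_lin: "supp (lin \<phi> u) \<subseteq> (\<Union>v\<in>supp u. supp (\<phi> v))"
proof
  fix w assume "w \<in> supp (lin \<phi> u)"
  then have "(\<Sum>v\<in>supp u. u v * \<phi> v w) \<noteq> 0" by (simp add: supp_def lin_def)
  then obtain v where "v \<in> supp u" "u v * \<phi> v w \<noteq> 0"
    by (meson sum.neutral)
  then show "w \<in> (\<Union>v\<in>supp u. supp (\<phi> v))" by (auto simp: supp_def)
qed

lemma contr_lin:
  assumes "finite (supp u)" "\<And>v. v \<in> supp u \<Longrightarrow> finite (supp (\<phi> v))"
  shows "contr (lin \<phi> u) \<theta> = contr u (\<lambda>v. contr (\<phi> v) \<theta>)"
proof -
  define T where "T = (\<Union>v\<in>supp u. supp (\<phi> v))"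
  have T: "finite T" "\<And>v. v \<in> supp u \<Longrightarrow> supp (\<phi> v) \<subseteq> T" using assms by (auto simp: T_def)
  have "contr (lin \<phi> u) \<theta> = (\<Sum>w\<in>T. lin \<phi> u w * \<theta> w)"
    using T supp_lin[of \<phi> u] by (intro contr_superset) (auto simp: T_def)
  also have "\<dots> = (\<Sum>w\<in>T. \<Sum>v\<in>supp u. u v * (\<phi> v w * \<theta> w))"
    by (simp add: lin_def sum_distrib_right mult.assoc)
  also have "\<dots> = (\<Sum>v\<in>supp u. \<Sum>w\<in>T. u v * (\<phi> v w * \<theta> w))"
    by (rule sum.swap)
  also have "\<dots> = (\<Sum>v\<in>supp u. u v * contr (\<phi> v) \<theta>)"
    using T by (intro sum.cong) (simp_all add: contr_superset[of T] sum_distrib_left)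
  finally show ?thesis by (simp add: contr_def)
qed

lemma tensor2_zero [simp]: "tensor2 (\<lambda>_. 0) v = (\<lambda>_. 0)" "tensor2 v (\<lambda>_. 0) = (\<lambda>_. 0)"
  by (auto simp: tensor2_def fun_eq_iff split: list.splits)

lemma tensor2_delta [simp]: "tensor2 (delta x) (delta y) = delta [x, y]"
  by (auto simp: tensor2_def delta_def fun_eq_iff split: list.splits)

lemma tensor2_scale [simp]:
  "tensor2 (\<lambda>y. c * u y) v = (\<lambda>w. c * tensor2 u v w)"
  "tensor2 u (\<lambda>y. c * v y) = (\<lambda>w. c * tensor2 u v w)"
  by (auto simp: tensor2_def fun_eq_iff split: list.splits)

lemma qq_minus_inverse_nonzero: "qq - inverse qq \<noteq> 0"
proof
  assume "qq - inverse qq = 0"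
  then have "qq * qq = 1" by (simp add: field_simps)
  then show False
    using residue_unique[of "qq * qq" "0 * 0" 1] residue_mult[OF residue_qq residue_qq] by simp
qed

lemma qint_1 [simp]: "qint 1 = 1"
  using qq_minus_inverse_nonzero by (simp add: qint_def power_int_minus)

lemma qint_2 [simp]: "qint 2 = qq + inverse qq"
proof -
  have "qq powi 2 - qq powi (-2) = (qq - inverse qq) * (qq + inverse qq)"
    by (simp add: power_int_minus algebra_simps power2_eq_square)
  then show ?thesis using qq_minus_inverse_nonzero by (simp add: qint_def power_int_minus)
qed

section \<open>Two-letter words and the matrices of the generators\<close>

definition words2 :: "bas list set" where
  "words2 = {[x, y] | x y. validB x \<and> validB y}"

definition scaleup :: "K \<Rightarrow> ('b \<Rightarrow> K) \<Rightarrow> 'b \<Rightarrow> K" (infixr "\<cdot>" 75) where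
  "c \<cdot> u = (\<lambda>w. c * u w)"

lemma scaleup_apply [simp]: "(c \<cdot> u) w = c * u w"
  by (simp add: scaleup_def)

text \<open>The generators act on V by the matrices \<open>emat\<close> and \<open>fmat\<close>, and \<open>t_1\<close> by \<open>tmat\<close>;
  the first index is the row.\<close>

definition emat :: "tri \<Rightarrow> tri \<Rightarrow> K" where
  "emat i k = (case (i, k) of (T0, T1) \<Rightarrow> qq + inverse qq | (T1, T2) \<Rightarrow> 1 | _ \<Rightarrow> 0)"

definition fmat :: "tri \<Rightarrow> tri \<Rightarrow> K" where
  "fmat i k = (case (i, k) of (T1, T0) \<Rightarrow> 1 | (T2, T1) \<Rightarrow> qq + inverse qq | _ \<Rightarrow> 0)"

definition tmat :: "tri \<Rightarrow> K" where
  "tmat i = (case i of T0 \<Rightarrow> qq^2 | T1 \<Rightarrow> 1 | T2 \<Rightarrow> inverse (qq^2))"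

definition dl :: "tri \<Rightarrow> tri \<Rightarrow> K" where "dl i k = (if i = k then 1 else 0)"

text \<open>Here e_0 acts as z f_1, f_0 as z^-1 e_1, and t_0 as the inverse of t_1.
  \<open>Qh\<close> is treated apart: q^h may rescale z and is then not given by a matrix at fixed
  x, y.\<close>

fun gmat :: "gen \<Rightarrow> K \<Rightarrow> K \<Rightarrow> tri \<Rightarrow> tri \<Rightarrow> tri \<Rightarrow> tri \<Rightarrow> K" where
  "gmat (E n) x y i j k l = (if n = 1 then emat i k * dl j l + inverse (tmat k) * dl i k * emat j l
     else x * fmat i k * dl j l + tmat k * dl i k * y * fmat j l)"
| "gmat (F n) x y i j k l = (if n = 1 then tmat l * fmat i k * dl j l + dl i k * fmat j l
     else inverse (tmat l) * inverse x * emat i k * dl j l + dl i k * inverse y * emat j l)"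
| "gmat ZZ x y i j k l = x * y * dl i k * dl j l"
| "gmat ZZinv x y i j k l = inverse (x * y) * dl i k * dl j l"
| "gmat ZS x y i j k l = (x + y) * dl i k * dl j l"
| "gmat (Qh h) x y i j k l = 0"

text \<open>Pairing with it evaluates the component (i, j) of a two-fold tensor, a Laurent
  polynomial in z_1 and z_2, at x and y.\<close>

definition mon2 :: "K \<Rightarrow> K \<Rightarrow> tri \<Rightarrow> tri \<Rightarrow> bas list \<Rightarrow> K" where
  "mon2 x y i j w = (case w of [(a, k), (b, l)] \<Rightarrow>
     if k = num i \<and> l = num j then x powi a * y powi b else 0 | _ \<Rightarrow> 0)"

lemma num_inject [simp]: "num i = num j \<longleftrightarrow> i = j"
  by (cases i; cases j) simp_all

lemma ex_num: "k \<le> 2 \<Longrightarrow> \<exists>i. k = num i"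
proof -
  assume "k \<le> 2"
  then consider "k = 0" | "k = 1" | "k = 2" by linarith
  then show ?thesis by cases (metis num_simps)+
qed

lemma words2E:
  assumes "w \<in> words2"
  obtains a k b l where "w = [(a, num k), (b, num l)]"
  using assms ex_num by (fastforce simp: words2_def validB_def)

lemma validB_num [simp]: "validB (a, num k)"
  by (cases k) (simp_all add: validB_def)

lemma mon2_num [simp]: "mon2 x y i j [(a, num k), (b, num l)] = dl i k * dl j l * (x powi a * y powi b)"
  by (auto simp: mon2_def dl_def)

text \<open>Linear combinations as lists of terms, so that explicit relations can be computed by
  rewriting and words may repeat.\<close>

definition lc :: "(K \<times> 'b) list \<Rightarrow> 'b \<Rightarrow> K" where
  "lc xs = (\<lambda>w. \<Sum>(c, v)\<leftarrow>xs. c * delta v w)"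

lemma lc_Nil [simp]: "lc [] = (\<lambda>w. 0)"
  and lc_Cons: "lc ((c, v) # xs) = (\<lambda>w. c * delta v w + lc xs w)"
  by (simp_all add: lc_def)

lemma supp_lc: "supp (lc xs) \<subseteq> snd ` {p \<in> set xs. fst p \<noteq> 0}"
proof (induction xs)
  case (Cons p xs)
  obtain c v where p: "p = (c, v)" by (cases p)
  have "supp (lc (p # xs)) \<subseteq> supp (\<lambda>w. c * delta v w) \<union> supp (lc xs)"
    unfolding p lc_Cons by (rule supp_add)
  moreover have "supp (\<lambda>w. c * delta v w) \<subseteq> (if c = 0 then {} else {v})"
    by (auto simp: supp_def delta_def)
  ultimately have "supp (lc (p # xs)) \<subseteq> (if c = 0 then {} else {v}) \<union> snd ` {p \<in> set xs. fst p \<noteq> 0}"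
    using Cons by blast
  also have "\<dots> \<subseteq> snd ` {q \<in> set (p # xs). fst q \<noteq> 0}"
    unfolding p by (cases "c = 0") force+
  finally show ?case .
qed (simp add: supp_zero)

lemma finite_supp_lc [simp]: "finite (supp (lc xs))"
  by (rule finite_subset[OF supp_lc]) simp

lemma contr_lc: "contr (lc xs) \<theta> = (\<Sum>(c, v)\<leftarrow>xs. c * \<theta> v)"
  by (induction xs) (auto simp: contr_zero lc_Cons contr_add contr_scale finite_supp_scale)

lemma op2b_num:
  shows "op2b (E 1) [(a, num k), (b, num l)] = lc
      [(if k = T0 then 0 else qint (3 - int (num k)), [(a, num k - 1), (b, num l)]),
       (inverse (tmat k) * (if l = T0 then 0 else qint (3 - int (num l))), [(a, num k), (b, num l - 1)])]"
    and "op2b (E 0) [(a, num k), (b, num l)] = lc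
      [(if k = T2 then 0 else qint (int (num k) + 1), [(a + 1, num k + 1), (b, num l)]),
       (tmat k * (if l = T2 then 0 else qint (int (num l) + 1)), [(a, num k), (b + 1, num l + 1)])]"
    and "op2b (F 1) [(a, num k), (b, num l)] = lc
      [(tmat l * (if k = T2 then 0 else qint (int (num k) + 1)), [(a, num k + 1), (b, num l)]),
       (if l = T2 then 0 else qint (int (num l) + 1), [(a, num k), (b, num l + 1)])]"
    and "op2b (F 0) [(a, num k), (b, num l)] = lc
      [(inverse (tmat l) * (if k = T0 then 0 else qint (3 - int (num k))), [(a - 1, num k - 1), (b, num l)]),
       (if l = T0 then 0 else qint (3 - int (num l)), [(a, num k), (b - 1, num l - 1)])]"
    and "op2b ZZ [(a, num k), (b, num l)] = lc [(1, [(a + 1, num k), (b + 1, num l)])]"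
    and "op2b ZZinv [(a, num k), (b, num l)] = lc [(1, [(a - 1, num k), (b - 1, num l)])]"
    and "op2b ZS [(a, num k), (b, num l)] = lc
      [(1, [(a + 1, num k), (b, num l)]), (1, [(a, num k), (b + 1, num l)])]"
    and "op2b (Qh (x, y, s)) [(a, num k), (b, num l)] = lc
      [(qq powi (2 * (y - x) * (2 - int (num k) - int (num l)) + s * (a + b)), [(a, num k), (b, num l)])]"
proof -
  show "op2b (Qh (x, y, s)) [(a, num k), (b, num l)] = lc
      [(qq powi (2 * (y - x) * (2 - int (num k) - int (num l)) + s * (a + b)), [(a, num k), (b, num l)])]"
    by (simp add: op2b_def lc_Cons pair_def wt_def Let_def algebra_simps)
qed (induct k; induct l; simp add: op2b_def ev_def fv_def lc_Cons tmat_def pair_def hcor_def wt_def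
      power_int_minus mult.assoc)+

lemma op2b_words2:
  assumes "w \<in> words2" "validgen g"
  shows "finite (supp (op2b g w)) \<and> supp (op2b g w) \<subseteq> words2"
proof -
  from words2E[OF assms(1)] obtain a k b l where w: "w = [(a, num k), (b, num l)]" .
  have *: "finite (supp (lc xs)) \<and> supp (lc xs) \<subseteq> words2" if "\<forall>(c, v)\<in>set xs. c = 0 \<or> v \<in> words2" for xs
    using that supp_lc[of xs] by fastforce
  have eqs: "(\<exists>x y. [(a', k'), (b', l')] = [x, y] \<and> validB x \<and> validB y) \<longleftrightarrow> k' \<le> 2 \<and> l' \<le> 2" for a' b' k' l'
    by (simp add: validB_def)
  have numk: "num k \<le> 2" "num l \<le> 2" "k \<noteq> T2 \<Longrightarrow> Suc (num k) \<le> 2" "l \<noteq> T2 \<Longrightarrow> Suc (num l) \<le> 2"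
    by (cases k; cases l; simp)+
  show ?thesis
  proof (cases g)
    case (Qh h)
    then obtain x y s where "g = Qh (x, y, s)" by (cases h) auto
    then show ?thesis unfolding w by (simp only: op2b_num) (rule *, simp add: words2_def eqs numk)
  next
    case (E n)
    then have "g = E 0 \<or> g = E 1" using assms(2) by (auto simp: validgen_def)
    then show ?thesis unfolding w
      by (elim disjE; simp only: op2b_num; intro *; cases k; cases l; simp add: words2_def eqs validB_def)
  next
    case (F n)
    then have "g = F 0 \<or> g = F 1" using assms(2) by (auto simp: validgen_def)
    then show ?thesis unfolding w
      by (elim disjE; simp only: op2b_num; intro *; cases k; cases l; simp add: words2_def eqs validB_def)
  qed (simp only: w op2b_num, rule *, simp add: words2_def eqs numk)+
qed

lemma supp_Nsp: "u \<in> Nsp \<Longrightarrow> finite (supp u) \<and> supp u \<subseteq> words2"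
proof (induction rule: Nsp.induct)
  case gen0
  then show ?case by (auto simp: supp_delta words2_def validB_def)
next
  case zero
  then show ?case by (simp add: supp_zero)
next
  case (add u v)
  then show ?case using supp_add[of u v] finite_supp_add[of u v] by blast
next
  case (smult u c)
  then show ?case using supp_scale[of c u] finite_supp_scale[of u c] by blast
next
  case (oper u g)
  have "supp (op2 g u) \<subseteq> (\<Union>v\<in>supp u. supp (op2b g v))" unfolding op2_def by (rule supp_lin)
  moreover have "finite (\<Union>v\<in>supp u. supp (op2b g v))" "(\<Union>v\<in>supp u. supp (op2b g v)) \<subseteq> words2"
    using oper op2b_words2 by blast+
  ultimately show ?case using finite_subset by blast
qed

section \<open>R-matrix invariance of the relations N\<close>

lemma contr_op2b:
  assumes "w \<in> words2" "validgen g" "\<And>h. g \<noteq> Qh h" "x \<noteq> 0" "y \<noteq> 0"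
  shows "contr (op2b g w) (mon2 x y i j) = (\<Sum>k\<in>UNIV. \<Sum>l\<in>UNIV. gmat g x y i j k l * mon2 x y k l w)"
proof -
  from words2E[OF assms(1)] obtain a k b l where w: "w = [(a, num k), (b, num l)]" .
  have "(\<Sum>k'\<in>UNIV. \<Sum>l'\<in>UNIV. gmat g x y i j k' l' * mon2 x y k' l' w) = gmat g x y i j k l * (x powi a * y powi b)"
    unfolding w mon2_num by (cases k; cases l) (simp_all add: sum_tri dl_def)
  moreover have "contr (op2b g w) (mon2 x y i j) = gmat g x y i j k l * (x powi a * y powi b)"
  proof (cases g)
    case (Qh h)
    then show ?thesis using assms(3) by simp
  next
    case (E n)
    then have "g = E 0 \<or> g = E 1" using assms(2) by (auto simp: validgen_def)
    then show ?thesis unfolding w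
      by (elim disjE; simp only: op2b_num contr_lc;
          induct k; induct l; induct i; induct j; simp add: mon2_def emat_def fmat_def dl_def assms(4,5) power_int_add)
  next
    case (F n)
    then have "g = F 0 \<or> g = F 1" using assms(2) by (auto simp: validgen_def)
    then show ?thesis unfolding w
      by (elim disjE; simp only: op2b_num contr_lc;
          induct k; induct l; induct i; induct j; simp add: mon2_def emat_def fmat_def dl_def assms(4,5) power_int_diff divide_inverse)
  next
    case ZZ
    show ?thesis unfolding w ZZ op2b_num contr_lc
      by (auto simp: mon2_def dl_def assms(4,5) power_int_add)
  next
    case ZZinv
    show ?thesis unfolding w ZZinv op2b_num contr_lc
      by (auto simp: mon2_def dl_def assms(4,5) power_int_diff divide_inverse)
  next
    case ZS
    show ?thesis unfolding w ZS op2b_num contr_lc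
      by (auto simp: mon2_def dl_def assms(4,5) power_int_add algebra_simps)
  qed
  ultimately show ?thesis by simp
qed

text \<open>R is a module map between V_y \<otimes> V_x and V_x \<otimes> V_y, checked entry by
  entry.\<close>

lemma gmat_EF_intertwines:
  assumes "n \<le> 1" "x \<noteq> 0" "y \<noteq> 0"
  shows "(\<Sum>k\<in>UNIV. \<Sum>l\<in>UNIV. rnum qq x y i j k l * gmat (E n) y x k l i' j')
      = (\<Sum>k\<in>UNIV. \<Sum>l\<in>UNIV. gmat (E n) x y i j k l * rnum qq x y k l i' j')" (is ?E)
    and "(\<Sum>k\<in>UNIV. \<Sum>l\<in>UNIV. rnum qq x y i j k l * gmat (F n) y x k l i' j')
      = (\<Sum>k\<in>UNIV. \<Sum>l\<in>UNIV. gmat (F n) x y i j k l * rnum qq x y k l i' j')" (is ?F)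
proof -
  \<comment> \<open>With p for 1/q and the relation q p = 1 the entries become polynomial identities
    that \<open>algebra\<close> decides.\<close>
  define p where "p = inverse qq"
  have p: "qq * p = 1" by (simp add: p_def)
  have tm: "tmat T0 = qq^2" "tmat T1 = 1" "tmat T2 = p^2"
     "inverse (qq^2) = p^2" "inverse (p^2) = qq^2"
    by (simp_all add: tmat_def p_def power_inverse)
  note simps = sum_tri rnum_def emat_def fmat_def dl_def tm p_def[symmetric]
  \<comment> \<open>f_0 involves inverse parameters. Multiplying by x y, which is the same for both
    orders of the parameters, removes them on both sides.\<close>
  define F0' where "F0' x y i k j l = inverse (tmat l) * y * emat i k * dl j l + dl i k * x * emat j l"
    for x y i k j l
  have F0': "gmat (F 0) x y i j k l = F0' x y i k j l / (x * y)" if "x \<noteq> 0" "y \<noteq> 0" for x y i j k l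
    using that by (simp add: F0'_def field_simps)
  have E0: "(\<Sum>k\<in>UNIV. \<Sum>l\<in>UNIV. rnum qq x y i j k l * gmat (E 0) y x k l i' j')
      = (\<Sum>k\<in>UNIV. \<Sum>l\<in>UNIV. gmat (E 0) x y i j k l * rnum qq x y k l i' j')"
    apply (induct i; induct j; induct i'; induct j'; simp add: simps)
    apply (algebra | ((insert p)[1], algebra))+
    done
  have E1: "(\<Sum>k\<in>UNIV. \<Sum>l\<in>UNIV. rnum qq x y i j k l * gmat (E 1) y x k l i' j')
      = (\<Sum>k\<in>UNIV. \<Sum>l\<in>UNIV. gmat (E 1) x y i j k l * rnum qq x y k l i' j')"
    apply (induct i; induct j; induct i'; induct j'; simp add: simps)
    apply (algebra | ((insert p)[1], algebra))+
    done
  have F0: "(\<Sum>k\<in>UNIV. \<Sum>l\<in>UNIV. rnum qq x y i j k l * F0' y x k i' l j')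
      = (\<Sum>k\<in>UNIV. \<Sum>l\<in>UNIV. F0' x y i k j l * rnum qq x y k l i' j')"
    apply (induct i; induct j; induct i'; induct j'; simp add: simps F0'_def)
    apply (algebra | ((insert p)[1], algebra))+
    done
  have F1: "(\<Sum>k\<in>UNIV. \<Sum>l\<in>UNIV. rnum qq x y i j k l * gmat (F 1) y x k l i' j')
      = (\<Sum>k\<in>UNIV. \<Sum>l\<in>UNIV. gmat (F 1) x y i j k l * rnum qq x y k l i' j')"
    apply (induct i; induct j; induct i'; induct j'; simp add: simps)
    apply (algebra | ((insert p)[1], algebra))+
    done
  have F0: "(\<Sum>k\<in>UNIV. \<Sum>l\<in>UNIV. rnum qq x y i j k l * gmat (F 0) y x k l i' j')
      = (\<Sum>k\<in>UNIV. \<Sum>l\<in>UNIV. gmat (F 0) x y i j k l * rnum qq x y k l i' j')"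
    using arg_cong[OF F0, of "\<lambda>s. s / (x * y)"] assms
    by (simp add: F0' sum_divide_distrib mult.commute[of y x] del: gmat.simps)
  have "n = 0 \<or> n = 1" using assms by linarith
  then show ?E ?F using E0 E1 F0 F1 by blast+
qed

lemma gmat_intertwines:
  assumes "validgen g" "\<And>h. g \<noteq> Qh h" "x \<noteq> 0" "y \<noteq> 0"
  shows "(\<Sum>k\<in>UNIV. \<Sum>l\<in>UNIV. rnum qq x y i j k l * gmat g y x k l i' j')
      = (\<Sum>k\<in>UNIV. \<Sum>l\<in>UNIV. gmat g x y i j k l * rnum qq x y k l i' j')"
proof (cases g)
  case (Qh h)
  then show ?thesis using assms(2) by simp
next
  case (E n)
  then have "n \<le> 1" using assms(1) by (simp add: validgen_def)
  then show ?thesis unfolding E using assms(3,4) by (rule gmat_EF_intertwines)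
next
  case (F n)
  then have "n \<le> 1" using assms(1) by (simp add: validgen_def)
  then show ?thesis unfolding F using assms(3,4) by (rule gmat_EF_intertwines)
next
  case ZZ
  show ?thesis unfolding ZZ
    by (cases i; cases j; cases i'; cases j'; simp add: sum_tri dl_def mult_ac)
next
  case ZZinv
  show ?thesis unfolding ZZinv
    by (cases i; cases j; cases i'; cases j'; simp add: sum_tri dl_def mult_ac)
next
  case ZS
  show ?thesis unfolding ZS
    by (cases i; cases j; cases i'; cases j'; simp add: sum_tri dl_def mult_ac add_ac)
qed

definition rinvariant :: "tens \<Rightarrow> bool" where
  "rinvariant u \<longleftrightarrow> (\<forall>x y i j. x \<noteq> 0 \<longrightarrow> y \<noteq> 0 \<longrightarrow>
     (y - qq^4 * x) * (y - qq^2 * x) * contr u (mon2 x y i j)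
     = (\<Sum>k\<in>UNIV. \<Sum>l\<in>UNIV. rnum qq x y i j k l * contr u (mon2 y x k l)))"

lemma contr_op2:
  assumes "finite (supp u)" "supp u \<subseteq> words2" "validgen g" "\<And>h. g \<noteq> Qh h" "x \<noteq> 0" "y \<noteq> 0"
  shows "contr (op2 g u) (mon2 x y i j) = (\<Sum>k\<in>UNIV. \<Sum>l\<in>UNIV. gmat g x y i j k l * contr u (mon2 x y k l))"
proof -
  have "contr (op2 g u) (mon2 x y i j) = contr u (\<lambda>v. contr (op2b g v) (mon2 x y i j))"
    unfolding op2_def using assms op2b_words2 by (intro contr_lin) blast+
  also have "\<dots> = contr u (\<lambda>v. \<Sum>k\<in>UNIV. \<Sum>l\<in>UNIV. gmat g x y i j k l * mon2 x y k l v)"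
    using assms by (intro contr_cong contr_op2b) auto
  also have "\<dots> = contr u (\<lambda>v. \<Sum>k\<in>UNIV. 1 * (\<Sum>l\<in>UNIV. gmat g x y i j k l * mon2 x y k l v))"
    by simp
  also have "\<dots> = (\<Sum>k\<in>UNIV. \<Sum>l\<in>UNIV. gmat g x y i j k l * contr u (mon2 x y k l))"
    unfolding contr_sum_right by simp
  finally show ?thesis .
qed

lemma contr_op2_Qh:
  assumes "finite (supp u)" "supp u \<subseteq> words2" "x \<noteq> 0" "y \<noteq> 0"
  shows "contr (op2 (Qh (r, t, s)) u) (mon2 x y i j)
     = qq powi (2 * (t - r) * (2 - int (num i) - int (num j))) * contr u (mon2 (qq powi s * x) (qq powi s * y) i j)"
proof -
  have "contr (op2 (Qh (r, t, s)) u) (mon2 x y i j) = contr u (\<lambda>v. contr (op2b (Qh (r, t, s)) v) (mon2 x y i j))"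
    unfolding op2_def using assms op2b_words2 by (intro contr_lin) (auto simp: validgen_def)
  also have "\<dots> = contr u (\<lambda>v. qq powi (2 * (t - r) * (2 - int (num i) - int (num j))) *
       mon2 (qq powi s * x) (qq powi s * y) i j v)"
  proof (rule contr_cong)
    fix w assume "w \<in> supp u"
    then have "w \<in> words2" using assms by auto
    then obtain a k b l where w: "w = [(a, num k), (b, num l)]" by (rule words2E)
    have "(qq powi s * x) powi a * (qq powi s * y) powi b = qq powi (s * (a + b)) * (x powi a * y powi b)"
      using assms by (simp add: power_int_mult_distrib power_int_mult[symmetric] power_int_add distrib_left)
    then show "contr (op2b (Qh (r, t, s)) w) (mon2 x y i j) =
        qq powi (2 * (t - r) * (2 - int (num i) - int (num j))) * mon2 (qq powi s * x) (qq powi s * y) i j w"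
      unfolding w op2b_num contr_lc mon2_num
      by (auto simp: dl_def power_int_add)
  qed
  also have "\<dots> = qq powi (2 * (t - r) * (2 - int (num i) - int (num j))) * contr u (mon2 (qq powi s * x) (qq powi s * y) i j)"
    by (rule contr_mult_right)
  finally show ?thesis .
qed

text \<open>Together with the homogeneity \<open>rnum_scale\<close> this lets R commute with q^h:
  the coroot part of h acts through the weight, the remaining part by rescaling both
  parameters.\<close>

lemma rnum_weight: "rnum q x y i j k l = 0 \<or> num i + num j = num k + num l"
  by (cases i; cases j; cases k; cases l) (simp_all add: rnum_def)

lemma rnum_scale: "rnum q (t * x) (t * y) i j k l = t^2 * rnum q x y i j k l"
  by (cases i; cases j; cases k; cases l) (simp_all add: rnum_def power2_eq_square algebra_simps)

text \<open>On v_0 \<otimes> v_0 the matrix R is the identity, and it commutes with every operator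
  under which \<open>Nsp\<close> is closed.\<close>

lemma rinvariant_Nsp: "u \<in> Nsp \<Longrightarrow> rinvariant u"
proof (induction rule: Nsp.induct)
  case gen0
  have "(y - qq^4 * x) * (y - qq^2 * x) * mon2 x y i j [(0, 0), (0, 0)]
     = (\<Sum>k\<in>UNIV. \<Sum>l\<in>UNIV. rnum qq x y i j k l * mon2 y x k l [(0, 0), (0, 0)])" for x y i j
    by (cases i; cases j) (simp_all add: sum_tri mon2_def rnum_def)
  then show ?case by (simp add: rinvariant_def)
next
  case zero
  then show ?case by (simp add: rinvariant_def contr_zero)
next
  case (add u v)
  then show ?case
    using supp_Nsp by (simp add: rinvariant_def contr_add distrib_left sum.distrib)
next
  case (smult u c)
  then show ?case
    using supp_Nsp by (simp add: rinvariant_def contr_scale sum_distrib_left mult.left_commute)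
next
  case (oper u g)
  have u: "finite (supp u)" "supp u \<subseteq> words2" using supp_Nsp oper by auto
  show ?case
  proof (cases "\<exists>h. g = Qh h")
    case True
    then obtain r t s where g: "g = Qh (r, t, s)" by (metis surj_pair)
    show ?thesis unfolding rinvariant_def g
    proof (intro allI impI)
      fix x y i j assume xy: "(x::K) \<noteq> 0" "(y::K) \<noteq> 0"
      define e where "e = qq powi (2 * (t - r) * (2 - int (num i) - int (num j)))"
      define c where "c = qq powi s"
      have c: "c \<noteq> 0" by (simp add: c_def)
      have "(c * y - qq ^ 4 * (c * x)) * (c * y - qq\<^sup>2 * (c * x)) * contr u (mon2 (c * x) (c * y) i j)
        = (\<Sum>k\<in>UNIV. \<Sum>l\<in>UNIV. rnum qq (c * x) (c * y) i j k l * contr u (mon2 (c * y) (c * x) k l))"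
        using oper.IH xy c unfolding rinvariant_def by simp
      then have "c^2 * ((y - qq ^ 4 * x) * (y - qq\<^sup>2 * x) * contr u (mon2 (c * x) (c * y) i j))
        = c^2 * (\<Sum>k\<in>UNIV. \<Sum>l\<in>UNIV. rnum qq x y i j k l * contr u (mon2 (c * y) (c * x) k l))"
        by (simp add: rnum_scale sum_distrib_left power2_eq_square algebra_simps)
      then have *: "(y - qq ^ 4 * x) * (y - qq\<^sup>2 * x) * contr u (mon2 (c * x) (c * y) i j)
        = (\<Sum>k\<in>UNIV. \<Sum>l\<in>UNIV. rnum qq x y i j k l * contr u (mon2 (c * y) (c * x) k l))"
        using c by simp
      have "(\<Sum>k\<in>UNIV. \<Sum>l\<in>UNIV. rnum qq x y i j k l * contr (op2 (Qh (r, t, s)) u) (mon2 y x k l))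
          = (\<Sum>k\<in>UNIV. \<Sum>l\<in>UNIV. e * (rnum qq x y i j k l * contr u (mon2 (c * y) (c * x) k l)))"
      proof (intro sum.cong refl)
        fix k l
        show "rnum qq x y i j k l * contr (op2 (Qh (r, t, s)) u) (mon2 y x k l)
          = e * (rnum qq x y i j k l * contr u (mon2 (c * y) (c * x) k l))"
        proof (cases "rnum qq x y i j k l = 0")
          case False
          then have "num i + num j = num k + num l" using rnum_weight by blast
          then have "2 - int (num i) - int (num j) = 2 - int (num k) - int (num l)" by linarith
          then have "e = qq powi (2 * (t - r) * (2 - int (num k) - int (num l)))"
            by (simp only: e_def)
          then show ?thesis
            unfolding contr_op2_Qh[OF u xy(2,1)] c_def by (simp only: mult_ac)
        qed simp
      qed
      also have "\<dots> = e * ((y - qq ^ 4 * x) * (y - qq\<^sup>2 * x) * contr u (mon2 (c * x) (c * y) i j))"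
        unfolding * by (simp add: sum_distrib_left)
      also have "\<dots> = (y - qq ^ 4 * x) * (y - qq\<^sup>2 * x) * contr (op2 (Qh (r, t, s)) u) (mon2 x y i j)"
        unfolding contr_op2_Qh[OF u xy] e_def c_def by simp
      finally show "(y - qq ^ 4 * x) * (y - qq\<^sup>2 * x) * contr (op2 (Qh (r, t, s)) u) (mon2 x y i j)
        = (\<Sum>k\<in>UNIV. \<Sum>l\<in>UNIV. rnum qq x y i j k l * contr (op2 (Qh (r, t, s)) u) (mon2 y x k l))" ..
    qed
  next
    case False
    then have g: "\<And>h. g \<noteq> Qh h" by blast
    show ?thesis unfolding rinvariant_def
    proof (intro allI impI)
      fix x y i j assume xy: "(x::K) \<noteq> 0" "(y::K) \<noteq> 0"
      define D where "D = (y - qq ^ 4 * x) * (y - qq\<^sup>2 * x)"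
      define M where "M k l k' l' = gmat g x y k l k' l'" for k l k' l'
      define M' where "M' k l k' l' = gmat g y x k l k' l'" for k l k' l'
      define R where "R k l k' l' = rnum qq x y k l k' l'" for k l k' l'
      define X where "X k l = contr u (mon2 x y k l)" for k l
      define X' where "X' k l = contr u (mon2 y x k l)" for k l
      have IH: "D * X k l = (\<Sum>k'\<in>UNIV. \<Sum>l'\<in>UNIV. R k l k' l' * X' k' l')" for k l
        using oper.IH xy unfolding rinvariant_def D_def X_def X'_def R_def by simp
      have RM: "(\<Sum>k\<in>UNIV. \<Sum>l\<in>UNIV. R i j k l * M' k l k' l') = (\<Sum>k\<in>UNIV. \<Sum>l\<in>UNIV. M i j k l * R k l k' l')" for k' l'
        unfolding R_def M_def M'_def using gmat_intertwines[OF oper.hyps(2) g xy] .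
      have swap: "(\<Sum>k\<in>UNIV. \<Sum>l\<in>UNIV. A k l * (\<Sum>k'\<in>UNIV. \<Sum>l'\<in>UNIV. B k l k' l' * C k' l'))
        = (\<Sum>k'\<in>UNIV. \<Sum>l'\<in>UNIV. (\<Sum>k\<in>UNIV. \<Sum>l\<in>UNIV. A k l * B k l k' l') * C k' l')"
        for A B and C :: "tri \<Rightarrow> tri \<Rightarrow> K"
      proof -
        have "(\<Sum>k\<in>UNIV. \<Sum>l\<in>UNIV. A k l * (\<Sum>k'\<in>UNIV. \<Sum>l'\<in>UNIV. B k l k' l' * C k' l'))
          = (\<Sum>k\<in>UNIV. \<Sum>l\<in>UNIV. \<Sum>k'\<in>UNIV. \<Sum>l'\<in>UNIV. A k l * B k l k' l' * C k' l')"
          by (simp add: sum_distrib_left mult.assoc)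
        also have "\<dots> = (\<Sum>k'\<in>UNIV. \<Sum>l'\<in>UNIV. \<Sum>k\<in>UNIV. \<Sum>l\<in>UNIV. A k l * B k l k' l' * C k' l')"
          by (simp add: sum.cartesian_product)
            (rule sum.reindex_bij_witness[of _ "\<lambda>(k', l', k, l). (k, l, k', l')" "\<lambda>(k, l, k', l'). (k', l', k, l)"]; auto)
        finally show ?thesis by (simp add: sum_distrib_right)
      qed
      \<comment> \<open>In matrix notation: R M' X' = M R X' = D M X.\<close>
      have "(\<Sum>k\<in>UNIV. \<Sum>l\<in>UNIV. R i j k l * (\<Sum>k'\<in>UNIV. \<Sum>l'\<in>UNIV. M' k l k' l' * X' k' l'))
        = (\<Sum>k\<in>UNIV. \<Sum>l\<in>UNIV. M i j k l * (\<Sum>k'\<in>UNIV. \<Sum>l'\<in>UNIV. R k l k' l' * X' k' l'))"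
        unfolding swap RM ..
      also have "\<dots> = D * (\<Sum>k\<in>UNIV. \<Sum>l\<in>UNIV. M i j k l * X k l)"
        unfolding IH[symmetric] by (simp add: sum_distrib_left mult.left_commute)
      finally show "(y - qq ^ 4 * x) * (y - qq\<^sup>2 * x) * contr (op2 g u) (mon2 x y i j)
        = (\<Sum>k\<in>UNIV. \<Sum>l\<in>UNIV. rnum qq x y i j k l * contr (op2 g u) (mon2 y x k l))"
        unfolding contr_op2[OF u oper.hyps(2) g xy] contr_op2[OF u oper.hyps(2) g xy(2,1)]
          D_def X_def X'_def M_def M'_def R_def by simp
    qed
  qed
qed


text \<open>A word of basis elements as a function of the spectral parameters \<open>z\<close> and of the tensor
  component \<open>J\<close>.\<close>

fun wfun :: "bas list \<Rightarrow> fn" where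
  "wfun [] = (\<lambda>z J. 1)"
| "wfun (x # w) = (\<lambda>z J. (if snd x = num (J 0) then pt (z 0) powi fst x else 0) *
     wfun w (\<lambda>i. z (Suc i)) (\<lambda>i. J (Suc i)))"

lemma wfun_append: "wfun (p @ w) z J = wfun p z J * wfun w (\<lambda>i. z (i + length p)) (\<lambda>i. J (i + length p))"
  by (induction p arbitrary: z J) simp_all

lemma wfun_cong: "(\<And>i. i < length w \<Longrightarrow> z i = z' i \<and> J i = J' i) \<Longrightarrow> wfun w z J = wfun w z' J'"
proof (induction w arbitrary: z z' J J')
  case (Cons x w)
  have "z 0 = z' 0 \<and> J 0 = J' 0" using Cons.prems[of 0] by simp
  moreover have "wfun w (\<lambda>i. z (Suc i)) (\<lambda>i. J (Suc i)) = wfun w (\<lambda>i. z' (Suc i)) (\<lambda>i. J' (Suc i))"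
    using Cons.prems by (intro Cons.IH) simp
  ultimately show ?case by simp
qed simp

definition tfun :: "tens \<Rightarrow> fn" where
  "tfun u = (\<lambda>z J. contr u (\<lambda>w. wfun w z J))"

lemma wfun_words2: "w \<in> words2 \<Longrightarrow> wfun w z J = mon2 (pt (z 0)) (pt (z (Suc 0))) (J 0) (J (Suc 0)) w"
  by (auto simp: words2_def mon2_def split: prod.splits)

lemma supp_embedN: "supp (embedN p u s) \<subseteq> (\<lambda>v. p @ v @ s) ` supp u"
proof
  fix w assume w: "w \<in> supp (embedN p u s)"
  then have *: "length w = length p + 2 + length s" "take (length p) w = p" "drop (length p + 2) w = s"
    "u (take 2 (drop (length p) w)) \<noteq> 0"
    by (auto simp: supp_def embedN_def split: if_splits)
  have "w = take (length p) w @ take 2 (drop (length p) w) @ drop (length p + 2) w"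
    by (metis append_take_drop_id drop_drop add.commute)
  then have "w = p @ take 2 (drop (length p) w) @ s" using * by simp
  then show "w \<in> (\<lambda>v. p @ v @ s) ` supp u" using *(4) by (auto simp: supp_def)
qed

lemma tfun_embedN:
  assumes "supp u \<subseteq> words2" "finite (supp u)"
  shows "tfun (embedN p u s) z J = wfun p z J *
     contr u (mon2 (pt (z (length p))) (pt (z (Suc (length p)))) (J (length p)) (J (Suc (length p)))) *
     wfun s (\<lambda>i. z (i + (2 + length p))) (\<lambda>i. J (i + (2 + length p)))"
proof -
  have len: "length v = 2" if "v \<in> words2" for v using that by (auto simp: words2_def)
  have emb: "embedN p u s (p @ v @ s) = u v" if "v \<in> words2" for v
    using len[OF that] by (simp add: embedN_def)
  have "tfun (embedN p u s) z J = (\<Sum>w\<in>(\<lambda>v. p @ v @ s) ` supp u. embedN p u s w * wfun w z J)"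
    unfolding tfun_def using supp_embedN[of p u s] assms by (intro contr_superset) auto
  also have "\<dots> = (\<Sum>v\<in>supp u. embedN p u s (p @ v @ s) * wfun (p @ v @ s) z J)"
    by (subst sum.reindex) (auto simp: inj_on_def)
  also have "\<dots> = (\<Sum>v\<in>supp u. wfun p z J * (u v * mon2 (pt (z (length p))) (pt (z (Suc (length p)))) (J (length p)) (J (Suc (length p))) v) *
     wfun s (\<lambda>i. z (i + (2 + length p))) (\<lambda>i. J (i + (2 + length p))))"
  proof (intro sum.cong refl)
    fix v assume "v \<in> supp u"
    then have v: "v \<in> words2" using assms by auto
    show "embedN p u s (p @ v @ s) * wfun (p @ v @ s) z J = wfun p z J * (u v * mon2 (pt (z (length p))) (pt (z (Suc (length p)))) (J (length p)) (J (Suc (length p))) v) *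
     wfun s (\<lambda>i. z (i + (2 + length p))) (\<lambda>i. J (i + (2 + length p)))"
      using len[OF v] by (simp add: emb[OF v] wfun_append wfun_words2[OF v] add.assoc)
  qed
  finally show ?thesis by (simp add: contr_def sum_distrib_left sum_distrib_right)
qed

text \<open>The prefix and the suffix do not see the exchange at position \<open>length p\<close>;
  what remains is the R-matrix invariance of u, divided by \<open>rden\<close>.\<close>

lemma sop_tfun_embedN:
  assumes "u \<in> Nsp"
  shows "sop (length p) (tfun (embedN p u s)) = tfun (embedN p u s)"
proof (intro ext)
  fix z :: "nat \<Rightarrow> nat" and J :: "nat \<Rightarrow> tri"
  have u: "supp u \<subseteq> words2" "finite (supp u)" using supp_Nsp[OF assms] by auto
  define r where "r = length p"
  define x where "x = z r"
  define y where "y = z (Suc r)"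
  define P where "P = wfun p z J"
  define S where "S = wfun s (\<lambda>i. z (i + (2 + r))) (\<lambda>i. J (i + (2 + r)))"
  have *: "tfun (embedN p u s) (z(r := z (Suc r), Suc r := z r)) (J(r := k, Suc r := l))
      = P * contr u (mon2 (pt y) (pt x) k l) * S" for k l
  proof -
    have "wfun p (z(r := z (Suc r), Suc r := z r)) (J(r := k, Suc r := l)) = P"
      unfolding P_def by (rule wfun_cong) (simp add: r_def)
    then show ?thesis
      unfolding tfun_embedN[OF u] r_def[symmetric] S_def x_def y_def by simp
  qed
  have "sop r (tfun (embedN p u s)) z J
    = (\<Sum>k\<in>UNIV. \<Sum>l\<in>UNIV. rm x y (J r) (J (Suc r)) k l * (P * contr u (mon2 (pt y) (pt x) k l) * S))"
    unfolding sop_def * x_def y_def ..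
  also have "\<dots> = P * ((\<Sum>k\<in>UNIV. \<Sum>l\<in>UNIV. rnum qq (pt x) (pt y) (J r) (J (Suc r)) k l * contr u (mon2 (pt y) (pt x) k l)) / rden x y) * S"
    by (simp add: rm_def sum_distrib_left sum_distrib_right sum_divide_distrib mult_ac)
  also have "\<dots> = P * (rden x y * contr u (mon2 (pt x) (pt y) (J r) (J (Suc r))) / rden x y) * S"
  proof -
    have "(\<Sum>k\<in>UNIV. \<Sum>l\<in>UNIV. rnum qq (pt x) (pt y) (J r) (J (Suc r)) k l * contr u (mon2 (pt y) (pt x) k l))
      = rden x y * contr u (mon2 (pt x) (pt y) (J r) (J (Suc r)))"
      using rinvariant_Nsp[OF assms] unfolding rinvariant_def rden_def by simp
    then show ?thesis by simp
  qed
  also have "\<dots> = tfun (embedN p u s) z J"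
    unfolding tfun_embedN[OF u] P_def S_def r_def x_def y_def by simp
  finally show "sop (length p) (tfun (embedN p u s)) z J = tfun (embedN p u s) z J"
    unfolding r_def .
qed

lemma finite_supp_embedN: "finite (supp u) \<Longrightarrow> finite (supp (embedN p u s))"
  using supp_embedN[of p u s] by (meson finite_imageI finite_subset)

lemma finite_supp_Nn: "u \<in> Nn n \<Longrightarrow> finite (supp u)"
  by (induction rule: Nn.induct)
    (auto simp: supp_zero supp_Nsp intro: finite_supp_embedN finite_supp_add finite_supp_scale)

lemma tfun_add: "finite (supp u) \<Longrightarrow> finite (supp v) \<Longrightarrow> tfun (\<lambda>w. u w + v w) = tfun u + tfun v"
  by (simp add: tfun_def contr_add fun_eq_iff)

lemma tfun_scale: "finite (supp u) \<Longrightarrow> tfun (\<lambda>w. c * u w) = (\<lambda>z J. c * tfun u z J)"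
  by (simp add: tfun_def contr_scale fun_eq_iff)

theorem Asym_Nn: "u \<in> Nn n \<Longrightarrow> Asym n (tfun u) = 0"
proof (induction rule: Nn.induct)
  case (emb u p s)
  let ?f = "tfun (embedN p u s)"
  have "?f + sop (length p) ?f \<in> symspan n"
    using emb by (intro symspan.gen) simp
  \<comment> \<open>The embedded relation equals its own image under s_i, so its double lies in
    \<open>symspan\<close>; 2 is invertible.\<close>
  then have "Asym n (?f + ?f) = 0"
    using sop_tfun_embedN[OF emb(1)] Asym_symspan by metis
  then have "Asym n ?f + Asym n ?f = 0" unfolding Asym_add .
  then show ?case by (simp add: fun_eq_iff)
next
  case zero
  then show ?case
    using Asym_scale[of n 0 0] by (simp add: tfun_def contr_zero zero_fun_def)
next
  case (add u v)
  then show ?case by (simp only: tfun_add[OF finite_supp_Nn finite_supp_Nn] Asym_add add_0_right)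
next
  case (smult u c)
  then show ?case by (simp only: tfun_scale[OF finite_supp_Nn] Asym_scale) (simp add: fun_eq_iff)
qed

section \<open>The antisymmetrizer at q = 0\<close>

definition regular :: "fn \<Rightarrow> bool" where "regular f \<longleftrightarrow> (\<forall>z J. f z J \<in> Areg)"

definition vanishing :: "fn \<Rightarrow> bool" where "vanishing f \<longleftrightarrow> (\<forall>z J. residue (f z J) 0)"

lemma rm_Areg: "rm m n i j k l \<in> Areg"
  by (rule residue_Areg[OF residue_rm])

lemma regular_sop: "regular f \<Longrightarrow> regular (sop i f)"
  by (auto simp: regular_def sop_def intro!: Areg_sum Areg_mult rm_Areg)

lemma regular_Dop: "regular f \<Longrightarrow> regular (Dop k f)"
proof (induction k)
  case (Suc k)
  then show ?case using regular_sop[of "Dop k f" k] by (auto simp: regular_def)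
qed simp

lemma regular_Asym: "regular f \<Longrightarrow> regular (Asym n f)"
  by (induction n arbitrary: f) (simp_all add: regular_Dop)

lemma vanishing_add: "vanishing f \<Longrightarrow> vanishing g \<Longrightarrow> vanishing (f + g)"
  using residue_add[of _ 0 _ 0] by (simp add: vanishing_def)

lemma vanishing_zero: "vanishing 0"
  by (simp add: vanishing_def)

lemma vanishing_scale: "vanishing f \<Longrightarrow> c \<in> Areg \<Longrightarrow> vanishing (\<lambda>z J. c * f z J)"
  using residue_0_mult[of _ c] by (simp add: vanishing_def mult.commute[of c])

lemma vanishing_diff: "vanishing f \<Longrightarrow> vanishing g \<Longrightarrow> vanishing (f - g)"
  using residue_diff[of _ 0 _ 0] by (simp add: vanishing_def)

lemma vanishing_sop: "vanishing f \<Longrightarrow> vanishing (sop i f)"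
  unfolding vanishing_def sop_def
proof (intro allI)
  fix z :: "nat \<Rightarrow> nat" and J :: "nat \<Rightarrow> tri"
  assume "\<forall>z J. residue (f z J) 0"
  then have "residue (\<Sum>k\<in>UNIV. \<Sum>l\<in>UNIV. rm (z i) (z (Suc i)) (J i) (J (Suc i)) k l *
      f (z(i := z (Suc i), Suc i := z i)) (J(i := k, Suc i := l))) (\<Sum>k::tri\<in>UNIV. \<Sum>l::tri\<in>UNIV. 0)"
    by (intro residue_sum) (simp add: mult.commute[of "rm _ _ _ _ _ _"] residue_0_mult rm_Areg)
  then show "residue (\<Sum>k\<in>UNIV. \<Sum>l\<in>UNIV. rm (z i) (z (Suc i)) (J i) (J (Suc i)) k l *
      f (z(i := z (Suc i), Suc i := z i)) (J(i := k, Suc i := l))) 0"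
    by simp
qed

lemma vanishing_Dop: "vanishing f \<Longrightarrow> vanishing (Dop k f)"
  by (induction k) (simp_all add: vanishing_sop vanishing_diff del: minus_apply)

lemma vanishing_Asym: "vanishing f \<Longrightarrow> vanishing (Asym n f)"
  by (induction n arbitrary: f) (simp_all add: vanishing_Dop)

lemma pt_powi_Areg: "pt n powi a \<in> Areg"
  by (rule residue_Areg[OF residue_powi[OF residue_pt]]) (simp del: of_nat_Suc)

lemma wfun_Areg: "wfun w z J \<in> Areg"
  by (induction w arbitrary: z J) (auto intro!: Areg_mult pt_powi_Areg)

lemma regular_tfun:
  assumes "u \<in> Ltens n" shows "regular (tfun u)"
  using assms unfolding regular_def tfun_def contr_def Ltens_def
  by (auto intro!: Areg_sum Areg_mult wfun_Areg)

text \<open>\<open>wcoord w\<close> are the coordinates of w in which the simple transpositions permute entries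
  at q = 0, and in which normal ordering means strictly increasing.\<close>

definition wcoord :: "bas list \<Rightarrow> nat \<Rightarrow> int" where
  "wcoord w i = fst (w ! i) + (\<Sum>k<i. henergy (snd (w ! k)) (snd (w ! Suc k)))"

text \<open>What s_i becomes at q = 0: the components stay in place, while the powers of z are
  exchanged and shifted by the energy.\<close>

definition wswap :: "nat \<Rightarrow> bas list \<Rightarrow> bas list" where
  "wswap i w = (let h = henergy (snd (w ! i)) (snd (w ! Suc i)) in
     w[i := (fst (w ! Suc i) + h, snd (w ! i)), Suc i := (fst (w ! i) - h, snd (w ! Suc i))])"

lemma length_wswap [simp]: "length (wswap i w) = length w"
  by (simp add: wswap_def Let_def)

lemma snd_nth_wswap: "Suc i < length w \<Longrightarrow> m < length w \<Longrightarrow> snd (wswap i w ! m) = snd (w ! m)"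
  by (simp add: wswap_def Let_def nth_list_update)

lemma map_snd_wswap: "Suc i < length w \<Longrightarrow> map snd (wswap i w) = map snd w"
  by (rule nth_equalityI) (simp_all add: snd_nth_wswap)

lemma wcoord_wswap:
  assumes "Suc i < length w" "m < length w"
  shows "wcoord (wswap i w) m = wcoord w (if m = i then Suc i else if m = Suc i then i else m)"
proof -
  have *: "(\<Sum>k<m. henergy (snd (wswap i w ! k)) (snd (wswap i w ! Suc k)))
      = (\<Sum>k<m. henergy (snd (w ! k)) (snd (w ! Suc k)))"
    using assms by (intro sum.cong) (simp_all add: snd_nth_wswap)
  consider "m = i" | "m = Suc i" | "m \<noteq> i" "m \<noteq> Suc i" by blast
  then show ?thesis
    unfolding wcoord_def * by cases (use assms in \<open>simp_all add: wswap_def Let_def nth_list_update\<close>)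
qed

text \<open>Both sides are one and the same monomial, multiplied by an R-matrix entry in one case
  and by the value of that entry at q = 0 in the other.\<close>

lemma wfun_wswap:
  assumes "Suc i < length w" "\<forall>x\<in>set w. validB x"
  shows "vanishing (sop i (wfun w) - wfun (wswap i w))"
  unfolding vanishing_def
proof (intro allI)
  fix z :: "nat \<Rightarrow> nat" and J :: "nat \<Rightarrow> tri"
  obtain a k where x: "w ! i = (a, num k)" 
    using assms ex_num[of "snd (w ! i)"] by (metis Suc_lessD nth_mem prod.collapse validB_def)
  obtain b l where y: "w ! Suc i = (b, num l)"
    using assms ex_num[of "snd (w ! Suc i)"] by (metis nth_mem prod.collapse validB_def)
  define p where "p = take i w"
  define s where "s = drop (Suc (Suc i)) w"
  have w: "w = p @ (a, num k) # (b, num l) # s"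
    using assms x y by (metis p_def s_def Cons_nth_drop_Suc Suc_lessD append_take_drop_id)
  have lp: "length p = i" using assms by (simp add: p_def)
  define h where "h = henergy (num k) (num l)"
  have sw: "wswap i w = p @ (b + h, num k) # (a - h, num l) # s"
    unfolding wswap_def x y Let_def h_def using lp by (simp add: w list_update_append)
  define P where "P = wfun p z J"
  define S where "S = wfun s (\<lambda>j. z (Suc (Suc (j + i)))) (\<lambda>j. J (Suc (Suc (j + i))))"
  have P: "wfun p (z(i := z (Suc i), Suc i := z i)) (J(i := k', Suc i := l')) = P" for k' l'
    unfolding P_def by (rule wfun_cong) (simp add: lp)
  define m where "m = z i"
  define n where "n = z (Suc i)"
  have 1: "wfun w (z(i := z (Suc i), Suc i := z i)) (J(i := k', Suc i := l'))
     = dl k' k * dl l' l * (P * (pt n powi a * pt m powi b) * S)" for k' l'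
    by (simp add: w wfun_append P lp S_def[symmetric] dl_def m_def n_def)
  have "sop i (wfun w) z J = (\<Sum>k'\<in>UNIV. \<Sum>l'\<in>UNIV. rm m n (J i) (J (Suc i)) k' l' *
      (dl k' k * dl l' l * (P * (pt n powi a * pt m powi b) * S)))"
    by (simp add: sop_def 1 m_def n_def)
  also have "\<dots> = rm m n (J i) (J (Suc i)) k l * (P * (pt n powi a * pt m powi b) * S)"
    by (cases k; cases l) (simp_all add: sum_tri dl_def)
  finally have 2: "sop i (wfun w) z J = rm m n (J i) (J (Suc i)) k l * (P * (pt n powi a * pt m powi b) * S)" .
  define C where "C = (if J i = k \<and> J (Suc i) = l then (pt m / pt n) powi h else 0)"
  have 3: "wfun (wswap i w) z J = C * (P * (pt n powi a * pt m powi b) * S)"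
    by (simp add: sw wfun_append lp P_def[symmetric] S_def[symmetric] C_def m_def n_def
        power_int_add power_int_diff power_int_divide_distrib)
  have "residue C (if J i = k \<and> J (Suc i) = l then (of_nat (Suc m) / of_nat (Suc n)) powi h else 0)"
    unfolding C_def by (auto intro!: residue_powi residue_divide simp del: of_nat_Suc)
  moreover have "residue (rm m n (J i) (J (Suc i)) k l)
      (if J i = k \<and> J (Suc i) = l then (of_nat (Suc m) / of_nat (Suc n)) powi h else 0)"
    using residue_rm[of m n "J i" "J (Suc i)" k l] by (cases "J i = k \<and> J (Suc i) = l") (auto simp: h_def simp del: of_nat_Suc)
  ultimately have "residue (rm m n (J i) (J (Suc i)) k l - C) 0"
    using residue_diff by fastforce
  moreover have "P * (pt n powi a * pt m powi b) * S \<in> Areg"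
    unfolding P_def S_def by (intro Areg_mult wfun_Areg pt_powi_Areg)
  ultimately have "residue ((rm m n (J i) (J (Suc i)) k l - C) * (P * (pt n powi a * pt m powi b) * S)) 0"
    by (rule residue_0_mult)
  then show "residue ((sop i (wfun w) - wfun (wswap i w)) z J) 0"
    by (simp only: minus_apply 2 3 left_diff_distrib)
qed

section \<open>Expansion of the antisymmetrizer at q = 0 into words\<close>

text \<open>Congruence, modulo functions vanishing at q = 0, to a rational combination of words with
  property P. Tracking only P avoids writing out the sum over the symmetric group.\<close>

inductive wspan :: "(bas list \<Rightarrow> bool) \<Rightarrow> fn \<Rightarrow> bool" for P where
  van: "vanishing f \<Longrightarrow> wspan P f"
| add: "wspan P f \<Longrightarrow> P w \<Longrightarrow> wspan P (f + (\<lambda>z J. of_rat c * wfun w z J))"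

lemma wspan_add: "wspan P g \<Longrightarrow> wspan P f \<Longrightarrow> wspan P (f + g)"
proof (induction rule: wspan.induct)
  case (van g)
  from van(2,1) show ?case
  proof (induction rule: wspan.induct)
    case (van f)
    then show ?case by (intro wspan.van vanishing_add)
  next
    case (add f w c)
    have "f + (\<lambda>z J. of_rat c * wfun w z J) + g = (f + g) + (\<lambda>z J. of_rat c * wfun w z J)"
      by (simp add: fun_eq_iff)
    then show ?case using wspan.add[OF add.IH[OF add.prems] add.hyps(2)] by metis
  qed
next
  case (add g w c)
  have "f + (g + (\<lambda>z J. of_rat c * wfun w z J)) = (f + g) + (\<lambda>z J. of_rat c * wfun w z J)"
    by (simp add: fun_eq_iff)
  then show ?case using wspan.add[OF add.IH[OF add.prems] add.hyps(2)] by metis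
qed

lemma wspan_wfun: "P w \<Longrightarrow> wspan P (\<lambda>z J. of_rat c * wfun w z J)"
  using wspan.add[OF wspan.van[OF vanishing_zero], of P w c] by (simp add: fun_eq_iff plus_fun_def)

lemma wspan_linear:
  assumes "wspan P f"
    and "\<And>f. vanishing f \<Longrightarrow> vanishing (L f)" "\<And>f g. L (f + g) = L f + L g"
    and "\<And>c f. L (\<lambda>z J. of_rat c * f z J) = (\<lambda>z J. of_rat c * L f z J)"
    and "\<And>w c. P w \<Longrightarrow> wspan Q (\<lambda>z J. of_rat c * L (wfun w) z J)"
  shows "wspan Q (L f)"
  using assms(1)
proof (induction rule: wspan.induct)
  case (van f)
  then show ?case by (intro wspan.van assms)
next
  case (add f w c)
  then show ?case unfolding assms(3,4) by (intro wspan_add assms(5))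
qed

lemma wspan_scale: "wspan P f \<Longrightarrow> wspan P (\<lambda>z J. of_rat c * f z J)"
proof (rule wspan_linear[where P = P and L = "\<lambda>f z J. of_rat c * f z J"])
  fix w d assume "P w"
  then show "wspan P (\<lambda>z J. of_rat d * (of_rat c * wfun w z J))"
    using wspan_wfun[of P w "d * c"] by (simp add: of_rat_mult mult.assoc)
qed (auto simp: fun_eq_iff algebra_simps intro!: vanishing_scale residue_Areg)

lemma wspan_uminus: "wspan P f \<Longrightarrow> wspan P (- f)"
  using wspan_scale[of P f "-1"] by (simp add: fun_Compl_def)

lemma wspan_mono: "wspan P f \<Longrightarrow> (\<And>w. P w \<Longrightarrow> Q w) \<Longrightarrow> wspan Q f"
  by (induction rule: wspan.induct) (auto intro: wspan.intros)

lemma wspan_sop: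
  assumes "wspan P f" "\<And>w. P w \<Longrightarrow> Suc i < length w \<and> (\<forall>x\<in>set w. validB x) \<and> Q (wswap i w)"
  shows "wspan Q (sop i f)"
proof (rule wspan_linear[OF assms(1)])
  fix w c assume "P w"
  note w = assms(2)[OF this]
  have "sop i (wfun w) = (sop i (wfun w) - wfun (wswap i w)) + (\<lambda>z J. of_rat 1 * wfun (wswap i w) z J)"
    by (simp add: fun_eq_iff)
  then have "wspan Q (sop i (wfun w))"
    using w wfun_wswap by (metis wspan.van wspan.add)
  then show "wspan Q (\<lambda>z J. of_rat c * sop i (wfun w) z J)" by (rule wspan_scale)
qed (simp_all add: sop_add sop_scale vanishing_sop del: plus_fun_apply)

lemma wspan_Asym:
  assumes "wspan P f" "\<And>w. P w \<Longrightarrow> wspan Q (Asym n (wfun w))"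
  shows "wspan Q (Asym n f)"
  by (rule wspan_linear[OF assms(1)])
    (simp_all add: Asym_add Asym_scale vanishing_Asym wspan_scale assms(2) del: plus_fun_apply)

text \<open>What permutations of the first n coordinates leave invariant. Knowing the set of these
  coordinates, rather than the permutation, is enough to recognise unsorted words.\<close>

definition wrel :: "nat \<Rightarrow> bas list \<Rightarrow> bas list \<Rightarrow> bool" where
  "wrel n w v \<longleftrightarrow> length v = length w \<and> map snd v = map snd w \<and>
     wcoord v ` {..<n} = wcoord w ` {..<n} \<and> (\<forall>m. n \<le> m \<longrightarrow> m < length w \<longrightarrow> wcoord v m = wcoord w m)"

lemma wrel_refl: "wrel n w w"
  by (simp add: wrel_def)

lemma wrel_trans: "wrel n w v \<Longrightarrow> wrel n v u \<Longrightarrow> wrel n w u"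
  by (simp add: wrel_def)

lemma wrel_Suc:
  assumes "wrel n w v" "n < length w" shows "wrel (Suc n) w v"
  using assms by (auto simp: wrel_def lessThan_Suc)

lemma wrel_valid:
  assumes "wrel n w v" "\<forall>x\<in>set w. validB x" shows "\<forall>x\<in>set v. validB x"
proof -
  have "snd ` set v = snd ` set w" using assms(1) unfolding wrel_def by (metis set_map)
  then show ?thesis using assms(2) unfolding validB_def by (metis image_iff)
qed

lemma wrel_wswap:
  assumes "Suc i < length w" shows "wrel (Suc (Suc i)) w (wswap i w)"
proof -
  have "wcoord (wswap i w) ` {..<Suc (Suc i)} = wcoord w ` (\<lambda>m. if m = i then Suc i else if m = Suc i then i else m) ` {..<Suc (Suc i)}"
    unfolding image_image using assms by (intro image_cong) (simp_all add: wcoord_wswap)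
  also have "(\<lambda>m. if m = i then Suc i else if m = Suc i then i else m) ` {..<Suc (Suc i)} = {..<Suc (Suc i)}"
    by (auto simp: image_iff)
  finally show ?thesis
    unfolding wrel_def using assms by (simp add: map_snd_wswap wcoord_wswap)
qed

text \<open>The terms s_{k-1} ... s_j with j < k carry the coordinate at j to position k, so outside
  the identity term position k holds an earlier coordinate of w.\<close>

lemma wspan_Dop:
  assumes "\<forall>x\<in>set w. validB x"
  shows "k < length w \<Longrightarrow> wspan (\<lambda>v. wrel (Suc k) w v \<and> wcoord v k \<in> wcoord w ` {..<k}) (Dop k (wfun w) - wfun w)"
proof (induction k)
  case 0
  show ?case by (rule wspan.van) (simp add: vanishing_def)
next
  case (Suc k)
  let ?Q = "\<lambda>v. wrel (Suc (Suc k)) w v \<and> wcoord v (Suc k) \<in> wcoord w ` {..<Suc k}"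
  have "wspan ?Q (sop k (Dop k (wfun w) - wfun w))"
  proof (rule wspan_sop[OF Suc.IH])
    fix v assume v: "wrel (Suc k) w v \<and> wcoord v k \<in> wcoord w ` {..<k}"
    then have len: "length v = length w" by (simp add: wrel_def)
    have "wrel (Suc (Suc k)) w (wswap k v)"
      using wrel_trans[OF wrel_Suc[of "Suc k" w v] wrel_wswap[of k v]] v Suc.prems len by simp
    moreover have "wcoord (wswap k v) (Suc k) = wcoord v k"
      using Suc.prems len by (simp add: wcoord_wswap)
    ultimately show "Suc k < length v \<and> (\<forall>x\<in>set v. validB x) \<and> ?Q (wswap k v)"
      using v Suc.prems len wrel_valid[OF _ assms] by (auto simp: lessThan_Suc)
  qed (use Suc.prems in simp)
  moreover have "wspan ?Q (sop k (wfun w))"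
  proof (rule wspan_sop[where P = "\<lambda>v. v = w"])
    show "wspan (\<lambda>v. v = w) (wfun w)" using wspan_wfun[of "\<lambda>v. v = w" w 1] by simp
    show "Suc k < length v \<and> (\<forall>x\<in>set v. validB x) \<and> ?Q (wswap k v)" if "v = w" for v
      using that Suc.prems assms by (auto simp: wrel_wswap wcoord_wswap)
  qed
  ultimately have "wspan ?Q (- (sop k (wfun w) + sop k (Dop k (wfun w) - wfun w)))"
    by (intro wspan_uminus wspan_add)
  moreover have "- (sop k (wfun w) + sop k (Dop k (wfun w) - wfun w)) = Dop (Suc k) (wfun w) - wfun w"
    by (simp add: sop_diff fun_eq_iff)
  ultimately show ?case by metis
qed

lemma wspan_Asym_wrel:
  "\<forall>x\<in>set w. validB x \<Longrightarrow> n \<le> length w \<Longrightarrow> wspan (wrel n w) (Asym n (wfun w))"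
proof (induction n arbitrary: w)
  case 0
  then show ?case using wspan_wfun[of "wrel 0 w" w 1] by (simp add: wrel_refl)
next
  case (Suc n)
  have "Dop n (wfun w) = (\<lambda>z J. of_rat 1 * wfun w z J) + (Dop n (wfun w) - wfun w)"
    by (simp add: fun_eq_iff)
  moreover have "wspan (wrel (Suc n) w) (Dop n (wfun w) - wfun w)"
    by (rule wspan_mono[OF wspan_Dop[OF Suc.prems(1)]]) (use Suc.prems(2) in auto)
  ultimately have "wspan (wrel (Suc n) w) (Dop n (wfun w))"
    using wspan_add[OF _ wspan_wfun[of "wrel (Suc n) w" w 1, OF wrel_refl]] by metis
  then have "wspan (wrel (Suc n) w) (Asym n (Dop n (wfun w)))"
  proof (rule wspan_Asym)
    fix v assume v: "wrel (Suc n) w v"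
    then have "length v = length w" by (simp add: wrel_def)
    then have "wspan (wrel n v) (Asym n (wfun v))"
      using Suc.prems wrel_valid[OF v] by (intro Suc.IH) simp_all
    then show "wspan (wrel (Suc n) w) (Asym n (wfun v))"
    proof (rule wspan_mono)
      fix u assume "wrel n v u"
      then show "wrel (Suc n) w u"
        using v Suc.prems \<open>length v = length w\<close> by (intro wrel_trans[OF v] wrel_Suc) simp_all
    qed
  qed
  then show ?case by simp
qed

definition wsorted :: "nat \<Rightarrow> bas list \<Rightarrow> bool" where
  "wsorted n w \<longleftrightarrow> (\<forall>i. Suc i < n \<longrightarrow> wcoord w i < wcoord w (Suc i))"

lemma wsorted_Suc: "wsorted (Suc n) w \<Longrightarrow> wsorted n w"
  by (simp add: wsorted_def)

lemma wsorted_less: "wsorted n w \<Longrightarrow> i < j \<Longrightarrow> j < n \<Longrightarrow> wcoord w i < wcoord w j"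
proof (induction j)
  case (Suc j)
  then have "wcoord w j < wcoord w (Suc j)" by (simp add: wsorted_def)
  then show ?case using Suc by (cases "i = j") auto
qed simp

text \<open>A strictly increasing arrangement of distinct numbers is unique, so only the identity
  permutation yields a sorted word.\<close>

lemma wspan_Asym_wsorted:
  assumes "\<forall>x\<in>set w. validB x" "n \<le> length w" "wsorted n w"
  shows "wspan (\<lambda>v. length v = length w \<and> map snd v = map snd w \<and> \<not> wsorted n v) (Asym n (wfun w) - wfun w)"
  using assms(2,3)
proof (induction n)
  case 0
  show ?case by (rule wspan.van) (simp add: vanishing_def)
next
  case (Suc n)
  let ?Q = "\<lambda>v. length v = length w \<and> map snd v = map snd w \<and> \<not> wsorted (Suc n) v"
  have "wsorted n w" using Suc.prems(2) by (rule wsorted_Suc)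
  then have 1: "wspan ?Q (Asym n (wfun w) - wfun w)"
    using Suc.prems(1) \<open>wsorted n w\<close> by (intro wspan_mono[OF Suc.IH]) (use Suc.prems(1) wsorted_Suc in auto)
  have 2: "wspan ?Q (Asym n (Dop n (wfun w) - wfun w))"
  proof (rule wspan_Asym[OF wspan_Dop[OF assms(1)]])
    show "n < length w" using Suc.prems by simp
    fix v assume v: "wrel (Suc n) w v \<and> wcoord v n \<in> wcoord w ` {..<n}"
    then have len: "length v = length w" by (simp add: wrel_def)
    have "wspan (wrel n v) (Asym n (wfun v))"
      using v assms(1) wrel_valid Suc.prems len by (intro wspan_Asym_wrel) auto
    then show "wspan ?Q (Asym n (wfun v))"
    proof (rule wspan_mono)
      fix u assume u: "wrel n v u"
      have "\<not> wsorted (Suc n) u"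
      proof
        \<comment> \<open>A sorted u would have its largest coordinate at position n, but there it
          has some smaller \<open>wcoord w j\<close>, and the maximum \<open>wcoord w n\<close> sits
          further left.\<close>
        assume s: "wsorted (Suc n) u"
        have un: "wcoord u n = wcoord v n" using u Suc.prems len by (simp add: wrel_def)
        obtain j where j: "j < n" "wcoord v n = wcoord w j" using v by auto
        have lt: "wcoord w j < wcoord w n" using wsorted_less[OF Suc.prems(2), of j n] j by simp
        have "wcoord w n \<in> wcoord v ` {..<Suc n}" using v by (auto simp: wrel_def)
        then obtain i where i: "i < Suc n" "wcoord w n = wcoord v i" by auto
        have "i \<noteq> n" using i lt j by auto
        then have "wcoord w n \<in> wcoord v ` {..<n}" using i by auto
        then have "wcoord w n \<in> wcoord u ` {..<n}" using u by (simp add: wrel_def)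
        then obtain k where k: "k < n" "wcoord w n = wcoord u k" by auto
        then have "wcoord u k < wcoord u n" using wsorted_less[OF s] by simp
        then show False using k un j lt by simp
      qed
      then show "?Q u" using u v by (simp add: wrel_def)
    qed
  qed
  have "Asym (Suc n) (wfun w) - wfun w = (Asym n (wfun w) - wfun w) + Asym n (Dop n (wfun w) - wfun w)"
    using Asym_add[of n "wfun w" "Dop n (wfun w) - wfun w"] by (simp add: fun_eq_iff)
  then show ?case using wspan_add[OF 2 1] by metis
qed

lemma wspan_finite:
  assumes "wspan P f"
  shows "\<exists>T \<rho>. finite T \<and> (\<forall>w\<in>T. P w) \<and> vanishing (\<lambda>z J. f z J - (\<Sum>w\<in>T. of_rat (\<rho> w) * wfun w z J))"
  using assms
proof (induction rule: wspan.induct)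
  case (van f)
  then show ?case by (intro exI[of _ "{}"]) simp
next
  case (add f w c)
  then obtain T \<rho> where T: "finite T" "\<forall>w\<in>T. P w" "vanishing (\<lambda>z J. f z J - (\<Sum>w\<in>T. of_rat (\<rho> w) * wfun w z J))"
    by blast
  define \<rho>' where "\<rho>' v = (if v \<in> T then \<rho> v else 0) + (if v = w then c else 0)" for v
  have "(\<Sum>v\<in>insert w T. of_rat (\<rho>' v) * wfun v z J)
     = (\<Sum>v\<in>T. of_rat (\<rho> v) * wfun v z J) + of_rat c * wfun w z J" for z J
  proof -
    have "(\<Sum>v\<in>insert w T. of_rat (\<rho>' v) * wfun v z J)
      = (\<Sum>v\<in>insert w T. of_rat (if v \<in> T then \<rho> v else 0) * wfun v z J)
      + (\<Sum>v\<in>insert w T. of_rat (if v = w then c else 0) * wfun v z J)"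
      by (simp add: \<rho>'_def of_rat_add distrib_right sum.distrib)
    also have "(\<Sum>v\<in>insert w T. of_rat (if v \<in> T then \<rho> v else 0) * wfun v z J) = (\<Sum>v\<in>T. of_rat (\<rho> v) * wfun v z J)"
      using T(1) by (intro sum.mono_neutral_cong_right) auto
    also have "(\<Sum>v\<in>insert w T. of_rat (if v = w then c else 0) * wfun v z J) = (\<Sum>v\<in>{w}. of_rat c * wfun v z J)"
      using T(1) by (intro sum.mono_neutral_cong_right) auto
    finally show ?thesis by simp
  qed
  then have "(\<lambda>z J. (f + (\<lambda>z J. of_rat c * wfun w z J)) z J - (\<Sum>v\<in>insert w T. of_rat (\<rho>' v) * wfun v z J))
     = (\<lambda>z J. f z J - (\<Sum>w\<in>T. of_rat (\<rho> w) * wfun w z J))"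
    by (simp add: fun_eq_iff)
  then show ?case using T add(2) by (intro exI[of _ "insert w T"] exI[of _ \<rho>']) simp
qed

section \<open>Linear independence of words at q = 0\<close>

text \<open>\<open>wfun\<close> is constant in q, so independence at q = 0 can be proved over the
  rationals.\<close>

fun wfunq :: "bas list \<Rightarrow> (nat \<Rightarrow> nat) \<Rightarrow> (nat \<Rightarrow> tri) \<Rightarrow> rat" where
  "wfunq [] = (\<lambda>z J. 1)"
| "wfunq (x # w) = (\<lambda>z J. (if snd x = num (J 0) then of_nat (Suc (z 0)) powi fst x else 0) *
     wfunq w (\<lambda>i. z (Suc i)) (\<lambda>i. J (Suc i)))"

lemma of_rat_powi: "(of_rat (r powi n) :: 'a::field_char_0) = of_rat r powi n"
  by (simp add: power_int_def of_rat_power of_rat_inverse)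

lemma wfun_of_rat: "wfun w z J = of_rat (wfunq w z J)"
  by (induction w arbitrary: z J) (simp_all add: pt_of_rat of_rat_mult of_rat_powi del: of_nat_Suc)

lemma wfunq_nonzeroD: "wfunq w z J \<noteq> 0 \<Longrightarrow> i < length w \<Longrightarrow> snd (w ! i) = num (J i)"
proof (induction w arbitrary: z J i)
  case (Cons x w)
  then show ?case by (cases i) (auto split: if_splits)
qed simp

text \<open>The parameter is \<open>Suc (z i)\<close>, which the substitution 2 z_i + 1 doubles. The
  resulting powers of 2 separate the exponents at position i.\<close>

lemma wfunq_scale_arg:
  "i < length w \<Longrightarrow> wfunq w (z(i := 2 * z i + 1)) J = 2 powi fst (w ! i) * wfunq w z J"
proof (induction w arbitrary: z J i)
  case (Cons x w)
  show ?case
  proof (cases i)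
    case 0
    have "(of_nat (Suc (2 * z 0 + 1)) :: rat) = 2 * of_nat (Suc (z 0))" by simp
    then show ?thesis using 0 by (simp add: power_int_mult_distrib del: of_nat_Suc)
  next
    case (Suc j)
    have "(\<lambda>k. (z(i := 2 * z i + 1)) (Suc k)) = (\<lambda>k. z (Suc k))(j := 2 * z (Suc j) + 1)"
      using Suc by auto
    then have "wfunq w (\<lambda>k. (z(i := 2 * z i + 1)) (Suc k)) (\<lambda>k. J (Suc k))
       = 2 powi fst (w ! j) * wfunq w (\<lambda>k. z (Suc k)) (\<lambda>k. J (Suc k))"
      using Suc Cons.IH[of j "\<lambda>k. z (Suc k)"] Cons.prems by simp
    then show ?thesis using Suc by (simp del: of_nat_Suc fun_upd_apply) simp
  qed
qed simp

lemma ex_wfunq_nonzero: "\<forall>x\<in>set w. validB x \<Longrightarrow> \<exists>J. wfunq w z J \<noteq> 0"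
proof (induction w arbitrary: z)
  case (Cons x w)
  then obtain J where J: "wfunq w (\<lambda>i. z (Suc i)) J \<noteq> 0" by auto
  obtain k where "snd x = num k" using Cons.prems ex_num by (auto simp: validB_def)
  then have "wfunq (x # w) z (case_nat k J) \<noteq> 0" using J by (simp del: of_nat_Suc)
  then show ?case by blast
qed simp

text \<open>Artin's argument: distinct words give distinct characters.\<close>

lemma wfunq_independent:
  assumes "finite W" "\<forall>w\<in>W. length w = n \<and> (\<forall>x\<in>set w. validB x)"
    and "\<And>z J. (\<Sum>w\<in>W. c w * wfunq w z J) = 0"
  shows "\<forall>w\<in>W. c w = 0"
  using assms
proof (induction W arbitrary: c rule: finite_induct)
  case (insert w0 W)
  \<comment> \<open>The function l acts as an eigenvalue: if the sum weighted by l vanishes as well,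
    subtracting \<open>l w0\<close> times the original sum removes w0, and the induction hypothesis
    applies.\<close>
  have step: "c w1 = 0"
    if w1: "w1 \<in> W" "l w1 \<noteq> l w0" and l: "\<And>z J. (\<Sum>w\<in>insert w0 W. c w * l w * wfunq w z J) = 0"
    for w1 and l :: "bas list \<Rightarrow> rat"
  proof -
    have "(\<Sum>w\<in>W. (c w * (l w - l w0)) * wfunq w z J) = 0" for z J
    proof -
      have "(\<Sum>w\<in>insert w0 W. c w * (l w - l w0) * wfunq w z J)
         = (\<Sum>w\<in>insert w0 W. c w * l w * wfunq w z J) - l w0 * (\<Sum>w\<in>insert w0 W. c w * wfunq w z J)"
        unfolding sum_distrib_left sum_subtractf[symmetric] by (intro sum.cong refl) (simp add: algebra_simps)
      then show ?thesis using l insert.prems(2) insert.hyps by simp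
    qed
    then have "\<forall>w\<in>W. c w * (l w - l w0) = 0"
      using insert.prems(1) by (intro insert.IH) auto
    then have "c w1 * (l w1 - l w0) = 0" using w1(1) by blast
    then show ?thesis using w1(2) by simp
  qed
  have zero: "c w1 = 0" if w1: "w1 \<in> W" for w1
  proof -
    have "w1 \<noteq> w0" using w1 insert.hyps by auto
    moreover have len: "length w1 = n" "length w0 = n" using w1 insert.prems by auto
    ultimately obtain i where i: "i < n" "w1 ! i \<noteq> w0 ! i" by (metis nth_equalityI)
    show ?thesis
    proof (cases "snd (w1 ! i) = snd (w0 ! i)")
      case True
      then have "fst (w1 ! i) \<noteq> fst (w0 ! i)" using i by (metis prod.collapse)
      then have "(2::rat) powi fst (w1 ! i) \<noteq> 2 powi fst (w0 ! i)"
        using power_int_strict_increasing[of _ _ "2::rat"] by (metis linorder_neqE order_less_irrefl one_less_numeral_iff semiring_norm(76))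
      then show ?thesis
      proof (rule step[OF w1])
        fix z J
        have "(\<Sum>w\<in>insert w0 W. c w * 2 powi fst (w ! i) * wfunq w z J)
           = (\<Sum>w\<in>insert w0 W. c w * wfunq w (z(i := 2 * z i + 1)) J)"
        proof (rule sum.cong[OF refl])
          fix w assume "w \<in> insert w0 W"
          then have "length w = n" using insert.prems(1) by blast
          then have "i < length w" using i(1) by simp
          then show "c w * 2 powi fst (w ! i) * wfunq w z J = c w * wfunq w (z(i := 2 * z i + 1)) J"
            by (simp only: wfunq_scale_arg mult.assoc)
        qed
        then show "(\<Sum>w\<in>insert w0 W. c w * 2 powi fst (w ! i) * wfunq w z J) = 0"
          using insert.prems(2) by simp
      qed
    next
      case False
      \<comment> \<open>For different components at i the eigenvalue is the indicator of the
        component of w0, realised by a factor depending only on \<open>J i\<close>.\<close>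
      define l where "l w = (if snd (w ! i) = snd (w0 ! i) then 1 else 0 :: rat)" for w :: "bas list"
      have "l w1 \<noteq> l w0" using False by (simp add: l_def)
      then show ?thesis
      proof (rule step[OF w1])
        fix z J
        have "(\<Sum>w\<in>insert w0 W. c w * l w * wfunq w z J)
           = (\<Sum>w\<in>insert w0 W. (if num (J i) = snd (w0 ! i) then 1 else 0) * (c w * wfunq w z J))"
        proof (rule sum.cong[OF refl])
          fix w assume "w \<in> insert w0 W"
          then have "length w = n" using insert.prems(1) by blast
          then have "i < length w" using i(1) by simp
          then have "wfunq w z J = 0 \<or> snd (w ! i) = num (J i)" using wfunq_nonzeroD by blast
          then show "c w * l w * wfunq w z J = (if num (J i) = snd (w0 ! i) then 1 else 0) * (c w * wfunq w z J)"
            by (auto simp: l_def)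
        qed
        then show "(\<Sum>w\<in>insert w0 W. c w * l w * wfunq w z J) = 0"
          unfolding sum_distrib_left[symmetric] insert.prems(2) by simp
      qed
    qed
  qed
  obtain J where "wfunq w0 (\<lambda>_. 0) J \<noteq> 0" using ex_wfunq_nonzero insert.prems(1) by blast
  moreover have "c w0 * wfunq w0 (\<lambda>_. 0) J = 0"
    using insert.prems(2)[of "\<lambda>_. 0" J] insert.hyps zero by simp
  ultimately show ?case using zero by simp
qed simp

lemma wfun_independent:
  assumes "finite W" "\<forall>w\<in>W. length w = n \<and> (\<forall>x\<in>set w. validB x)"
    and "vanishing (\<lambda>z J. \<Sum>w\<in>W. of_rat (c w) * wfun w z J)"
  shows "\<forall>w\<in>W. c w = 0"
proof (rule wfunq_independent[OF assms(1,2)])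
  fix z J
  have "residue (\<Sum>w\<in>W. of_rat (c w) * wfun w z J) 0" using assms(3) by (simp add: vanishing_def)
  moreover have "(\<Sum>w\<in>W. of_rat (c w) * wfun w z J) = of_rat (\<Sum>w\<in>W. c w * wfunq w z J)"
    by (simp add: wfun_of_rat of_rat_sum of_rat_mult)
  ultimately show "(\<Sum>w\<in>W. c w * wfunq w z J) = 0" using residue_unique residue_of_rat by metis
qed

lemma contr_sum_left:
  assumes "finite S"
  shows "finite (supp (\<lambda>w. \<Sum>s\<in>S. b s * delta s w)) \<and> contr (\<lambda>w. \<Sum>s\<in>S. b s * delta s w) \<theta> = (\<Sum>s\<in>S. b s * \<theta> s)"
  using assms
proof (induction S rule: finite_induct)
  case (insert s S)
  then show ?case by (simp add: contr_add contr_scale finite_supp_add finite_supp_scale)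
qed (simp add: contr_zero supp_zero)

lemma tfun_sum_delta: "finite S \<Longrightarrow> tfun (\<lambda>w. \<Sum>s\<in>S. b s * delta s w) = (\<lambda>z J. \<Sum>s\<in>S. b s * wfun s z J)"
  by (simp add: tfun_def contr_sum_left)

lemma Asym_sum: "Asym n (\<lambda>z J. \<Sum>s\<in>S. b s * f s z J) = (\<lambda>z J. \<Sum>s\<in>S. b s * Asym n (f s) z J)"
proof (induction S rule: infinite_finite_induct)
  case (insert s S)
  have "(\<lambda>z J. \<Sum>s\<in>insert s S. b s * f s z J) = (\<lambda>z J. b s * f s z J) + (\<lambda>z J. \<Sum>s\<in>S. b s * f s z J)"
    using insert by (simp add: fun_eq_iff)
  then have "Asym n (\<lambda>z J. \<Sum>s\<in>insert s S. b s * f s z J)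
     = (\<lambda>z J. b s * Asym n (f s) z J) + (\<lambda>z J. \<Sum>s\<in>S. b s * Asym n (f s) z J)"
    by (simp only: Asym_add Asym_scale insert.IH)
  then show ?case using insert by (simp add: fun_eq_iff)
next
  case empty
  then show ?case using Asym_scale[of n 0 0] by simp
next
  case (infinite S)
  then show ?case using Asym_scale[of n 0 0] by simp
qed

lemma wspan_sum:
  assumes "finite S" "\<And>s. s \<in> S \<Longrightarrow> wspan P (f s)"
  shows "wspan P (\<lambda>z J. \<Sum>s\<in>S. f s z J)"
  using assms
proof (induction S rule: finite_induct)
  case empty
  show ?case by (rule wspan.van) (simp add: vanishing_def)
next
  case (insert s S)
  have "(\<lambda>z J. \<Sum>s\<in>insert s S. f s z J) = f s + (\<lambda>z J. \<Sum>s\<in>S. f s z J)"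
    using insert.hyps by (simp add: fun_eq_iff)
  then show ?case using insert by (simp only:) (intro wspan_add insert.IH insert.prems; simp)
qed

text \<open>Apply the antisymmetrizer and set q = 0: the element of N and the multiple of q^k
  disappear, and the values of the b_s remain as coefficients of sorted words, accompanied by
  unsorted words only.\<close>

theorem sorted_words_independent:
  assumes "finite S" "\<And>s. s \<in> S \<Longrightarrow> length s = n \<and> (\<forall>x\<in>set s. validB x) \<and> wsorted n s"
    and "\<And>s. s \<in> S \<Longrightarrow> b s \<in> Areg" and "v \<in> Ltens n" "0 < k"
    and "(\<lambda>w. (\<Sum>s\<in>S. b s * delta s w) - qq ^ k * v w) \<in> Nn n"
  shows "\<forall>s\<in>S. residue (b s) 0"
proof -
  define U where "U = (\<lambda>w. \<Sum>s\<in>S. b s * delta s w)"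
  have fU: "finite (supp U)" unfolding U_def using contr_sum_left[OF assms(1)] by blast
  have fv: "finite (supp v)" using assms(4) by (simp add: Ltens_def istens_def)
  have "Asym n (tfun (\<lambda>w. U w + (- (qq ^ k)) * v w)) = 0"
    using Asym_Nn[OF assms(6)] by (simp add: U_def)
  then have "Asym n (tfun U) + (\<lambda>z J. (- (qq ^ k)) * Asym n (tfun v) z J) = 0"
    by (simp only: tfun_add[OF fU finite_supp_scale[OF fv]] tfun_scale[OF fv] Asym_add Asym_scale)
  then have eq: "(\<Sum>s\<in>S. b s * Asym n (wfun s) z J) = qq ^ k * Asym n (tfun v) z J" for z J
    by (simp add: U_def tfun_sum_delta[OF assms(1)] Asym_sum fun_eq_iff)
  obtain \<beta> where \<beta>: "\<And>s. s \<in> S \<Longrightarrow> residue (b s) (\<beta> s)"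
    using assms(3) unfolding Areg_iff_residue by metis
  have reg: "regular (Asym n (wfun s))" for s
    by (intro regular_Asym) (simp add: regular_def wfun_Areg)
  define g where "g = (\<lambda>z J. \<Sum>s\<in>S. of_rat (\<beta> s) * Asym n (wfun s) z J)"
  have "vanishing g" unfolding vanishing_def
  proof (intro allI)
    fix z J
    have "g z J = qq ^ k * Asym n (tfun v) z J - (\<Sum>s\<in>S. (b s - of_rat (\<beta> s)) * Asym n (wfun s) z J)"
      unfolding eq[symmetric] g_def by (simp add: left_diff_distrib sum_subtractf)
    moreover have "residue (qq ^ k * Asym n (tfun v) z J) 0"
      using regular_Asym[OF regular_tfun[OF assms(4)]] assms(5) by (intro residue_qq_power_mult) (auto simp: regular_def)
    moreover have "residue (\<Sum>s\<in>S. (b s - of_rat (\<beta> s)) * Asym n (wfun s) z J) (\<Sum>s\<in>S. 0)"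
    proof (rule residue_sum)
      fix s assume "s \<in> S"
      then have "residue (b s - of_rat (\<beta> s)) 0" using residue_diff[OF \<beta>[of s] residue_of_rat[of "\<beta> s"]] by simp
      then show "residue ((b s - of_rat (\<beta> s)) * Asym n (wfun s) z J) 0"
        using reg by (intro residue_0_mult) (auto simp: regular_def)
    qed
    ultimately show "residue (g z J) 0" using residue_diff by fastforce
  qed
  define P where "P v \<longleftrightarrow> length v = n \<and> (\<forall>x\<in>set v. validB x) \<and> \<not> wsorted n v" for v
  define G where "G = (\<lambda>z J. \<Sum>s\<in>S. of_rat (\<beta> s) * (Asym n (wfun s) - wfun s) z J)"
  have P: "wspan P (\<lambda>z J. of_rat (\<beta> s) * (Asym n (wfun s) - wfun s) z J)" if s: "s \<in> S" for s
  proof (rule wspan_scale, rule wspan_mono[OF wspan_Asym_wsorted])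
    show "\<forall>x\<in>set s. validB x" "n \<le> length s" "wsorted n s" using assms(2)[OF s] by auto
    fix w assume w: "length w = length s \<and> map snd w = map snd s \<and> \<not> wsorted n w"
    then have "snd ` set w = snd ` set s" by (metis set_map)
    then have "\<forall>x\<in>set w. validB x"
      using assms(2)[OF s] unfolding validB_def by (metis image_iff)
    then show "P w" using w assms(2)[OF s] by (simp add: P_def)
  qed
  have "wspan P G" unfolding G_def by (rule wspan_sum[OF assms(1) P])
  from wspan_finite[OF this] obtain T \<rho> where T: "finite T" "\<forall>w\<in>T. P w" "vanishing (\<lambda>z J. G z J - (\<Sum>w\<in>T. of_rat (\<rho> w) * wfun w z J))"
    by auto
  \<comment> \<open>Unsorted corrections cannot cancel the coefficients of sorted words.\<close>
  have disj: "S \<inter> T = {}" using T(2) assms(2) by (auto simp: P_def)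
  define c where "c w = (if w \<in> S then \<beta> w else \<rho> w)" for w
  have "(\<Sum>w\<in>S \<union> T. of_rat (c w) * wfun w z J) = g z J - (G z J - (\<Sum>w\<in>T. of_rat (\<rho> w) * wfun w z J))" for z J
  proof -
    have "(\<Sum>w\<in>S \<union> T. of_rat (c w) * wfun w z J)
       = (\<Sum>w\<in>S. of_rat (c w) * wfun w z J) + (\<Sum>w\<in>T. of_rat (c w) * wfun w z J)"
      using disj assms(1) T(1) by (intro sum.union_disjoint)
    moreover have "(\<Sum>w\<in>S. of_rat (c w) * wfun w z J) = (\<Sum>w\<in>S. of_rat (\<beta> w) * wfun w z J)"
      by (intro sum.cong) (simp_all add: c_def)
    moreover have "(\<Sum>w\<in>T. of_rat (c w) * wfun w z J) = (\<Sum>w\<in>T. of_rat (\<rho> w) * wfun w z J)"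
      using disj by (intro sum.cong) (auto simp: c_def)
    ultimately show ?thesis
      by (simp add: g_def G_def right_diff_distrib sum_subtractf)
  qed
  then have "vanishing (\<lambda>z J. \<Sum>w\<in>S \<union> T. of_rat (c w) * wfun w z J)"
    using vanishing_diff[OF \<open>vanishing g\<close> T(3)] by (simp add: vanishing_def)
  then have "\<forall>w\<in>S \<union> T. c w = 0"
    using T assms(1,2) by (intro wfun_independent) (auto simp: P_def)
  then have "\<beta> s = 0" if "s \<in> S" for s using that by (metis UnI1 c_def)
  then show ?thesis using \<beta> by metis
qed

section \<open>Straightening\<close>

lemma Nsp_add: "u \<in> Nsp \<Longrightarrow> v \<in> Nsp \<Longrightarrow> u + v \<in> Nsp"
  using Nsp.add by (simp add: plus_fun_def)

lemma Nsp_diff: "u \<in> Nsp \<Longrightarrow> v \<in> Nsp \<Longrightarrow> u - v \<in> Nsp"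
  using Nsp.add[OF _ Nsp.smult[of v "-1"], of u] by (simp add: fun_diff_def)

lemma Nsp_cancel: "c \<cdot> u \<in> Nsp \<Longrightarrow> c \<noteq> 0 \<Longrightarrow> u \<in> Nsp"
  using Nsp.smult[of "c \<cdot> u" "inverse c"] by (simp add: mult.assoc[symmetric] scaleup_def)

lemma op2_lc: "op2 g (lc xs) = (\<lambda>w. \<Sum>(c, v)\<leftarrow>xs. c * op2b g v w)"
  unfolding op2_def lin_def
  using contr_lc[of xs] unfolding contr_def by (simp add: fun_eq_iff)

lemma op2_add: "finite (supp u) \<Longrightarrow> finite (supp v) \<Longrightarrow> op2 g (u + v) = op2 g u + op2 g v"
proof (intro ext)
  fix w assume "finite (supp u)" "finite (supp v)"
  then show "op2 g (u + v) w = (op2 g u + op2 g v) w"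
    using contr_add[of u v "\<lambda>v. op2b g v w"]
    by (simp add: op2_def lin_def contr_def plus_fun_def)
qed

section \<open>The two-letter relations\<close>

type_synonym term2 = "K \<times> (int \<times> tri) \<times> (int \<times> tri)"

definition shift_lc :: "int \<Rightarrow> int \<Rightarrow> term2 list \<Rightarrow> tens" where
  "shift_lc a b ts = lc (map (\<lambda>(c, (p, i), (r, j)). (c, [(a + p, num i), (b + r, num j)])) ts)"

lemma shift_lc_Nil [simp]: "shift_lc a b [] = 0"
  and shift_lc_Cons: "shift_lc a b ((c, (p, i), (r, j)) # ts)
    = c \<cdot> delta [(a + p, num i), (b + r, num j)] + shift_lc a b ts"
  by (simp_all add: shift_lc_def lc_Cons fun_eq_iff)

lemma finite_supp_shift_lc [simp]: "finite (supp (shift_lc a b ts))"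
  by (simp add: shift_lc_def)

lemma op2_shift_lc:
  "op2 ZZ (shift_lc a b ts) = shift_lc (a + 1) (b + 1) ts"
  "op2 ZZinv (shift_lc a b ts) = shift_lc (a - 1) (b - 1) ts"
  "op2 ZS (shift_lc a b ts) = shift_lc (a + 1) b ts + shift_lc a (b + 1) ts"
  unfolding shift_lc_def op2_lc
  by (induction ts; auto simp: lc_Cons op2b_num fun_eq_iff algebra_simps)+

lemma shift_diag_Nsp:
  assumes "shift_lc 0 0 ts \<in> Nsp" shows "shift_lc a a ts \<in> Nsp"
proof (induction a rule: int_induct[where k = 0])
  case base
  then show ?case using assms .
next
  case (step1 i)
  then show ?case using Nsp.oper[of _ ZZ] by (simp add: op2_shift_lc(1)[symmetric] validgen_def)
next
  case (step2 i)
  then show ?case using Nsp.oper[of _ ZZinv] by (simp add: op2_shift_lc(2)[symmetric] validgen_def)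
qed

text \<open>Newton's recursion: z_1^(d+2) + z_2^(d+2) is (z_1 + z_2) (z_1^(d+1) + z_2^(d+1)) minus
  z_1 z_2 (z_1^d + z_2^d). The factor z_1 z_2 raises a, hence the generalisation over a.\<close>

lemma shift_sym_Nsp_nat:
  assumes "shift_lc 0 0 ts \<in> Nsp"
  shows "shift_lc (a + int d) a ts + shift_lc a (a + int d) ts \<in> Nsp"
proof (induction d arbitrary: a rule: induct_nat_012)
  case 0
  show ?case using Nsp_add[OF shift_diag_Nsp[OF assms, of a] shift_diag_Nsp[OF assms, of a]]
    by (simp only: of_nat_0 add_0_right)
next
  case 1
  then show ?case
    using Nsp.oper[OF shift_diag_Nsp[OF assms, of a], of ZS]
    by (simp add: op2_shift_lc(3) validgen_def del: plus_fun_apply)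
next
  case (ge2 d)
  let ?u = "shift_lc (a + int (Suc d)) a ts + shift_lc a (a + int (Suc d)) ts"
  let ?v = "shift_lc (a + 1 + int d) (a + 1) ts + shift_lc (a + 1) (a + 1 + int d) ts"
  have "op2 ZS ?u - ?v \<in> Nsp"
    using ge2 by (intro Nsp_diff Nsp.oper) (simp_all add: validgen_def del: plus_fun_apply)
  moreover have "op2 ZS ?u = shift_lc (a + 1 + int d + 1) a ts + shift_lc (a + 1 + int d) (a + 1) ts
     + (shift_lc (a + 1) (a + 1 + int d) ts + shift_lc a (a + 1 + int d + 1) ts)"
    by (simp add: op2_add op2_shift_lc(3) algebra_simps del: plus_fun_apply)
  ultimately show ?case by (simp add: fun_eq_iff algebra_simps fun_diff_def plus_fun_def)
qed

lemma shift_sym_Nsp: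
  assumes "shift_lc 0 0 ts \<in> Nsp"
  shows "shift_lc a b ts + shift_lc b a ts \<in> Nsp"
proof (cases "b \<le> a")
  case True
  then show ?thesis using shift_sym_Nsp_nat[OF assms, of b "nat (a - b)"] by simp
next
  case False
  then show ?thesis using shift_sym_Nsp_nat[OF assms, of a "nat (b - a)"] by (simp add: add.commute)
qed

text \<open>The relation with leading term \<open>z_1\<^sup>h v_i \<otimes> v_j\<close>, where h is the energy; \<open>reltail i j\<close> lists its
  remaining terms, divided by q.\<close>

definition reltail :: "tri \<Rightarrow> tri \<Rightarrow> term2 list" where
  "reltail i j = (case (i, j) of
     (T0, T0) \<Rightarrow> []
   | (T0, T1) \<Rightarrow> [(qq, (0, T1), (0, T0))]
   | (T1, T0) \<Rightarrow> [(qq, (0, T0), (1, T1))]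
   | (T0, T2) \<Rightarrow> [(1, (0, T1), (0, T1)), (qq^3, (0, T2), (0, T0))]
   | (T2, T0) \<Rightarrow> [(1, (1, T1), (1, T1)), (qq^3, (0, T0), (2, T2))]
   | (T1, T1) \<Rightarrow> [(qq, (0, T1), (1, T1)), (1 + qq^2, (1, T2), (0, T0)), (1 + qq^2, (0, T0), (1, T2))]
   | (T1, T2) \<Rightarrow> [(qq, (0, T2), (0, T1))]
   | (T2, T1) \<Rightarrow> [(qq, (0, T1), (1, T2))]
   | (T2, T2) \<Rightarrow> [])"

definition relation :: "tri \<Rightarrow> tri \<Rightarrow> term2 list" where
  "relation i j = (1, (henergy (num i) (num j), i), (0, j)) # map (\<lambda>(c, p, r). (qq * c, p, r)) (reltail i j)"

lemma op2_shift_lc_EF: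
  "op2 g (shift_lc a b ts) = (\<lambda>w. \<Sum>(c, (p, i), (r, j))\<leftarrow>ts. c * op2b g [(a + p, num i), (b + r, num j)] w)"
  unfolding shift_lc_def op2_lc by (rule ext) (induction ts; auto)

text \<open>The quantum integers [2], [3] and [4], which have to be cancelled when relations are
  produced by e_0 and f_1.\<close>

lemma nonzero_sums: "qq + inverse qq \<noteq> 0" "1 + qq^2 + inverse (qq^2) \<noteq> 0"
  "(qq + inverse qq) * (qq^2 + inverse (qq^2)) \<noteq> 0"
proof -
  have 1: "1 + x \<noteq> 0" if "residue x 0" for x
    using residue_add[OF residue_1 that] residue_unique[of "1 + x" "1 + 0" 0] by auto
  have q: "residue (qq ^ n) 0" if "0 < n" for n
    using residue_qq_power_mult[OF that Areg_1] by simp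
  have "qq + inverse qq = inverse qq * (1 + qq^2)" by (simp add: field_simps power2_eq_square)
  moreover have "1 + qq^2 \<noteq> 0" by (rule 1) (rule q, simp)
  ultimately show a: "qq + inverse qq \<noteq> 0" by simp
  have "1 + qq^2 + inverse (qq^2) = inverse (qq^2) * (1 + (qq^2 + qq^4))"
    by (simp add: field_simps power2_eq_square power4_eq_xxxx)
  moreover have "1 + (qq^2 + qq^4) \<noteq> 0"
    by (rule 1) (use residue_add[OF q[of 2] q[of 4]] in simp)
  ultimately show "1 + qq^2 + inverse (qq^2) \<noteq> 0" by simp
  have "qq^2 + inverse (qq^2) = inverse (qq^2) * (1 + qq^4)" by (simp add: field_simps power2_eq_square power4_eq_xxxx)
  moreover have "1 + qq^4 \<noteq> 0" by (rule 1) (rule q, simp)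
  ultimately show "(qq + inverse qq) * (qq^2 + inverse (qq^2)) \<noteq> 0" using a by simp
qed

lemmas op2b_simps =
  op2b_num(2)[of a T0 b T0 for a b, simplified]
  op2b_num(2)[of a T0 b T1 for a b, simplified]
  op2b_num(2)[of a T0 b T2 for a b, simplified]
  op2b_num(2)[of a T1 b T0 for a b, simplified]
  op2b_num(2)[of a T1 b T1 for a b, simplified]
  op2b_num(2)[of a T1 b T2 for a b, simplified]
  op2b_num(2)[of a T2 b T0 for a b, simplified]
  op2b_num(2)[of a T2 b T1 for a b, simplified]
  op2b_num(2)[of a T2 b T2 for a b, simplified]
  op2b_num(3)[of a T0 b T0 for a b, simplified]
  op2b_num(3)[of a T0 b T1 for a b, simplified]
  op2b_num(3)[of a T0 b T2 for a b, simplified]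
  op2b_num(3)[of a T1 b T0 for a b, simplified]
  op2b_num(3)[of a T1 b T1 for a b, simplified]
  op2b_num(3)[of a T1 b T2 for a b, simplified]
  op2b_num(3)[of a T2 b T0 for a b, simplified]
  op2b_num(3)[of a T2 b T1 for a b, simplified]
  op2b_num(3)[of a T2 b T2 for a b, simplified]

lemmas rel_simps = relation_def reltail_def henergy_def shift_lc_Cons tmat_def lc_Cons fun_eq_iff

text \<open>Every relation comes from an earlier one by e_0 or f_1, up to a quantum integer.\<close>

lemma relation_Nsp: "shift_lc 0 0 (relation i j) \<in> Nsp"
proof -
  have vE: "validgen (E 0)" and vF: "validgen (F 1)" and vZ: "validgen ZZinv" by (simp_all add: validgen_def)
  have 00: "shift_lc 0 0 (relation T0 T0) \<in> Nsp"
  proof -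
    have "shift_lc 0 0 (relation T0 T0) = delta [(0, 0), (0, 0)]" by (simp add: rel_simps)
    then show ?thesis using Nsp.gen0 by simp
  qed
  have 01: "shift_lc 0 0 (relation T0 T1) \<in> Nsp"
  proof (rule Nsp_cancel)
    have "1 \<cdot> shift_lc 0 0 (relation T0 T1) = op2 (F 1) (shift_lc 0 0 (relation T0 T0))"
      unfolding op2_shift_lc_EF
      by (simp add: rel_simps op2b_simps) (simp add: field_simps power2_eq_square power3_eq_cube power4_eq_xxxx flip: numeral_2_eq_2)
    then show "1 \<cdot> shift_lc 0 0 (relation T0 T1) \<in> Nsp"
      using Nsp.oper[OF 00 vF] by simp
  qed (use nonzero_sums in simp_all)
  have 10: "shift_lc 0 0 (relation T1 T0) \<in> Nsp"
  proof (rule Nsp_cancel)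
    have "1 \<cdot> shift_lc 0 0 (relation T1 T0) = op2 (E 0) (shift_lc 0 0 (relation T0 T0))"
      unfolding op2_shift_lc_EF
      by (simp add: rel_simps op2b_simps) (simp add: field_simps power2_eq_square power3_eq_cube power4_eq_xxxx flip: numeral_2_eq_2)
    then show "1 \<cdot> shift_lc 0 0 (relation T1 T0) \<in> Nsp"
      using Nsp.oper[OF 00 vE] by simp
  qed (use nonzero_sums in simp_all)
  have 02: "shift_lc 0 0 (relation T0 T2) \<in> Nsp"
  proof (rule Nsp_cancel)
    have "(qq + inverse qq) \<cdot> shift_lc 0 0 (relation T0 T2) = op2 (F 1) (shift_lc 0 0 (relation T0 T1))"
      unfolding op2_shift_lc_EF
      by (simp add: rel_simps op2b_simps) (simp add: field_simps power2_eq_square power3_eq_cube power4_eq_xxxx flip: numeral_2_eq_2)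
    then show "(qq + inverse qq) \<cdot> shift_lc 0 0 (relation T0 T2) \<in> Nsp"
      using Nsp.oper[OF 01 vF] by simp
  qed (use nonzero_sums in simp_all)
  have 20: "shift_lc 0 0 (relation T2 T0) \<in> Nsp"
  proof (rule Nsp_cancel)
    have "(qq + inverse qq) \<cdot> shift_lc 0 0 (relation T2 T0) = op2 (E 0) (shift_lc 0 0 (relation T1 T0))"
      unfolding op2_shift_lc_EF
      by (simp add: rel_simps op2b_simps) (simp add: field_simps power2_eq_square power3_eq_cube power4_eq_xxxx flip: numeral_2_eq_2)
    then show "(qq + inverse qq) \<cdot> shift_lc 0 0 (relation T2 T0) \<in> Nsp"
      using Nsp.oper[OF 10 vE] by simp
  qed (use nonzero_sums in simp_all)
  have 11: "shift_lc 0 0 (relation T1 T1) \<in> Nsp"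
  proof (rule Nsp_cancel)
    have "1 \<cdot> shift_lc 0 0 (relation T1 T1) = op2 (E 0) (shift_lc 0 0 (relation T0 T1))"
      unfolding op2_shift_lc_EF
      by (simp add: rel_simps op2b_simps) (simp add: field_simps power2_eq_square power3_eq_cube power4_eq_xxxx flip: numeral_2_eq_2)
    then show "1 \<cdot> shift_lc 0 0 (relation T1 T1) \<in> Nsp"
      using Nsp.oper[OF 01 vE] by simp
  qed (use nonzero_sums in simp_all)
  have 12: "shift_lc 0 0 (relation T1 T2) \<in> Nsp"
  proof (rule Nsp_cancel)
    have "(1 + qq^2 + inverse (qq^2)) \<cdot> shift_lc 0 0 (relation T1 T2) = op2 (F 1) (shift_lc 0 0 (relation T0 T2))"
      unfolding op2_shift_lc_EF
      by (simp add: rel_simps op2b_simps) (simp add: field_simps power2_eq_square power3_eq_cube power4_eq_xxxx flip: numeral_2_eq_2)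
    then show "(1 + qq^2 + inverse (qq^2)) \<cdot> shift_lc 0 0 (relation T1 T2) \<in> Nsp"
      using Nsp.oper[OF 02 vF] by simp
  qed (use nonzero_sums in simp_all)
  \<comment> \<open>e_0 turns the relation for (2, 0) into z \<otimes> z times the one for (2, 1);
    \<open>ZZinv\<close> removes this factor afterwards.\<close>
  have s21: "shift_lc 1 1 (relation T2 T1) \<in> Nsp"
  proof (rule Nsp_cancel)
    have "(1 + qq^2 + inverse (qq^2)) \<cdot> shift_lc 1 1 (relation T2 T1) = op2 (E 0) (shift_lc 0 0 (relation T2 T0))"
      unfolding op2_shift_lc_EF
      by (simp add: rel_simps op2b_simps) (simp add: field_simps power2_eq_square power3_eq_cube power4_eq_xxxx flip: numeral_2_eq_2)
    then show "(1 + qq^2 + inverse (qq^2)) \<cdot> shift_lc 1 1 (relation T2 T1) \<in> Nsp"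
      using Nsp.oper[OF 20 vE] by simp
  qed (use nonzero_sums in simp_all)
  have 21: "shift_lc 0 0 (relation T2 T1) \<in> Nsp"
    using Nsp.oper[OF s21 vZ] by (simp add: op2_shift_lc)
  have 22: "shift_lc 0 0 (relation T2 T2) \<in> Nsp"
  proof (rule Nsp_cancel)
    have "((qq + inverse qq) * (qq^2 + inverse (qq^2))) \<cdot> shift_lc 0 0 (relation T2 T2) = op2 (F 1) (shift_lc 0 0 (relation T1 T2))"
      unfolding op2_shift_lc_EF
      by (simp add: rel_simps op2b_simps) (simp add: field_simps power2_eq_square power3_eq_cube power4_eq_xxxx flip: numeral_2_eq_2)
    then show "((qq + inverse qq) * (qq^2 + inverse (qq^2))) \<cdot> shift_lc 0 0 (relation T2 T2) \<in> Nsp"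
      using Nsp.oper[OF 12 vF] by simp
  qed (use nonzero_sums in simp_all)
  show ?thesis
    using 00 01 02 10 11 12 20 21 22 by (cases i; cases j) simp_all
qed

text \<open>Read off from the table. Nonnegative exponents keep the powers of z bounded below; the
  last inequality is the decrease of the left letter.\<close>

lemma reltail_props:
  assumes "(c, (p, k), (r, l)) \<in> set (reltail i j)"
  shows "c \<in> Areg" "0 \<le> p" "0 \<le> r" "p + r = henergy (num i) (num j)" "num k + num l = num i + num j"
    "3 * p - int (num k) < 3 * henergy (num i) (num j) - int (num i)"
  using assms
  by (cases i; cases j; auto simp: reltail_def henergy_def intro!: Areg_closed)+

lemma henergy_nonneg: "0 \<le> henergy (num i) (num j)"
  by (cases i; cases j) (simp_all add: henergy_def)

text \<open>A lexicographic order in one integer: first the power of z, then the component, a larger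
  index counting as smaller. The factor 3 exceeds the range of components.\<close>

definition letter_measure :: "bas \<Rightarrow> int" where "letter_measure x = 3 * fst x - int (snd x)"

definition same_weight :: "bas list \<Rightarrow> bas list \<Rightarrow> bool" where
  "same_weight w v \<longleftrightarrow> length v = length w \<and> sum_list (map fst v) = sum_list (map fst w)
     \<and> sum_list (map snd v) = sum_list (map snd w)"

text \<open>With \<alpha> = a - h the energy is b - \<alpha>. If it is negative, the relation times
  z_1^\<alpha> z_2^b + z_1^b z_2^\<alpha> has x \<otimes> y and a partner of opposite energy as
  leading terms; if it is zero, z_1^b z_2^b is used and there is no partner.\<close>

lemma straighten_pair:
  assumes "validB x" "validB y" "Hen x y \<le> 0"
  obtains ys where
    "(\<lambda>w. delta [x, y] w + (if Hen x y = 0 then 0 else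
        delta [(fst y + henergy (snd x) (snd y), snd x), (fst x - henergy (snd x) (snd y), snd y)] w)
        + qq * lc ys w) \<in> Nsp"
    "\<And>c v. (c, v) \<in> set ys \<Longrightarrow> c \<in> Areg \<and> (\<exists>x' y'. v = [x', y'] \<and> validB x' \<and> validB y' \<and>
        same_weight [x, y] [x', y'] \<and> min (fst x) (fst y) \<le> min (fst x') (fst y') \<and> letter_measure x' < letter_measure x)"
proof -
  obtain a i where x: "x = (a, num i)" using assms(1) ex_num by (metis prod.collapse validB_def)
  obtain b j where y: "y = (b, num j)" using assms(2) ex_num by (metis prod.collapse validB_def)
  define h where "h = henergy (num i) (num j)"
  define \<alpha> where "\<alpha> = a - h"
  have h: "0 \<le> h" unfolding h_def by (rule henergy_nonneg)
  have H: "Hen x y = b - \<alpha>" by (simp add: Hen_def x y \<alpha>_def h_def henergy_def)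
  define tw where "tw = (\<lambda>s t. map (\<lambda>(c, (p, k), (r, l)). (c, [(s + p, num k), (t + r, num l)])) (reltail i j))"
  have rel: "shift_lc s t (relation i j) = delta [(s + h, num i), (t, num j)] + (\<lambda>w. qq * lc (tw s t) w)" for s t
  proof -
    have "shift_lc s t (map (\<lambda>(c, p, r). (qq * c, p, r)) ts) = (\<lambda>w. qq * shift_lc s t ts w)" for ts
      by (induction ts) (auto simp: shift_lc_Cons fun_eq_iff algebra_simps)
    then show ?thesis
      unfolding relation_def shift_lc_Cons h_def tw_def by (simp add: shift_lc_def fun_eq_iff)
  qed
  have props: "c \<in> Areg \<and> (\<exists>x' y'. v = [x', y'] \<and> validB x' \<and> validB y' \<and>
        same_weight [x, y] [x', y'] \<and> min (fst x) (fst y) \<le> min (fst x') (fst y') \<and> letter_measure x' < letter_measure x)"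
    if cv: "(c, v) \<in> set (tw s t)" and st: "s + t = \<alpha> + b" "b \<le> s" "b \<le> t" "s \<le> \<alpha>" for c v s t
  proof -
    obtain p k r l where e: "(c, (p, k), (r, l)) \<in> set (reltail i j)" "v = [(s + p, num k), (t + r, num l)]"
      using cv by (auto simp: tw_def)
    note P = reltail_props[OF e(1), folded h_def]
    have "b \<le> a" using st h \<alpha>_def by simp
    moreover have "same_weight [x, y] v"
      using P st by (simp add: same_weight_def e x y \<alpha>_def)
    moreover have "letter_measure (s + p, num k) < letter_measure x"
      using P st by (simp add: letter_measure_def x \<alpha>_def)
    ultimately show ?thesis
      using P st unfolding e x y by (intro conjI exI[of _ "(s + p, num k)"] exI[of _ "(t + r, num l)"]) auto
  qed
  show ?thesis
  proof (cases "Hen x y = 0")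
    case True
    then have eq: "\<alpha> = b" using H by simp
    have "shift_lc \<alpha> \<alpha> (relation i j) \<in> Nsp" by (rule shift_diag_Nsp[OF relation_Nsp])
    then have "(\<lambda>w. delta [x, y] w + 0 + qq * lc (tw \<alpha> \<alpha>) w) \<in> Nsp"
      unfolding rel by (simp add: x y eq[symmetric] plus_fun_def) (simp add: \<alpha>_def)
    then show ?thesis
      using True props[of _ _ \<alpha> \<alpha>] eq by (intro that[of "tw \<alpha> \<alpha>"]) auto
  next
    case False
    then have lt: "b < \<alpha>" using H assms(3) by simp
    have "shift_lc \<alpha> b (relation i j) + shift_lc b \<alpha> (relation i j) \<in> Nsp"
      by (rule shift_sym_Nsp[OF relation_Nsp])
    moreover have "lc (tw \<alpha> b @ tw b \<alpha>) w = lc (tw \<alpha> b) w + lc (tw b \<alpha>) w" for w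
      by (simp add: lc_def)
    ultimately have "(\<lambda>w. delta [x, y] w + delta [(b + h, num i), (a - h, num j)] w + qq * lc (tw \<alpha> b @ tw b \<alpha>) w) \<in> Nsp"
      unfolding rel by (simp add: x y plus_fun_def \<alpha>_def algebra_simps)
    then show ?thesis
      using False props[of _ _ \<alpha> b] props[of _ _ b \<alpha>] lt
      by (intro that[of "tw \<alpha> b @ tw b \<alpha>"]) (auto simp: x y h_def)
  qed
qed

text \<open>Straightening lowers the prefix sums of \<open>letter_measure\<close> and does not lower the minimal
  power of z, so it terminates.\<close>

fun word_measure :: "int \<Rightarrow> bas list \<Rightarrow> nat" where
  "word_measure M [] = 0"
| "word_measure M (x # w) = Suc (length w) * nat (letter_measure x + 2 - 3 * M) + word_measure M w"

lemma word_measure_append_less: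
  "length t' = length t \<Longrightarrow> word_measure M t' < word_measure M t \<Longrightarrow> word_measure M (p @ t') < word_measure M (p @ t)"
  by (induction p) auto

lemma letter_measure_nonneg: "validB x \<Longrightarrow> M \<le> fst x \<Longrightarrow> 0 \<le> letter_measure x + 2 - 3 * M"
  by (auto simp: letter_measure_def validB_def)

text \<open>A letter counts with its distance from the end. The pair keeps its total
  \<open>letter_measure\<close>, so the decrease of the left letter outweighs the increase of the
  right one.\<close>

lemma word_measure_straighten:
  assumes "same_weight [x, y] [x', y']" "letter_measure x' < letter_measure x"
    and "validB x" "validB y" "validB x'" "validB y'"
    and "M \<le> fst x" "M \<le> fst y" "M \<le> fst x'" "M \<le> fst y'"
  shows "word_measure M (p @ x' # y' # s) < word_measure M (p @ x # y # s)"
proof (rule word_measure_append_less)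
  have e: "letter_measure x' + letter_measure y' = letter_measure x + letter_measure y"
    using assms(1) by (auto simp: same_weight_def letter_measure_def)
  define n where "n v = nat (letter_measure v + 2 - 3 * M)" for v
  have n: "int (n v) = letter_measure v + 2 - 3 * M" if "validB v" "M \<le> fst v" for v
    using letter_measure_nonneg[OF that] by (simp add: n_def)
  have 1: "n x' + n y' = n x + n y" and 2: "n x' < n x"
    using e assms(2) n[OF assms(3,7)] n[OF assms(4,8)] n[OF assms(5,9)] n[OF assms(6,10)] by linarith+
  have "Suc (length s) * n x' + Suc (length s) * n y' = Suc (length s) * n x + Suc (length s) * n y"
    using 1 by (metis distrib_left)
  moreover have "word_measure M (x' # y' # s) = n x' + Suc (length s) * n x' + Suc (length s) * n y' + word_measure M s"
    by (simp add: n_def)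
  moreover have "word_measure M (x # y # s) = n x + Suc (length s) * n x + Suc (length s) * n y + word_measure M s"
    by (simp add: n_def)
  ultimately show "word_measure M (x' # y' # s) < word_measure M (x # y # s)"
    using 2 by linarith
qed simp

section \<open>Straightening inside longer words\<close>

lemma embedN_add: "embedN p (\<lambda>w. u w + v w) s = (\<lambda>w. embedN p u s w + embedN p v s w)"
  by (auto simp: embedN_def fun_eq_iff)

lemma embedN_scale: "embedN p (\<lambda>w. c * u w) s = (\<lambda>w. c * embedN p u s w)"
  by (auto simp: embedN_def fun_eq_iff)

lemma embedN_zero: "embedN p (\<lambda>w. 0) s = (\<lambda>w. 0)"
  by (auto simp: embedN_def fun_eq_iff)

lemma embedN_delta:
  assumes "length v = 2" shows "embedN p (delta v) s = delta (p @ v @ s)"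
proof
  fix w
  have "(length w = length p + 2 + length s \<and> take (length p) w = p \<and> drop (length p + 2) w = s \<and> take 2 (drop (length p) w) = v)
    \<longleftrightarrow> w = p @ v @ s"
  proof
    assume *: "length w = length p + 2 + length s \<and> take (length p) w = p \<and> drop (length p + 2) w = s \<and> take 2 (drop (length p) w) = v"
    have "w = take (length p) w @ take 2 (drop (length p) w) @ drop (length p + 2) w"
      by (metis append_take_drop_id drop_drop add.commute)
    then show "w = p @ v @ s" using * by simp
  qed (use assms in auto)
  then show "embedN p (delta v) s w = delta (p @ v @ s) w"
    unfolding embedN_def delta_def by auto
qed

lemma embedN_lc:
  "(\<And>c v. (c, v) \<in> set ys \<Longrightarrow> length v = 2) \<Longrightarrow>
    embedN p (lc ys) s = lc (map (\<lambda>(c, v). (c, p @ v @ s)) ys)"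
proof (induction ys)
  case (Cons y ys)
  obtain c v where y: "y = (c, v)" by (cases y)
  then have "length v = 2" using Cons.prems by auto
  moreover have "embedN p (lc ys) s = lc (map (\<lambda>(c, v). (c, p @ v @ s)) ys)"
    by (rule Cons.IH) (use Cons.prems in auto)
  ultimately show ?case
    by (simp add: y lc_Cons embedN_add embedN_scale embedN_delta)
qed (simp add: embedN_zero)

lemma lc_append: "lc (xs @ ys) = (\<lambda>w. lc xs w + lc ys w)"
  by (simp add: lc_def)

lemma lc_scale: "lc (map (\<lambda>(c, v). (d * c, v)) xs) = (\<lambda>w. d * lc xs w)"
  by (induction xs) (auto simp: lc_Cons fun_eq_iff algebra_simps)

abbreviation normal :: "bas list \<Rightarrow> bool" where
  "normal \<equiv> successively (\<lambda>x y. 0 < Hen x y)"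

text \<open>Regular coefficients keep the result in the lattice, and the weight is recorded for
  \<open>violation_persists\<close>.\<close>

definition straightens :: "bas list \<Rightarrow> (K \<times> bas list) list \<Rightarrow> bool" where
  "straightens w xs \<longleftrightarrow> (\<forall>(c, v)\<in>set xs. c \<in> Areg \<and> normal v \<and> (\<forall>x\<in>set v. validB x) \<and> same_weight w v)"

lemma same_weight_trans: "same_weight u v \<Longrightarrow> same_weight v w \<Longrightarrow> same_weight u w"
  by (simp add: same_weight_def)

lemma straighten_combination:
  assumes "\<And>c v. (c, v) \<in> set ys \<Longrightarrow> c \<in> Areg \<and> same_weight w v \<and>
     (\<exists>xs. straightens v xs \<and> (\<lambda>u. delta v u - lc xs u) \<in> Nn n)"
  shows "\<exists>xs. straightens w xs \<and> (\<lambda>u. lc ys u - lc xs u) \<in> Nn n"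
  using assms
proof (induction ys)
  case Nil
  show ?case by (intro exI[of _ "[]"]) (simp add: straightens_def Nn.zero)
next
  case (Cons y ys)
  obtain c v where y: "y = (c, v)" by (cases y)
  obtain xs where xs: "straightens w xs" "(\<lambda>u. lc ys u - lc xs u) \<in> Nn n"
    using Cons.IH[OF Cons.prems] by auto
  obtain zs where zs: "straightens v zs" "(\<lambda>u. delta v u - lc zs u) \<in> Nn n"
    and c: "c \<in> Areg" and wv: "same_weight w v"
    using Cons.prems[of c v] y by auto
  let ?xs = "map (\<lambda>(d, v). (c * d, v)) zs @ xs"
  have "straightens w ?xs"
    using xs(1) zs(1) c same_weight_trans[OF wv] by (fastforce simp: straightens_def)
  moreover have "(\<lambda>u. lc (y # ys) u - lc ?xs u)
     = (\<lambda>u. c * (delta v u - lc zs u) + (lc ys u - lc xs u))"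
    by (simp add: y lc_Cons lc_append lc_scale fun_eq_iff) (simp add: algebra_simps)
  moreover have "(\<lambda>u. c * (delta v u - lc zs u) + (lc ys u - lc xs u)) \<in> Nn n"
    by (intro Nn.add Nn.smult zs xs)
  ultimately show ?case by (intro exI[of _ ?xs]) simp
qed

lemma not_successivelyD:
  "\<not> successively P w \<Longrightarrow> \<exists>p x y s. w = p @ x # y # s \<and> \<not> P x y"
proof (induction P w rule: successively.induct)
  case (3 P x y w)
  show ?case
  proof (cases "P x y")
    case True
    then obtain p a b s where "y # w = p @ a # b # s \<and> \<not> P a b" using 3 by auto
    then have "x # y # w = (x # p) @ a # b # s \<and> \<not> P a b" by simp
    then show ?thesis by blast
  next
    case False
    then show ?thesis by (intro exI[of _ "[]"]) auto
  qed
qed simp_all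

theorem straighten_word:
  assumes "\<forall>x\<in>set w. validB x"
  shows "\<exists>xs. straightens w xs \<and> (\<lambda>u. delta w u - lc xs u) \<in> Nn (length w)"
proof -
  \<comment> \<open>A lower bound for the powers of z that persists through straightening, so the
    truncation by \<open>nat\<close> in \<open>word_measure\<close> never takes effect.\<close>
  define M where "M = Min (insert 0 (fst ` set w))"
  have "\<forall>x\<in>set w. M \<le> fst x" by (simp add: M_def)
  with assms show ?thesis
  proof (induction "word_measure M w" arbitrary: w rule: less_induct)
    case less
    show ?case
    proof (cases "normal w")
      case True
      then show ?thesis
        using less.prems
        by (intro exI[of _ "[(1, w)]"]) (simp add: straightens_def same_weight_def lc_Cons Nn.zero Areg_1)
    next
      case False
      then obtain p x y s where w: "w = p @ x # y # s" "Hen x y \<le> 0"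
        using not_successivelyD[of _ w] by (metis linorder_not_le)
      have v: "validB x" "validB y" "M \<le> fst x" "M \<le> fst y" using less.prems w by auto
      obtain ys where ys: "(\<lambda>w. delta [x, y] w + (if Hen x y = 0 then 0 else
          delta [(fst y + henergy (snd x) (snd y), snd x), (fst x - henergy (snd x) (snd y), snd y)] w)
          + qq * lc ys w) \<in> Nsp"
        "\<And>c v. (c, v) \<in> set ys \<Longrightarrow> c \<in> Areg \<and> (\<exists>x' y'. v = [x', y'] \<and> validB x' \<and> validB y' \<and>
          same_weight [x, y] [x', y'] \<and> min (fst x) (fst y) \<le> min (fst x') (fst y') \<and> letter_measure x' < letter_measure x)"
        using straighten_pair[OF v(1,2) w(2)] by blast
      define x1 where "x1 = (fst y + henergy (snd x) (snd y), snd x)"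
      define y1 where "y1 = (fst x - henergy (snd x) (snd y), snd y)"
      define zs where "zs = (if Hen x y = 0 then [] else [(-1, [x1, y1])]) @ map (\<lambda>(c, v). (- qq * c, v)) ys"
      have lz: "lc zs u = (if Hen x y = 0 then 0 else - delta [x1, y1] u) - qq * lc ys u" for u
        unfolding zs_def lc_append lc_scale by (simp add: lc_Cons)
      have "(\<lambda>u. delta [x, y] u - lc zs u) \<in> Nsp"
        using ys(1) by (cases "Hen x y = 0") (simp_all add: lz x1_def y1_def algebra_simps)
      moreover have zs: "c \<in> Areg \<and> (\<exists>x' y'. v = [x', y'] \<and> validB x' \<and> validB y' \<and>
          same_weight [x, y] [x', y'] \<and> M \<le> fst x' \<and> M \<le> fst y' \<and> letter_measure x' < letter_measure x)"
        if cv: "(c, v) \<in> set zs" for c v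
      proof -
        consider "Hen x y \<noteq> 0" "c = -1" "v = [x1, y1]" | d where "(d, v) \<in> set ys" "c = - qq * d"
          using cv by (auto simp: zs_def split: if_splits)
        then show ?thesis
        proof cases
          case 1
          have "henergy (snd x) (snd y) \<ge> 0" using v by (auto simp: henergy_def validB_def)
          moreover have "Hen x y = henergy (snd x) (snd y) - fst x + fst y"
            by (simp add: Hen_def henergy_def)
          ultimately show ?thesis
            using 1 v w(2) by (auto simp: x1_def y1_def validB_def same_weight_def letter_measure_def
                intro!: Areg_uminus Areg_1)
        next
          case 2
          then show ?thesis using ys(2)[of d v] v by (fastforce intro!: Areg_mult Areg_uminus Areg_qq)
        qed
      qed
      moreover have len2: "(c, v) \<in> set zs \<Longrightarrow> length v = 2" for c v using zs by fastforce
      ultimately have "embedN p (\<lambda>u. delta [x, y] u + (- 1) * lc zs u) s \<in> Nn (length w)"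
        using less.prems w(1) by (intro Nn.emb) auto
      then have N: "(\<lambda>u. delta w u - lc (map (\<lambda>(c, v). (c, p @ v @ s)) zs) u) \<in> Nn (length w)"
        unfolding embedN_add embedN_scale by (simp add: embedN_delta embedN_lc len2 w(1))
      have "\<exists>xs. straightens w xs \<and> (\<lambda>u. lc (map (\<lambda>(c, v). (c, p @ v @ s)) zs) u - lc xs u) \<in> Nn (length w)"
      proof (rule straighten_combination)
        fix c v assume "(c, v) \<in> set (map (\<lambda>(c, v). (c, p @ v @ s)) zs)"
        then obtain v' where v': "v = p @ v' @ s" "(c, v') \<in> set zs" by auto
        obtain x' y' where xy: "v' = [x', y']" "validB x'" "validB y'" "same_weight [x, y] [x', y']"
          "M \<le> fst x'" "M \<le> fst y'" "letter_measure x' < letter_measure x" and c: "c \<in> Areg"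
          using zs[OF v'(2)] by blast
        have wv: "same_weight w v" using xy(4) by (auto simp: same_weight_def v' xy(1) w(1))
        have "\<exists>xs. straightens v xs \<and> (\<lambda>u. delta v u - lc xs u) \<in> Nn (length v)"
        proof (rule less.hyps)
          show "word_measure M v < word_measure M w"
            unfolding v' xy(1) w(1) using word_measure_straighten xy v by simp
          show "\<forall>x\<in>set v. validB x" "\<forall>x\<in>set v. M \<le> fst x"
            using less.prems xy unfolding v' xy(1) w(1) by auto
        qed
        then show "c \<in> Areg \<and> same_weight w v \<and> (\<exists>xs. straightens v xs \<and> (\<lambda>u. delta v u - lc xs u) \<in> Nn (length w))"
          using c wv by (simp add: same_weight_def)
      qed
      then obtain xs where xs: "straightens w xs"
        "(\<lambda>u. lc (map (\<lambda>(c, v). (c, p @ v @ s)) zs) u - lc xs u) \<in> Nn (length w)" by blast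
      have "(\<lambda>u. delta w u - lc xs u) \<in> Nn (length w)"
        using Nn.add[OF N xs(2)] by simp
      then show ?thesis using xs(1) by blast
    qed
  qed
qed

section \<open>The Fock space\<close>

definition vac :: "GS \<Rightarrow> int \<Rightarrow> nat \<Rightarrow> nat \<Rightarrow> bas list" where
  "vac gs m r R = map (\<lambda>k. bgs gs (m + int k)) [r..<R]"

lemma length_vac [simp]: "length (vac gs m r R) = R - r"
  by (simp add: vac_def)

lemma vac_same [simp]: "vac gs m r r = []"
  by (simp add: vac_def)

lemma vac_append: "r \<le> s \<Longrightarrow> s \<le> R \<Longrightarrow> vac gs m r s @ vac gs m s R = vac gs m r R"
  unfolding vac_def map_append[symmetric] using upt_add_eq_append[of r s "R - s"] by simp

lemma validB_bgs: "validB (bgs gs k)"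
  by (simp add: validB_def bgs_def split: GS.splits)

lemma validB_vac: "x \<in> set (vac gs m r R) \<Longrightarrow> validB x"
  by (auto simp: vac_def validB_bgs)

lemma ext_eq: "ext gs m r R u w = (if length w = R \<and> drop r w = vac gs m r R then u (take r w) else 0)"
  by (simp add: ext_def vac_def)

lemma ext_ext:
  assumes "r \<le> s" "s \<le> R"
  shows "ext gs m s R (ext gs m r s u) = ext gs m r R u"
proof
  fix w :: "bas list"
  have "drop r w = drop r (take s w) @ drop s w" if "length w = R"
  proof -
    have "drop r w = drop r (take s w @ drop s w)" by simp
    also have "\<dots> = drop r (take s w) @ drop s w"
      using assms that by (subst drop_append) simp
    finally show ?thesis .
  qed
  then have "drop r w = vac gs m r R \<longleftrightarrow> drop r (take s w) = vac gs m r s \<and> drop s w = vac gs m s R"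
    if "length w = R"
    using that assms by (simp add: vac_append[OF assms, symmetric])
  then show "ext gs m s R (ext gs m r s u) w = ext gs m r R u w"
    using assms by (auto simp: ext_eq)
qed

lemma ext_add: "ext gs m r R (\<lambda>w. u w + v w) = (\<lambda>w. ext gs m r R u w + ext gs m r R v w)"
  and ext_diff: "ext gs m r R (\<lambda>w. u w - v w) = (\<lambda>w. ext gs m r R u w - ext gs m r R v w)"
  and ext_scale: "ext gs m r R (\<lambda>w. c * u w) = (\<lambda>w. c * ext gs m r R u w)"
  and ext_zero: "ext gs m r R (\<lambda>w. 0) = (\<lambda>w. 0)"
  by (auto simp: ext_eq fun_eq_iff)

lemma ext_sum: "ext gs m r R (\<lambda>w. \<Sum>i\<in>S. f i w) = (\<lambda>w. \<Sum>i\<in>S. ext gs m r R (f i) w)"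
  by (auto simp: ext_eq fun_eq_iff)

lemma ext_delta:
  assumes "length v = r" "r \<le> R"
  shows "ext gs m r R (delta v) = delta (v @ vac gs m r R)"
proof
  fix w
  have "(length w = R \<and> drop r w = vac gs m r R \<and> take r w = v) \<longleftrightarrow> w = v @ vac gs m r R"
    using assms by (metis append_eq_conv_conj append_take_drop_id length_append length_vac le_add_diff_inverse)
  then show "ext gs m r R (delta v) w = delta (v @ vac gs m r R) w"
    by (auto simp: ext_eq delta_def)
qed

lemma ext_embedN:
  assumes "length p + 2 + length s = r" "r \<le> R"
  shows "ext gs m r R (embedN p u s) = embedN p u (s @ vac gs m r R)"
proof
  fix w
  have "drop (length p + 2) w = s @ vac gs m r R \<longleftrightarrow> drop r w = vac gs m r R \<and> drop (length p + 2) (take r w) = s"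
    if "length w = R"
  proof -
    have "drop (length p + 2) w = drop (length p + 2) (take r w @ drop r w)" by simp
    also have "\<dots> = drop (length p + 2) (take r w) @ drop r w"
      using assms that by (subst drop_append) simp
    finally show ?thesis using assms that by (auto simp: append_eq_append_conv)
  qed
  moreover have "take (length p) (take r w) = take (length p) w" using assms by (simp add: min_def)
  moreover have "take 2 (drop (length p) (take r w)) = take 2 (drop (length p) w)"
    using assms by (simp add: drop_take min_def)
  moreover have "length p + 2 + length (s @ vac gs m r R) = R" using assms by simp
  moreover have "length w = R \<Longrightarrow> length (take r w) = length p + 2 + length s" using assms by simp
  ultimately show "ext gs m r R (embedN p u s) w = embedN p u (s @ vac gs m r R) w"
    unfolding ext_eq embedN_def by (cases "length w = R") (simp_all del: length_take)
qed

lemma ext_Nn: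
  assumes "r \<le> R" shows "u \<in> Nn r \<Longrightarrow> ext gs m r R u \<in> Nn R"
proof (induction rule: Nn.induct)
  case (emb u p s)
  then show ?case
    using assms validB_vac by (subst ext_embedN) (auto intro!: Nn.emb)
qed (simp_all add: ext_zero ext_add ext_scale Nn.intros)

lemma istens_ext:
  assumes "istens r u" "r \<le> R" shows "istens R (ext gs m r R u)"
proof -
  have eq: "w = take r w @ vac gs m r R \<and> u (take r w) \<noteq> 0" if "ext gs m r R u w \<noteq> 0" for w
    using that by (metis append_take_drop_id ext_eq)
  then have "supp (ext gs m r R u) \<subseteq> (\<lambda>v. v @ vac gs m r R) ` supp u"
    unfolding supp_def by (intro subsetI) (simp only: mem_Collect_eq image_iff Bex_def, blast)
  then have "finite (supp (ext gs m r R u))"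
    using assms(1) unfolding istens_def by (meson finite_imageI finite_subset)
  moreover have "length w = R \<and> (\<forall>x\<in>set w. validB x)" if "ext gs m r R u w \<noteq> 0" for w
  proof -
    have "\<forall>x\<in>set (take r w). validB x"
      using eq[OF that] assms(1) unfolding istens_def by blast
    moreover have "set w = set (take r w) \<union> set (vac gs m r R)"
      using eq[OF that] by (metis set_append)
    ultimately have "\<forall>x\<in>set w. validB x" using validB_vac by blast
    then show ?thesis using that by (auto simp: ext_eq split: if_splits)
  qed
  ultimately show ?thesis by (simp add: istens_def)
qed

lemma Ltens_ext: "u \<in> Ltens r \<Longrightarrow> r \<le> R \<Longrightarrow> ext gs m r R u \<in> Ltens R"
  using istens_ext[of r u R gs m] Areg_0 by (auto simp: Ltens_def ext_eq)

lemma ext_same: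
  assumes "\<And>w. u w \<noteq> 0 \<Longrightarrow> length w = r" shows "ext gs m r r u = u"
  using assms by (auto simp: ext_eq fun_eq_iff)

lemma Ltens_zero: "(\<lambda>w. 0) \<in> Ltens r"
  by (auto simp: Ltens_def istens_def supp_zero)

lemma Ltens_add: "u \<in> Ltens r \<Longrightarrow> v \<in> Ltens r \<Longrightarrow> (\<lambda>w. u w + v w) \<in> Ltens r"
  unfolding Ltens_def istens_def by (auto intro: finite_supp_add) (metis add_0)+

lemma Ltens_scale: "u \<in> Ltens r \<Longrightarrow> c \<in> Areg \<Longrightarrow> (\<lambda>w. c * u w) \<in> Ltens r"
  unfolding Ltens_def istens_def by (auto intro: finite_supp_scale)

lemma Ltens_delta: "length v = r \<Longrightarrow> \<forall>x\<in>set v. validB x \<Longrightarrow> delta v \<in> Ltens r"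
  unfolding Ltens_def istens_def using finite_supp_delta[of v]
  by (simp add: Areg_closed delta_def[of v] split: if_splits)

section \<open>Membership in q^n L\<close>

text \<open>The stages of the lattice elements and of the final vanishing can all be extended to a
  common one, where the lattice elements add up to a single tensor.\<close>

lemma inqL_iff:
  "inqL gs m k r u \<longleftrightarrow> (\<exists>R\<ge>r. \<exists>w\<in>Ltens R. (\<lambda>x. ext gs m r R u x - qq ^ k * w x) \<in> Nn R)"
proof
  assume "inqL gs m k r u"
  then obtain R ws R' where R: "r \<le> R" "\<forall>(s, w)\<in>set ws. s \<le> R \<and> w \<in> Ltens s" "R \<le> R'"
    and N: "ext gs m R R' (\<lambda>x. ext gs m r R u x - qq ^ k * (\<Sum>(s, w)\<leftarrow>ws. ext gs m s R w x)) \<in> Nn R'"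
    unfolding inqL_def zeroBar_def by blast
  define W where "W = (\<lambda>x. \<Sum>(s, w)\<leftarrow>ws. ext gs m s R w x)"
  have "W \<in> Ltens R" unfolding W_def using R(2)
    by (induction ws) (auto simp: Ltens_zero intro!: Ltens_add Ltens_ext)
  then have "ext gs m R R' W \<in> Ltens R'" using R by (intro Ltens_ext)
  moreover have "ext gs m R R' (\<lambda>x. ext gs m r R u x - qq ^ k * W x)
     = (\<lambda>x. ext gs m r R' u x - qq ^ k * ext gs m R R' W x)"
    unfolding ext_diff ext_scale using R by (simp add: ext_ext)
  ultimately show "\<exists>R\<ge>r. \<exists>w\<in>Ltens R. (\<lambda>x. ext gs m r R u x - qq ^ k * w x) \<in> Nn R"
    using N R unfolding W_def by (intro exI[of _ R'] conjI bexI[of _ "ext gs m R R' W"]) (simp_all add: W_def)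
next
  assume "\<exists>R\<ge>r. \<exists>w\<in>Ltens R. (\<lambda>x. ext gs m r R u x - qq ^ k * w x) \<in> Nn R"
  then obtain R w where R: "r \<le> R" "w \<in> Ltens R" and N: "(\<lambda>x. ext gs m r R u x - qq ^ k * w x) \<in> Nn R" by blast
  have "ext gs m R R w = w" using R(2) by (intro ext_same) (auto simp: Ltens_def istens_def)
  then have "ext gs m R R (\<lambda>x. ext gs m r R u x - qq ^ k * (\<Sum>(s, w)\<leftarrow>[(R, w)]. ext gs m s R w x)) \<in> Nn R"
    using ext_Nn[OF order_refl N] by simp
  then have "zeroBar gs m R (\<lambda>x. ext gs m r R u x - qq ^ k * (\<Sum>(s, w)\<leftarrow>[(R, w)]. ext gs m s R w x))"
    unfolding zeroBar_def by blast
  then show "inqL gs m k r u"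
    unfolding inqL_def using R by (intro exI[of _ R] conjI exI[of _ "[(R, w)]"]) simp_all
qed

lemma inqL_stage:
  assumes "r \<le> R" "w \<in> Ltens R" "(\<lambda>x. ext gs m r R u x - qq ^ k * w x) \<in> Nn R" "R \<le> R'"
  shows "\<exists>w\<in>Ltens R'. (\<lambda>x. ext gs m r R' u x - qq ^ k * w x) \<in> Nn R'"
proof (rule bexI[of _ "ext gs m R R' w"])
  have "ext gs m R R' (\<lambda>x. ext gs m r R u x - qq ^ k * w x) \<in> Nn R'"
    using assms ext_Nn by blast
  then show "(\<lambda>x. ext gs m r R' u x - qq ^ k * ext gs m R R' w x) \<in> Nn R'"
    unfolding ext_diff ext_scale using assms by (simp add: ext_ext)
qed (use assms Ltens_ext in blast)

lemma inqL_add: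
  assumes "inqL gs m k r u" "inqL gs m k r v" shows "inqL gs m k r (\<lambda>w. u w + v w)"
proof -
  obtain R w where 1: "r \<le> R" "w \<in> Ltens R" "(\<lambda>x. ext gs m r R u x - qq ^ k * w x) \<in> Nn R"
    using assms(1) unfolding inqL_iff by blast
  obtain R' w' where 2: "r \<le> R'" "w' \<in> Ltens R'" "(\<lambda>x. ext gs m r R' v x - qq ^ k * w' x) \<in> Nn R'"
    using assms(2) unfolding inqL_iff by blast
  define S where "S = max R R'"
  obtain a where a: "a \<in> Ltens S" "(\<lambda>x. ext gs m r S u x - qq ^ k * a x) \<in> Nn S"
    using inqL_stage[OF 1, of S] by (auto simp: S_def)
  obtain b where b: "b \<in> Ltens S" "(\<lambda>x. ext gs m r S v x - qq ^ k * b x) \<in> Nn S"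
    using inqL_stage[OF 2, of S] by (auto simp: S_def)
  have "(\<lambda>x. ext gs m r S (\<lambda>w. u w + v w) x - qq ^ k * (a x + b x)) \<in> Nn S"
    using Nn.add[OF a(2) b(2)] by (simp add: ext_add algebra_simps)
  then show ?thesis unfolding inqL_iff
    using Ltens_add[OF a(1) b(1)] 1(1) by (intro exI[of _ S]) (auto simp: S_def)
qed

lemma inqL_Nn: "u \<in> Nn r \<Longrightarrow> inqL gs m k r u"
  unfolding inqL_iff
  by (intro exI[of _ r] conjI bexI[of _ "\<lambda>w. 0"]) (simp_all add: ext_Nn Ltens_zero)

text \<open>A scalar with a pole of order at most n at q = 0 costs n powers of q.\<close>

lemma inqL_scale:
  assumes "inqL gs m (k + n) r u" "qq ^ n * c \<in> Areg" shows "inqL gs m k r (\<lambda>w. c * u w)"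
proof -
  obtain R w where 1: "r \<le> R" "w \<in> Ltens R" "(\<lambda>x. ext gs m r R u x - qq ^ (k + n) * w x) \<in> Nn R"
    using assms(1) unfolding inqL_iff by blast
  have "(\<lambda>x. c * (ext gs m r R u x - qq ^ (k + n) * w x)) \<in> Nn R"
    using 1(3) by (rule Nn.smult)
  then have "(\<lambda>x. ext gs m r R (\<lambda>w. c * u w) x - qq ^ k * (qq ^ n * c * w x)) \<in> Nn R"
    by (simp add: ext_scale algebra_simps power_add)
  then show ?thesis unfolding inqL_iff
    using 1(1) Ltens_scale[OF 1(2) assms(2)]
    by (intro exI[of _ R] conjI bexI[of _ "\<lambda>x. qq ^ n * c * w x"]) simp_all
qed

lemma inqL_scale_Areg: "inqL gs m k r u \<Longrightarrow> c \<in> Areg \<Longrightarrow> inqL gs m k r (\<lambda>w. c * u w)"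
  using inqL_scale[of gs m k 0 r u c] by simp

lemma inqL_qq:
  assumes "inqL gs m k r u" shows "inqL gs m (Suc k) r (\<lambda>w. qq * u w)"
proof -
  obtain R w where 1: "r \<le> R" "w \<in> Ltens R" "(\<lambda>x. ext gs m r R u x - qq ^ k * w x) \<in> Nn R"
    using assms unfolding inqL_iff by blast
  have "(\<lambda>x. ext gs m r R (\<lambda>w. qq * u w) x - qq ^ Suc k * w x) \<in> Nn R"
    using Nn.smult[OF 1(3), of qq] by (simp add: ext_scale algebra_simps)
  then show ?thesis unfolding inqL_iff
    using 1(1,2) by (intro exI[of _ R] conjI bexI[of _ w])
qed

lemma inqL_ext:
  assumes "inqL gs m k s (ext gs m r s u)" "r \<le> s" shows "inqL gs m k r u"
proof -
  obtain R w where 1: "s \<le> R" "w \<in> Ltens R" "(\<lambda>x. ext gs m s R (ext gs m r s u) x - qq ^ k * w x) \<in> Nn R"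
    using assms unfolding inqL_iff by blast
  then show ?thesis unfolding inqL_iff using assms(2)
    by (intro exI[of _ R] conjI bexI[of _ w]) (simp_all add: ext_ext)
qed

lemma inqL_0_Ltens: "u \<in> Ltens r \<Longrightarrow> inqL gs m 0 r u"
  unfolding inqL_iff
  by (intro exI[of _ r] conjI bexI[of _ u])
    (auto simp: ext_same Ltens_def istens_def Nn.zero)

text \<open>Prepending a letter makes the wedge start one position earlier, hence the passage from m
  + 1 to m in \<open>inqL_lmul\<close>.\<close>

definition lmul :: "bas \<Rightarrow> tens \<Rightarrow> tens" where
  "lmul x u = (\<lambda>w. case w of [] \<Rightarrow> 0 | y # w' \<Rightarrow> if y = x then u w' else 0)"

lemma lmul_delta [simp]: "lmul x (delta w) = delta (x # w)"
  by (auto simp: lmul_def delta_def fun_eq_iff split: list.splits)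

lemma lmul_linear: "lmul x (\<lambda>w. u w + v w) = (\<lambda>w. lmul x u w + lmul x v w)"
  "lmul x (\<lambda>w. u w - v w) = (\<lambda>w. lmul x u w - lmul x v w)"
  "lmul x (\<lambda>w. c * u w) = (\<lambda>w. c * lmul x u w)" "lmul x (\<lambda>w. 0) = (\<lambda>w. 0)"
  by (auto simp: lmul_def fun_eq_iff split: list.splits)

lemma lmul_Nn:
  assumes "validB x" shows "u \<in> Nn n \<Longrightarrow> lmul x u \<in> Nn (Suc n)"
proof (induction rule: Nn.induct)
  case (emb u p s)
  have "lmul x (embedN p u s) = embedN (x # p) u s"
    by (auto simp: lmul_def embedN_def fun_eq_iff split: list.splits)
  then show ?case using emb assms by (simp add: Nn.emb)
qed (simp_all add: lmul_linear Nn.intros)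

lemma lmul_Ltens:
  assumes "validB x" "u \<in> Ltens n" shows "lmul x u \<in> Ltens (Suc n)"
proof -
  have "supp (lmul x u) \<subseteq> (#) x ` supp u"
  proof
    fix w assume "w \<in> supp (lmul x u)"
    then show "w \<in> (#) x ` supp u" by (cases w) (auto simp: supp_def lmul_def split: if_splits)
  qed
  moreover have "finite (supp u)" using assms(2) by (simp add: Ltens_def istens_def)
  ultimately have "finite (supp (lmul x u))" using finite_subset by blast
  then show ?thesis
    using assms Areg_0 unfolding Ltens_def istens_def
    by (auto simp: lmul_def split: list.splits if_splits)
qed

lemma ext_lmul: "ext gs m (Suc r) (Suc R) (lmul x u) = lmul x (ext gs (m + 1) r R u)"
proof -
  have "vac gs m (Suc r) (Suc R) = vac gs (m + 1) r R"
    unfolding vac_def by (simp add: map_Suc_upt[symmetric] del: map_Suc_upt upt_Suc) (simp add: comp_def add_ac)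
  then show ?thesis
    by (auto simp: ext_eq lmul_def fun_eq_iff split: list.splits)
qed

lemma inqL_lmul:
  assumes "inqL gs (m + 1) k r u" "validB x" shows "inqL gs m k (Suc r) (lmul x u)"
proof -
  obtain R w where 1: "r \<le> R" "w \<in> Ltens R" "(\<lambda>y. ext gs (m + 1) r R u y - qq ^ k * w y) \<in> Nn R"
    using assms unfolding inqL_iff by blast
  have "(\<lambda>y. ext gs m (Suc r) (Suc R) (lmul x u) y - qq ^ k * lmul x w y) \<in> Nn (Suc R)"
    using lmul_Nn[OF assms(2) 1(3)] by (simp add: lmul_linear ext_lmul)
  then show ?thesis unfolding inqL_iff
    using lmul_Ltens[OF assms(2) 1(2)] 1(1) by (intro exI[of _ "Suc R"]) auto
qed

lemma inqL_lc:
  "(\<And>c v. (c, v) \<in> set xs \<Longrightarrow> c \<in> Areg \<and> inqL gs m k r (delta v)) \<Longrightarrow> inqL gs m k r (lc xs)"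
proof (induction xs)
  case Nil
  then show ?case by (simp add: inqL_Nn Nn.zero)
next
  case (Cons y xs)
  obtain c v where y: "y = (c, v)" by (cases y)
  have "inqL gs m k r (lc xs)" by (rule Cons.IH) (use Cons.prems in auto)
  moreover have "inqL gs m k r (\<lambda>w. c * delta v w)"
    by (rule inqL_scale_Areg) (use Cons.prems[of c v] y in auto)
  ultimately show ?case unfolding y lc_Cons by (intro inqL_add)
qed

text \<open>The energy of a normally ordered pair followed by the vacuum is smaller than that of a
  letter violating the normal ordering with the vacuum.\<close>

lemma violation_persists:
  assumes "validB c" "Hen c (bgs gs m) \<le> 0" "same_weight [c, bgs gs m] v" "normal v" "\<forall>x\<in>set v. validB x"
  obtains c1 c2 where "v = [c1, c2]" "validB c1" "validB c2" "Hen c2 (bgs gs (m + 1)) \<le> 0"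
proof -
  obtain c1 c2 where v: "v = [c1, c2]"
    using assms(3) by (auto simp: same_weight_def length_Suc_conv numeral_2_eq_2)
  obtain a i where c: "c = (a, i)" by (cases c)
  obtain a1 i1 where c1: "c1 = (a1, i1)" by (cases c1)
  obtain a2 i2 where c2: "c2 = (a2, i2)" by (cases c2)
  have "Hen c2 (bgs gs (m + 1)) \<le> 0"
  proof (rule ccontr)
    assume "\<not> ?thesis"
    then show False
      using assms unfolding v c c1 c2
      by (cases gs; cases "even m") (auto simp: same_weight_def Hen_def bgs_def validB_def min_def split: if_splits)
  qed
  then show ?thesis using that v assms(5) by auto
qed

lemma Nsp_Nn2: "u \<in> Nsp \<Longrightarrow> u \<in> Nn 2"
proof -
  assume u: "u \<in> Nsp"
  have len: "u w = 0" if "length w \<noteq> 2" for w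
    using supp_Nsp[OF u] that by (auto simp: words2_def supp_def)
  have "embedN [] u [] = u"
  proof
    fix w show "embedN [] u [] w = u w" using len[of w] by (auto simp: embedN_def)
  qed
  then show ?thesis using Nn.emb[OF u, of "[]" "[]" 2] by simp
qed

text \<open>Consecutive vacuum letters have the least positive energy; a violation therefore shrinks
  by exactly one when a vacuum letter is absorbed.\<close>

lemma Hen_bgs: "Hen (bgs gs m) (bgs gs (m + 1)) = 1"
  by (cases gs) (simp_all add: Hen_def bgs_def)

text \<open>Outer induction on the power of q, inner induction on the size -H of the violation. Tail
  terms have a factor q and use the outer hypothesis; the partner term has none, but its second
  letter violates the next vacuum letter by one less.\<close>

theorem violating_letter_vanishes:
  "validB c \<Longrightarrow> Hen c (bgs gs (m + 1)) \<le> 0 \<Longrightarrow> inqL gs m k 1 (delta [c])"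
proof (induction k arbitrary: m c)
  case 0
  then show ?case by (intro inqL_0_Ltens Ltens_delta) simp_all
next
  case (Suc k)
  note IHk = Suc.IH
  from Suc.prems show ?case
  proof (induction "nat (- Hen c (bgs gs (m + 1)))" arbitrary: m c rule: less_induct)
    case less
    define b where "b = bgs gs (m + 1)"
    define h where "h = henergy (snd c) (snd b)"
    have b: "validB b" unfolding b_def by (rule validB_bgs)
    obtain ys where ys: "(\<lambda>w. delta [c, b] w + (if Hen c b = 0 then 0 else
        delta [(fst b + h, snd c), (fst c - h, snd b)] w) + qq * lc ys w) \<in> Nsp"
      "\<And>d v. (d, v) \<in> set ys \<Longrightarrow> d \<in> Areg \<and> (\<exists>x' y'. v = [x', y'] \<and> validB x' \<and> validB y' \<and>
        same_weight [c, b] [x', y'] \<and> min (fst c) (fst b) \<le> min (fst x') (fst y') \<and>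
        letter_measure x' < letter_measure c)"
      by (rule straighten_pair[OF less.prems(1) b less.prems(2)[folded b_def], folded h_def]) (erule that, blast)
    \<comment> \<open>The tail is first brought to normally ordered pairs, the form in which
      \<open>violation_persists\<close> controls the second letter.\<close>
    have "\<exists>xs. straightens [c, b] xs \<and> (\<lambda>u. lc ys u - lc xs u) \<in> Nn 2"
    proof (rule straighten_combination)
      fix d v assume "(d, v) \<in> set ys"
      then obtain x' y' where "d \<in> Areg" "v = [x', y']" "validB x'" "validB y'" "same_weight [c, b] [x', y']"
        using ys(2) by blast
      then show "d \<in> Areg \<and> same_weight [c, b] v \<and> (\<exists>xs. straightens v xs \<and> (\<lambda>u. delta v u - lc xs u) \<in> Nn 2)"
        using straighten_word[of v] by (simp add: numeral_2_eq_2)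
    qed
    then obtain xs where xs: "straightens [c, b] xs" "(\<lambda>u. lc ys u - lc xs u) \<in> Nn 2" by blast
    have 1: "inqL gs m k 2 (lc xs)"
    proof (rule inqL_lc)
      fix d v assume "(d, v) \<in> set xs"
      then have v: "d \<in> Areg" "normal v" "\<forall>x\<in>set v. validB x" "same_weight [c, b] v"
        using xs(1) by (auto simp: straightens_def)
      obtain c1 c2 where c12: "v = [c1, c2]" "validB c1" "validB c2" "Hen c2 (bgs gs (m + 1 + 1)) \<le> 0"
        using violation_persists[OF less.prems v(4)[unfolded b_def] v(2,3)] .
      have "inqL gs m k (Suc 1) (lmul c1 (delta [c2]))"
        by (rule inqL_lmul[OF IHk[OF c12(3,4)] c12(2)])
      then show "d \<in> Areg \<and> inqL gs m k 2 (delta v)" using v(1) c12(1) by (simp add: numeral_2_eq_2)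
    qed
    have 2: "inqL gs m (Suc k) 2 (\<lambda>w. if Hen c b = 0 then 0 else delta [(fst b + h, snd c), (fst c - h, snd b)] w)"
    \<comment> \<open>At energy 0 there is no partner term, so the inner induction stops
      here.\<close>
    proof (cases "Hen c b = 0")
      case True
      then show ?thesis by (simp add: inqL_Nn Nn.zero)
    next
      case False
      have Hcb: "Hen c b = h - fst c + fst b" by (simp add: Hen_def h_def henergy_def)
      have "Hen (fst c - h, snd b) (bgs gs (m + 1 + 1)) = Hen b (bgs gs (m + 1 + 1)) + fst b - (fst c - h)"
        by (simp add: Hen_def)
      also have "\<dots> = 1 + Hen c b"
        unfolding b_def Hen_bgs Hcb[unfolded b_def] by simp
      finally have *: "Hen (fst c - h, snd b) (bgs gs (m + 1 + 1)) = 1 + Hen c b" .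
      have "inqL gs (m + 1) (Suc k) 1 (delta [(fst c - h, snd b)])"
        using * False less.prems b by (intro less.hyps) (auto simp: b_def[symmetric] validB_def)
      then have "inqL gs m (Suc k) (Suc 1) (lmul (fst b + h, snd c) (delta [(fst c - h, snd b)]))"
        by (rule inqL_lmul) (use less.prems in \<open>simp add: validB_def\<close>)
      then show ?thesis using False by (simp add: numeral_2_eq_2)
    qed
    have 3: "inqL gs m (Suc k) 2 (\<lambda>w. qq * (lc ys w - lc xs w))"
      by (intro inqL_Nn Nn.smult xs)
    \<comment> \<open>The pair is the relation minus the partner minus q times the tail, where the
      tail is its straightened form plus an element of N.\<close>
    have "inqL gs m (Suc k) 2 (\<lambda>w. (delta [c, b] w + (if Hen c b = 0 then 0 else
        delta [(fst b + h, snd c), (fst c - h, snd b)] w) + qq * lc ys w)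
        + (-1) * ((if Hen c b = 0 then 0 else delta [(fst b + h, snd c), (fst c - h, snd b)] w)
        + (qq * lc xs w + qq * (lc ys w - lc xs w))))"
      by (intro inqL_add inqL_scale_Areg 2 3 inqL_qq 1 inqL_Nn Nsp_Nn2 ys Areg_uminus Areg_1)
    then have "inqL gs m (Suc k) 2 (delta [c, b])"
      by (simp add: algebra_simps cong: if_cong)
    moreover have "ext gs m 1 2 (delta [c]) = delta [c, b]"
      using ext_delta[of "[c]" 1 2 gs m] by (simp add: vac_def b_def numeral_2_eq_2)
    ultimately show ?case by (intro inqL_ext[of gs m "Suc k" 2 1]) simp_all
  qed
qed

lemma inqL_violating_word:
  "\<forall>x\<in>set p. validB x \<Longrightarrow> validB c \<Longrightarrow> Hen c (bgs gs (m + int (Suc (length p)))) \<le> 0 \<Longrightarrow>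
    inqL gs m k (Suc (length p)) (delta (p @ [c]))"
proof (induction p arbitrary: m)
  case Nil
  then show ?case using violating_letter_vanishes[of c gs m k] by simp
next
  case (Cons x p)
  have "inqL gs (m + 1) k (Suc (length p)) (delta (p @ [c]))"
    using Cons.prems by (intro Cons.IH) (simp_all add: algebra_simps)
  from inqL_lmul[OF this, of x] show ?case using Cons.prems by simp
qed

text \<open>Consecutive values of \<open>wcoord\<close> differ by the energy of the adjacent
  letters.\<close>

lemma wsorted_map:
  assumes "\<And>k. 0 < Hen (c k) (c (Suc k))"
  shows "wsorted n (map c [0..<n])"
  unfolding wsorted_def
proof (intro allI impI)
  fix i assume "Suc i < n"
  then show "wcoord (map c [0..<n]) i < wcoord (map c [0..<n]) (Suc i)"
    using assms[of i] by (simp add: wcoord_def Hen_def henergy_def)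
qed

lemma zeroF_add: "zeroF gs m r u \<Longrightarrow> zeroF gs m r v \<Longrightarrow> zeroF gs m r (\<lambda>w. u w + v w)"
  by (simp add: zeroF_def inqL_add)

text \<open>A pole of c is absorbed by starting from a higher power of q, available because u lies
  in every q^n L.\<close>

lemma zeroF_scale:
  assumes "zeroF gs m r u" shows "zeroF gs m r (\<lambda>w. c * u w)"
  unfolding zeroF_def
proof (intro allI impI)
  fix n :: nat assume "0 < n"
  obtain N where "qq ^ N * c \<in> Areg" using ex_qq_power_clear by blast
  moreover have "inqL gs m (n + N) r u" using assms \<open>0 < n\<close> by (simp add: zeroF_def)
  ultimately show "inqL gs m n r (\<lambda>w. c * u w)" using inqL_scale by blast
qed

lemma zeroF_Nn: "u \<in> Nn r \<Longrightarrow> zeroF gs m r u"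
  by (simp add: zeroF_def inqL_Nn)

section \<open>Spanning\<close>

definition normal_combination :: "GS \<Rightarrow> int \<Rightarrow> nat \<Rightarrow> tens \<Rightarrow> bool" where
  "normal_combination gs m r u \<longleftrightarrow> (\<exists>S a. finite S \<and>
     (\<forall>c\<in>S. normord gs m c \<and> (\<forall>k\<ge>r. c k = bgs gs (m + int k))) \<and>
     zeroF gs m r (\<lambda>w. u w - (\<Sum>c\<in>S. a c * gtens r c w)))"

lemma normal_combination_zeroF: "zeroF gs m r u \<Longrightarrow> normal_combination gs m r u"
  unfolding normal_combination_def by (intro exI[of _ "{}"]) simp

lemma normal_combination_add:
  assumes "normal_combination gs m r u" "normal_combination gs m r v"
  shows "normal_combination gs m r (\<lambda>w. u w + v w)"
proof -
  obtain S a where S: "finite S" "\<forall>c\<in>S. normord gs m c \<and> (\<forall>k\<ge>r. c k = bgs gs (m + int k))"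
    "zeroF gs m r (\<lambda>w. u w - (\<Sum>c\<in>S. a c * gtens r c w))"
    using assms(1) unfolding normal_combination_def by auto
  obtain T b where T: "finite T" "\<forall>c\<in>T. normord gs m c \<and> (\<forall>k\<ge>r. c k = bgs gs (m + int k))"
    "zeroF gs m r (\<lambda>w. v w - (\<Sum>c\<in>T. b c * gtens r c w))"
    using assms(2) unfolding normal_combination_def by auto
  define d where "d c = (if c \<in> S then a c else 0) + (if c \<in> T then b c else 0)" for c
  have "(\<Sum>c\<in>S \<union> T. d c * gtens r c w) = (\<Sum>c\<in>S. a c * gtens r c w) + (\<Sum>c\<in>T. b c * gtens r c w)" for w
  proof -
    have "(\<Sum>c\<in>S \<union> T. d c * gtens r c w)
      = (\<Sum>c\<in>S \<union> T. (if c \<in> S then a c else 0) * gtens r c w) + (\<Sum>c\<in>S \<union> T. (if c \<in> T then b c else 0) * gtens r c w)"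
      by (simp add: d_def distrib_right sum.distrib)
    also have "(\<Sum>c\<in>S \<union> T. (if c \<in> S then a c else 0) * gtens r c w) = (\<Sum>c\<in>S. a c * gtens r c w)"
      using S(1) T(1) by (intro sum.mono_neutral_cong_right) auto
    also have "(\<Sum>c\<in>S \<union> T. (if c \<in> T then b c else 0) * gtens r c w) = (\<Sum>c\<in>T. b c * gtens r c w)"
      using S(1) T(1) by (intro sum.mono_neutral_cong_right) auto
    finally show ?thesis .
  qed
  then have "zeroF gs m r (\<lambda>w. u w + v w - (\<Sum>c\<in>S \<union> T. d c * gtens r c w))"
    using zeroF_add[OF S(3) T(3)] by (simp add: algebra_simps)
  then show ?thesis
    unfolding normal_combination_def using S T by (intro exI[of _ "S \<union> T"] exI[of _ d]) auto
qed

lemma normal_combination_scale: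
  assumes "normal_combination gs m r u" shows "normal_combination gs m r (\<lambda>w. d * u w)"
proof -
  obtain S a where S: "finite S" "\<forall>c\<in>S. normord gs m c \<and> (\<forall>k\<ge>r. c k = bgs gs (m + int k))"
    "zeroF gs m r (\<lambda>w. u w - (\<Sum>c\<in>S. a c * gtens r c w))"
    using assms unfolding normal_combination_def by auto
  have "zeroF gs m r (\<lambda>w. d * u w - (\<Sum>c\<in>S. (d * a c) * gtens r c w))"
    using zeroF_scale[OF S(3), of d] by (simp add: right_diff_distrib sum_distrib_left mult.assoc)
  then show ?thesis
    unfolding normal_combination_def using S by (intro exI[of _ S] exI[of _ "\<lambda>c. d * a c"]) auto
qed

text \<open>Normal ordering can now fail only at the junction with the vacuum. If it does, the last
  letter is violating and the wedge vanishes in the Fock space.\<close>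

lemma normal_combination_normal:
  assumes "normal v" "\<forall>x\<in>set v. validB x"
  shows "normal_combination gs m (length v) (delta v)"
proof (cases "v = [] \<or> 0 < Hen (last v) (bgs gs (m + int (length v)))")
  case True
  define c where "c k = (if k < length v then v ! k else bgs gs (m + int k))" for k
  have H: "0 < Hen (c k) (c (Suc k))" for k
  proof -
    consider "Suc k < length v" | "Suc k = length v" | "length v \<le> k" by linarith
    then show ?thesis
    proof cases
      case 1
      then show ?thesis using successively_nth[OF assms(1), of k] by (simp add: c_def)
    next
      case 2
      then have len: "length v = Suc k" by simp
      then have "v \<noteq> []" by auto
      moreover from this have "last v = v ! k" using len by (simp add: last_conv_nth)
      ultimately show ?thesis using True 2 by (simp add: c_def)
    next
      case 3
      then show ?thesis using Hen_bgs[of gs "m + int k"] by (simp add: c_def add_ac)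
    qed
  qed
  have "map c [0..<length v] = v"
    by (rule nth_equalityI) (simp_all add: c_def)
  then have "gtens (length v) c = delta v" by (simp add: gtens_def)
  moreover have "normord gs m c"
    unfolding normord_def using H assms(2) validB_bgs
    by (auto simp: c_def intro!: exI[of _ "length v"])
  ultimately show ?thesis
    unfolding normal_combination_def
    by (intro exI[of _ "{c}"] exI[of _ "\<lambda>_. 1"]) (auto simp: c_def intro!: zeroF_Nn Nn.zero)
next
  case False
  then have v: "v = butlast v @ [last v]" by simp
  then have "zeroF gs m (length v) (delta v)"
    unfolding zeroF_def
    using inqL_violating_word[of "butlast v" "last v" gs m] False assms(2)
    by (metis in_set_butlastD last_in_set length_append_singleton linorder_not_less)
  then show ?thesis by (rule normal_combination_zeroF)
qed

text \<open>Straightening keeps the number of letters, so the combination is already found at stage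
  r.\<close>

theorem normal_combination_istens:
  assumes "istens r u" shows "normal_combination gs m r u"
proof -
  have zero: "normal_combination gs m r (\<lambda>w. 0)"
    by (intro normal_combination_zeroF zeroF_Nn Nn.zero)
  have lc: "normal_combination gs m r (lc xs)"
    if "\<And>c v. (c, v) \<in> set xs \<Longrightarrow> normal v \<and> (\<forall>x\<in>set v. validB x) \<and> length v = r" for xs
    using that
  proof (induction xs)
    case (Cons y xs)
    obtain c v where y: "y = (c, v)" by (cases y)
    have "normal_combination gs m r (delta v)"
      using normal_combination_normal[of v gs m] Cons.prems[of c v] y by auto
    moreover have "normal_combination gs m r (lc xs)"
    proof (rule Cons.IH)
      fix d w assume "(d, w) \<in> set xs"
      then show "normal w \<and> (\<forall>x\<in>set w. validB x) \<and> length w = r" using Cons.prems[of d w] by simp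
    qed
    ultimately show ?case
      unfolding y lc_Cons by (intro normal_combination_add normal_combination_scale)
  qed (simp add: zero)
  have word: "normal_combination gs m r (delta w)" if w: "length w = r" "\<forall>x\<in>set w. validB x" for w
  proof -
    obtain xs where xs: "straightens w xs" "(\<lambda>u. delta w u - lc xs u) \<in> Nn r"
      using straighten_word[OF w(2)] w(1) by blast
    have "normal_combination gs m r (lc xs)"
      using xs(1) w(1) by (intro lc) (auto simp: straightens_def same_weight_def)
    from normal_combination_add[OF this normal_combination_zeroF[OF zeroF_Nn[OF xs(2)]]]
    show ?thesis by simp
  qed
  have "normal_combination gs m r (\<lambda>x. \<Sum>w\<in>T. u w * delta w x)" if "finite T" "T \<subseteq> supp u" for T
    using that
  proof (induction T rule: finite_induct)
    case (insert w T)
    then have "normal_combination gs m r (\<lambda>x. u w * delta w x)"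
      using assms by (intro normal_combination_scale word) (auto simp: istens_def supp_def)
    then show ?case using insert by (simp add: normal_combination_add)
  qed (simp add: zero)
  then have "normal_combination gs m r (\<lambda>x. \<Sum>w\<in>supp u. u w * delta w x)"
    using assms by (simp add: istens_def)
  moreover have "(\<Sum>w\<in>supp u. u w * delta w x) = u x" for x
  proof -
    have "(\<Sum>w\<in>supp u. u w * delta w x) = (\<Sum>w\<in>supp u. if x = w then u w else 0)"
      by (intro sum.cong) (auto simp: delta_def)
    then show ?thesis using assms by (auto simp: istens_def supp_def)
  qed
  ultimately show ?thesis by simp
qed

section \<open>Independence\<close>

text \<open>Given a nonzero coefficient, scaling by the minimal power of q makes all coefficients
  regular and one nonzero at q = 0, against \<open>sorted_words_independent\<close>.\<close>

theorem normord_independent: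
  fixes gs :: GS and m :: int
  assumes "finite S" "\<forall>c\<in>S. normord gs m c \<and> (\<forall>k\<ge>R. c k = bgs gs (m + int k))"
    and zero: "zeroF gs m R (\<lambda>w. \<Sum>c\<in>S. a c * gtens R c w)"
  shows "\<forall>c\<in>S. a c = 0"
proof (rule ccontr)
  assume "\<not> ?thesis"
  then obtain c0 where c0: "c0 \<in> S" "a c0 \<noteq> 0" by blast
  obtain N b where b: "\<And>c. c \<in> S \<Longrightarrow> a c = qq powi N * b c"
    "\<And>c. c \<in> S \<Longrightarrow> b c \<in> Areg" "\<exists>c\<in>S. \<not> residue (b c) 0"
    using ex_common_leading_power[of S c0 a, OF assms(1) c0] by metis
  \<comment> \<open>Larger than N, so that a positive power q^j still multiplies the lattice element
    after division by q^N.\<close>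
  define n where "n = Suc (nat N)"
  have "inqL gs m n R (\<lambda>w. \<Sum>c\<in>S. a c * gtens R c w)" using zero by (simp add: zeroF_def n_def)
  then obtain R' v where R': "R \<le> R'" "v \<in> Ltens R'"
    and N: "(\<lambda>x. ext gs m R R' (\<lambda>w. \<Sum>c\<in>S. a c * gtens R c w) x - qq ^ n * v x) \<in> Nn R'"
    unfolding inqL_iff by blast
  define g where "g c = map c [0..<R']" for c :: "nat \<Rightarrow> bas"
  have ext_g: "ext gs m R R' (gtens R c) = delta (g c)" if "c \<in> S" for c
  proof -
    have "map c [0..<R] @ vac gs m R R' = map c [0..<R']"
    proof -
      have "vac gs m R R' = map c [R..<R']" unfolding vac_def using assms(2) that by auto
      then show ?thesis using R'(1) upt_add_eq_append[of 0 R "R' - R"] by simp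
    qed
    then show ?thesis using R'(1) by (simp add: gtens_def ext_delta g_def)
  qed
  \<comment> \<open>From R on all sequences in S agree with the vacuum, so their first R' letters
    determine them.\<close>
  have inj: "inj_on g S"
  proof (rule inj_onI, rule ext)
    fix c d k assume cd: "c \<in> S" "d \<in> S" "g c = g d"
    show "c k = d k"
    proof (cases "k < R'")
      case True
      then have "g c ! k = c k" "g d ! k = d k" by (simp_all add: g_def)
      then show ?thesis using cd by simp
    next
      case False
      then have "R \<le> k" using R'(1) by simp
      then have "c k = bgs gs (m + int k)" "d k = bgs gs (m + int k)"
        using assms(2) cd(1,2) by blast+
      then show ?thesis by simp
    qed
  qed
  define j where "j = nat (int n - N)"
  have j: "0 < j" by (simp add: j_def n_def)
  have qj: "qq powi (- N) * qq ^ n = qq ^ j"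
  proof -
    have "qq powi (- N) * qq ^ n = qq powi (int n - N)"
      by (simp add: power_int_add[symmetric] flip: power_int_of_nat)
    also have "\<dots> = qq ^ j" using j by (simp add: j_def power_int_def)
    finally show ?thesis .
  qed
  have ab: "qq powi (- N) * a c = b c" if "c \<in> S" for c
    unfolding b(1)[OF that] by (simp add: power_int_minus)
  define b' where "b' w = b (the_inv_into S g w)" for w
  have "(\<lambda>x. qq powi (- N) * (ext gs m R R' (\<lambda>w. \<Sum>c\<in>S. a c * gtens R c w) x - qq ^ n * v x)) \<in> Nn R'"
    using N by (rule Nn.smult)
  moreover have "qq powi (- N) * (ext gs m R R' (\<lambda>w. \<Sum>c\<in>S. a c * gtens R c w) x - qq ^ n * v x)
     = (\<Sum>s\<in>g ` S. b' s * delta s x) - qq ^ j * v x" for x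
  proof -
    have "qq powi (- N) * ext gs m R R' (\<lambda>w. \<Sum>c\<in>S. a c * gtens R c w) x = (\<Sum>c\<in>S. b c * delta (g c) x)"
      unfolding ext_sum ext_scale sum_distrib_left
      by (intro sum.cong refl) (simp add: ext_g ab mult.assoc[symmetric])
    also have "\<dots> = (\<Sum>s\<in>g ` S. b' s * delta s x)"
      using inj by (simp add: sum.reindex b'_def the_inv_into_f_f)
    finally show ?thesis by (simp add: right_diff_distrib qj mult.assoc[symmetric])
  qed
  ultimately have "(\<lambda>x. (\<Sum>s\<in>g ` S. b' s * delta s x) - qq ^ j * v x) \<in> Nn R'" by simp
  then have "\<forall>s\<in>g ` S. residue (b' s) 0"
  proof (rule sorted_words_independent[rotated -1])
    show "finite (g ` S)" using assms(1) by simp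
    show "length s = R' \<and> (\<forall>x\<in>set s. validB x) \<and> wsorted R' s" if "s \<in> g ` S" for s
      using that assms(2) wsorted_map[of _ R'] by (auto simp: g_def normord_def)
    show "b' s \<in> Areg" if "s \<in> g ` S" for s
      using that b(2) inj by (auto simp: b'_def the_inv_into_f_f)
  qed (use R' j in auto)
  then have "\<forall>c\<in>S. residue (b c) 0" using inj by (simp add: b'_def the_inv_into_f_f)
  then show False using b(3) by blast
qed

theorem mainTheorem7:
  fixes gs :: GS and m :: int
  shows "(\<forall>(R::nat) (S :: (nat \<Rightarrow> bas) set) (a :: (nat \<Rightarrow> bas) \<Rightarrow> K).
            finite S \<and> (\<forall>c\<in>S. normord gs m c \<and> (\<forall>k\<ge>R. c k = bgs gs (m + int k))) \<and>
            zeroF gs m R (\<lambda>w. \<Sum>c\<in>S. a c * gtens R c w)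
            \<longrightarrow> (\<forall>c\<in>S. a c = 0))
       \<and> (\<forall>(r::nat) (u::tens). istens r u \<longrightarrow>
            (\<exists>R\<ge>r. \<exists>(S :: (nat \<Rightarrow> bas) set) (a :: (nat \<Rightarrow> bas) \<Rightarrow> K).
               finite S \<and> (\<forall>c\<in>S. normord gs m c \<and> (\<forall>k\<ge>R. c k = bgs gs (m + int k))) \<and>
               zeroF gs m R (\<lambda>w. ext gs m r R u w - (\<Sum>c\<in>S. a c * gtens R c w))))"
proof (intro conjI allI impI)
  fix R :: nat and S :: "(nat \<Rightarrow> bas) set" and a :: "(nat \<Rightarrow> bas) \<Rightarrow> K"
  assume "finite S \<and> (\<forall>c\<in>S. normord gs m c \<and> (\<forall>k\<ge>R. c k = bgs gs (m + int k))) \<and>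
            zeroF gs m R (\<lambda>w. \<Sum>c\<in>S. a c * gtens R c w)"
  then show "\<forall>c\<in>S. a c = 0" using normord_independent by blast
next
  fix r :: nat and u :: tens assume u: "istens r u"
  then have "ext gs m r r u = u" by (intro ext_same) (simp add: istens_def)
  then show "\<exists>R\<ge>r. \<exists>(S :: (nat \<Rightarrow> bas) set) (a :: (nat \<Rightarrow> bas) \<Rightarrow> K).
               finite S \<and> (\<forall>c\<in>S. normord gs m c \<and> (\<forall>k\<ge>R. c k = bgs gs (m + int k))) \<and>
               zeroF gs m R (\<lambda>w. ext gs m r R u w - (\<Sum>c\<in>S. a c * gtens R c w))"
    using normal_combination_istens[OF u, of gs m] unfolding normal_combination_def
    by (intro exI[of _ r]) simp
qed

end
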